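(* Let $A=\mathbb{K}Q/J^2$ be a radical square zero algebra, where $Q$ has $n$ vertices. If $0<\phi\dim(A)\le n-1$, then $\psi\dim(A)\le n-1+d$, where $d$ is the length of the largest path in the member $M(Q)$ ending in a sink of $Q$ (with $d=0$ if $Q$ has no sink).
   Context: $\mathbb{K}$ is a field, $Q$ is a finite connected quiver, $J$ is the ideal of $\mathbb{K}Q$ generated by the arrows. Modules are finitely generated right modules, with the convention that the simple modules $S_i$ (one per vertex) satisfy $\Omega(S_i)=\bigoplus_{\alpha:i\to j}S_j$. $A_0$ is the direct sum of all simple modules $S_i$. The heart $C(Q)$ is the full subquiver of $Q$ on the vertices whose simple modules lie both in the support of $\Omega^n(A_0)$ and in the support of $\Omega^{-n}(A_0)$ ($\Omega^{-n}$ is the $n$-th cosyzygy); the member $M(Q)$ is the full subquiver on the vertices not in the heart. $K_0(A)$ is the abelian group generated by symbols $[M]$, one for each isomorphism class of finitely generated $A$-modules, modulo the relations $[M]-[M']-[M'']$ whenever $M\cong M'\oplus M''$ and $[P]$ for each projective $P$. The syzygy $\Omega$ induces a group endomorphism $\overline{\Omega}:K_0(A)\to K_0(A)$. For a module $M$, $\langle \mathrm{add}\, M\rangle$ is the subgroup of $K_0(A)$ generated by the classes of the indecomposable direct summands of $M$, and $\phi(M)=\min\{l\in\mathbb{N}: \overline{\Omega}|_{\overline{\Omega}^{l+s}\langle \mathrm{add}\, M\rangle}\text{ is injective for all } s\in\mathbb{N}\}$ ($0\in\mathbb{N}$). The second Igusa-Todorov function is $\psi(M)=\phi(M)+\sup\{\mathrm{pd}(N):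 N \text{ is a direct summand of }\Omega^{\phi(M)}(M)\text{ with }\mathrm{pd}(N)<\infty\}$. $\phi\dim(A)=\sup\{\phi(M): M\in \mathrm{mod}\,A\}$ and $\psi\dim(A)=\sup\{\psi(M): M\in\mathrm{mod}\,A\}$. *)

theory Defs
  imports
    "Graph_Theory.Graph_Theory"
    "HOL-Algebra.Free_Abelian_Groups"
    "HOL-Algebra.Generated_Groups"
    "HOL-Algebra.Ideal_Product"
    "HOL-Algebra.QuotRing"
    "HOL-Library.Extended_Nat"
begin

section \<open>Finitely generated right modules over a ring\<close>

text \<open>Like the module records of HOL-Algebra, the module record extends the ring record
  only in order to reuse its additive structure; its multiplication and unit are never used.\<close>

record ('r, 'm) rmodule = "'m ring" +
  ract :: "'m \<Rightarrow> 'r \<Rightarrow> 'm" (infixl "\<triangleleft>\<index>" 70)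

locale right_module = R?: ring R + M?: abelian_group M
  for R :: "('r, 'u) ring_scheme" (structure) and M :: "('r, 'm) rmodule" (structure) +
  assumes ract_closed [simp, intro]:
      "\<lbrakk>x \<in> carrier M; a \<in> carrier R\<rbrakk> \<Longrightarrow> x \<triangleleft>\<^bsub>M\<^esub> a \<in> carrier M"
    and ract_l_distr:
      "\<lbrakk>x \<in> carrier M; y \<in> carrier M; a \<in> carrier R\<rbrakk> \<Longrightarrow>
        (x \<oplus>\<^bsub>M\<^esub> y) \<triangleleft>\<^bsub>M\<^esub> a = (x \<triangleleft>\<^bsub>M\<^esub> a) \<oplus>\<^bsub>M\<^esub> (y \<triangleleft>\<^bsub>M\<^esub> a)"
    and ract_r_distr:
      "\<lbrakk>x \<in> carrier M; a \<in> carrier R; b \<in> carrier R\<rbrakk> \<Longrightarrow>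
        x \<triangleleft>\<^bsub>M\<^esub> (a \<oplus>\<^bsub>R\<^esub> b) = (x \<triangleleft>\<^bsub>M\<^esub> a) \<oplus>\<^bsub>M\<^esub> (x \<triangleleft>\<^bsub>M\<^esub> b)"
    and ract_assoc:
      "\<lbrakk>x \<in> carrier M; a \<in> carrier R; b \<in> carrier R\<rbrakk> \<Longrightarrow>
        x \<triangleleft>\<^bsub>M\<^esub> (a \<otimes>\<^bsub>R\<^esub> b) = (x \<triangleleft>\<^bsub>M\<^esub> a) \<triangleleft>\<^bsub>M\<^esub> b"
    and ract_one [simp]: "x \<in> carrier M \<Longrightarrow> x \<triangleleft>\<^bsub>M\<^esub> \<one>\<^bsub>R\<^esub> = x"

definition submod :: "('r, 'u) ring_scheme \<Rightarrow> ('r, 'm) rmodule \<Rightarrow> 'm set \<Rightarrow> bool" where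
  "submod R M N \<longleftrightarrow>
     additive_subgroup N M \<and> (\<forall>x\<in>N. \<forall>a\<in>carrier R. x \<triangleleft>\<^bsub>M\<^esub> a \<in> N)"

definition fin_gen :: "('r, 'u) ring_scheme \<Rightarrow> ('r, 'm) rmodule \<Rightarrow> bool" where
  "fin_gen R M \<longleftrightarrow>
     (\<exists>X. finite X \<and> X \<subseteq> carrier M \<and> (\<forall>N. submod R M N \<and> X \<subseteq> N \<longrightarrow> N = carrier M))"

text \<open>Every finitely generated module over a ring with elements of type \<open>'r\<close> is isomorphic to one
  whose carrier is a set of functions \<open>nat \<Rightarrow> 'r\<close> (represent each element by its coefficients with
  respect to a finite generating family; see \<open>fgmod_copy_exists\<close> below). So this set is the class of
  objects of mod-\<open>R\<close> up to isomorphism, for the given element type.\<close>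

definition fgmod :: "('r, 'u) ring_scheme \<Rightarrow> ('r, nat \<Rightarrow> 'r) rmodule set" where
  "fgmod R = {M. right_module R M \<and> fin_gen R M}"

definition rhom :: "('r, 'u) ring_scheme \<Rightarrow> ('r, 'm) rmodule \<Rightarrow> ('r, 'n) rmodule \<Rightarrow> ('m \<Rightarrow> 'n) set" where
  "rhom R M N = {h \<in> carrier M \<rightarrow> carrier N.
     (\<forall>x\<in>carrier M. \<forall>y\<in>carrier M. h (x \<oplus>\<^bsub>M\<^esub> y) = h x \<oplus>\<^bsub>N\<^esub> h y) \<and>
     (\<forall>x\<in>carrier M. \<forall>a\<in>carrier R. h (x \<triangleleft>\<^bsub>M\<^esub> a) = h x \<triangleleft>\<^bsub>N\<^esub> a)}"

definition riso :: "('r, 'u) ring_scheme \<Rightarrow> ('r, 'm) rmodule \<Rightarrow> ('r, 'n) rmodule \<Rightarrow> bool" where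
  "riso R M N \<longleftrightarrow> (\<exists>h \<in> rhom R M N. bij_betw h (carrier M) (carrier N))"

definition dsum :: "('r, 'm) rmodule \<Rightarrow> ('r, 'n) rmodule \<Rightarrow> ('r, 'm \<times> 'n) rmodule" where
  "dsum M N = \<lparr>carrier = carrier M \<times> carrier N, mult = undefined, one = undefined,
     zero = (\<zero>\<^bsub>M\<^esub>, \<zero>\<^bsub>N\<^esub>),
     add = (\<lambda>(x, y) (x', y'). (x \<oplus>\<^bsub>M\<^esub> x', y \<oplus>\<^bsub>N\<^esub> y')),
     ract = (\<lambda>(x, y) a. (x \<triangleleft>\<^bsub>M\<^esub> a, y \<triangleleft>\<^bsub>N\<^esub> a))\<rparr>"

text \<open>The direct sum of a \<^emph>\<open>finite\<close> family, where it coincides with the direct product.\<close>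

definition dsum_family :: "'i set \<Rightarrow> ('i \<Rightarrow> ('r, 'm) rmodule) \<Rightarrow> ('r, 'i \<Rightarrow> 'm) rmodule" where
  "dsum_family I M = \<lparr>carrier = (\<Pi>\<^sub>E i\<in>I. carrier (M i)), mult = undefined, one = undefined,
     zero = (\<lambda>i\<in>I. \<zero>\<^bsub>M i\<^esub>),
     add = (\<lambda>x y. \<lambda>i\<in>I. x i \<oplus>\<^bsub>M i\<^esub> y i),
     ract = (\<lambda>x a. \<lambda>i\<in>I. x i \<triangleleft>\<^bsub>M i\<^esub> a)\<rparr>"

context right_module
begin

lemma ract_zero_left: "a \<in> carrier R \<Longrightarrow> \<zero>\<^bsub>M\<^esub> \<triangleleft>\<^bsub>M\<^esub> a = \<zero>\<^bsub>M\<^esub>"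
  by (metis M.add.r_cancel_one' M.zero_closed M.r_zero ract_closed ract_l_distr)

lemma ract_zero_right: "x \<in> carrier M \<Longrightarrow> x \<triangleleft>\<^bsub>M\<^esub> \<zero>\<^bsub>R\<^esub> = \<zero>\<^bsub>M\<^esub>"
  by (metis M.add.r_cancel_one' R.zero_closed R.r_zero ract_closed ract_r_distr)

lemma ract_minus_right:
  assumes "x \<in> carrier M" "a \<in> carrier R"
  shows "x \<triangleleft>\<^bsub>M\<^esub> (\<ominus>\<^bsub>R\<^esub> a) = \<ominus>\<^bsub>M\<^esub> (x \<triangleleft>\<^bsub>M\<^esub> a)"
  using assms ract_r_distr[of x "\<ominus>\<^bsub>R\<^esub> a" a] ract_zero_right
  by (metis M.minus_equality R.a_inv_closed R.l_neg ract_closed)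

lemma submod_span:
  fixes n :: nat
  assumes Y: "\<And>i. i < n \<Longrightarrow> y i \<in> carrier M"
  shows "submod R M {(\<Oplus>\<^bsub>M\<^esub>i\<in>{..<n}. y i \<triangleleft>\<^bsub>M\<^esub> c i) | c. \<forall>i<n. c i \<in> carrier R}" (is "submod R M ?L")
proof -
  have act: "(\<Oplus>\<^bsub>M\<^esub>i\<in>{..<k}. y i \<triangleleft>\<^bsub>M\<^esub> c i) \<triangleleft>\<^bsub>M\<^esub> a = (\<Oplus>\<^bsub>M\<^esub>i\<in>{..<k}. y i \<triangleleft>\<^bsub>M\<^esub> (c i \<otimes>\<^bsub>R\<^esub> a))"
    if "\<forall>i<n. c i \<in> carrier R" "a \<in> carrier R" "k \<le> n" for k c a
    using that(3)
  proof (induct k)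
    case 0 then show ?case using that by (simp add: ract_zero_left)
  next
    case (Suc k)
    have 1: "(\<lambda>i. y i \<triangleleft>\<^bsub>M\<^esub> c i) \<in> {..<k} \<rightarrow> carrier M" "(\<lambda>i. y i \<triangleleft>\<^bsub>M\<^esub> (c i \<otimes>\<^bsub>R\<^esub> a)) \<in> {..<k} \<rightarrow> carrier M"
      using Suc.prems that Y by auto
    have 2: "y k \<triangleleft>\<^bsub>M\<^esub> c k \<in> carrier M" "y k \<triangleleft>\<^bsub>M\<^esub> (c k \<otimes>\<^bsub>R\<^esub> a) \<in> carrier M"
      using Suc.prems that Y by auto
    show ?case
      using Suc 1 2 that Y
      by (simp add: lessThan_Suc M.finsum_insert ract_l_distr M.finsum_closed ract_assoc)
  qed
  have cl: "?L \<subseteq> carrier M"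
    using Y by (auto intro!: M.finsum_closed)
  have "subgroup ?L (add_monoid M)"
  proof (rule group.subgroupI)
    show "group (add_monoid M)" by (rule M.a_group)
    show "?L \<subseteq> carrier (add_monoid M)" using cl by simp
    show "?L \<noteq> {}" by (auto intro!: exI[of _ "\<lambda>_. \<zero>\<^bsub>R\<^esub>"])
  next
    fix v assume "v \<in> ?L"
    then obtain c where c: "v = (\<Oplus>\<^bsub>M\<^esub>i\<in>{..<n}. y i \<triangleleft>\<^bsub>M\<^esub> c i)" "\<forall>i<n. c i \<in> carrier R" by auto
    let ?w = "\<Oplus>\<^bsub>M\<^esub>i\<in>{..<n}. y i \<triangleleft>\<^bsub>M\<^esub> (c i \<otimes>\<^bsub>R\<^esub> \<ominus>\<^bsub>R\<^esub> \<one>\<^bsub>R\<^esub>)"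
    have v: "v \<in> carrier M" using c Y by (auto intro!: M.finsum_closed)
    have "\<ominus>\<^bsub>M\<^esub> v = v \<triangleleft>\<^bsub>M\<^esub> (\<ominus>\<^bsub>R\<^esub> \<one>\<^bsub>R\<^esub>)"
      using v by (simp add: ract_minus_right)
    also have "\<dots> = ?w" unfolding c(1) using act[of c "\<ominus>\<^bsub>R\<^esub> \<one>\<^bsub>R\<^esub>" n] c(2) by simp
    finally show "inv\<^bsub>add_monoid M\<^esub> v \<in> ?L"
      unfolding a_inv_def[symmetric] using c(2)
      by (auto intro!: exI[of _ "\<lambda>i. c i \<otimes>\<^bsub>R\<^esub> \<ominus>\<^bsub>R\<^esub> \<one>\<^bsub>R\<^esub>"])
  next
    fix v w assume "v \<in> ?L" "w \<in> ?L"
    then obtain c d where c: "v = (\<Oplus>\<^bsub>M\<^esub>i\<in>{..<n}. y i \<triangleleft>\<^bsub>M\<^esub> c i)" "\<forall>i<n. c i \<in> carrier R"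
      and d: "w = (\<Oplus>\<^bsub>M\<^esub>i\<in>{..<n}. y i \<triangleleft>\<^bsub>M\<^esub> d i)" "\<forall>i<n. d i \<in> carrier R" by auto
    have "v \<oplus>\<^bsub>M\<^esub> w = (\<Oplus>\<^bsub>M\<^esub>i\<in>{..<n}. (y i \<triangleleft>\<^bsub>M\<^esub> c i) \<oplus>\<^bsub>M\<^esub> (y i \<triangleleft>\<^bsub>M\<^esub> d i))"
      unfolding c d using c d Y by (intro M.finsum_addf[symmetric]) auto
    also have "\<dots> = (\<Oplus>\<^bsub>M\<^esub>i\<in>{..<n}. y i \<triangleleft>\<^bsub>M\<^esub> (c i \<oplus>\<^bsub>R\<^esub> d i))"
      using c d Y by (intro M.finsum_cong') (auto simp: ract_r_distr)
    finally show "v \<otimes>\<^bsub>add_monoid M\<^esub> w \<in> ?L"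
      using c d by (auto intro!: exI[of _ "\<lambda>i. c i \<oplus>\<^bsub>R\<^esub> d i"])
  qed
  moreover have "v \<triangleleft>\<^bsub>M\<^esub> a \<in> ?L" if v: "v \<in> ?L" and a: "a \<in> carrier R" for v a
  proof -
    obtain c where c: "v = (\<Oplus>\<^bsub>M\<^esub>i\<in>{..<n}. y i \<triangleleft>\<^bsub>M\<^esub> c i)" "\<forall>i<n. c i \<in> carrier R" using v by auto
    show ?thesis unfolding c(1) act[OF c(2) a order_refl]
      using c a by (auto intro!: exI[of _ "\<lambda>i. c i \<otimes>\<^bsub>R\<^esub> a"])
  qed
  ultimately show ?thesis unfolding submod_def additive_subgroup_def by blast
qed

lemma span_inj:
  assumes "fin_gen R M"
  shows "\<exists>h :: 'm \<Rightarrow> nat \<Rightarrow> 'r. inj_on h (carrier M)"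
proof -
  obtain S where S: "finite S" "S \<subseteq> carrier M"
    "\<And>N. submod R M N \<Longrightarrow> S \<subseteq> N \<Longrightarrow> N = carrier M"
    using assms unfolding fin_gen_def by blast
  obtain xs where xs: "set xs = S" using finite_list[OF S(1)] by blast
  let ?n = "length xs" and ?y = "\<lambda>i. xs ! i"
  let ?s = "\<lambda>c. (\<Oplus>\<^bsub>M\<^esub>i\<in>{..<length xs}. xs ! i \<triangleleft>\<^bsub>M\<^esub> c i)"
  let ?L = "{?s c | c. \<forall>i<?n. c i \<in> carrier R}"
  have y: "?y i \<in> carrier M" if "i < ?n" for i using that xs S(2) nth_mem by blast
  have sub: "submod R M ?L" by (rule submod_span) (rule y)
  have "S \<subseteq> ?L"
  proof
    fix x assume "x \<in> S"
    then obtain j where j: "j < ?n" "xs ! j = x" using xs by (metis in_set_conv_nth)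
    let ?c = "\<lambda>i. if i = j then \<one>\<^bsub>R\<^esub> else \<zero>\<^bsub>R\<^esub>"
    have "?s ?c = (\<Oplus>\<^bsub>M\<^esub>i\<in>{..<?n}. if j = i then ?y i else \<zero>\<^bsub>M\<^esub>)"
      using y by (intro M.finsum_cong') (auto simp: ract_zero_right)
    also have "\<dots> = x" using y j by (subst M.finsum_singleton) auto
    finally have "x = ?s ?c" by simp
    then show "x \<in> ?L" by (auto intro!: exI[of _ ?c])
  qed
  then have L: "?L = carrier M" using S(3) sub by blast
  have "\<forall>x\<in>carrier M. \<exists>c. ?s c = x" unfolding L[symmetric] by blast
  then obtain h where "\<forall>x\<in>carrier M. ?s (h x) = x" by metis
  then have "inj_on h (carrier M)" by (intro inj_on_inverseI[where g = ?s]) blast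
  then show ?thesis by blast
qed

end

lemma fgmod_copy_exists:
  fixes R :: "('r, 'u) ring_scheme" and M :: "('r, 'm) rmodule"
  assumes "right_module R M" "fin_gen R M"
  shows "\<exists>N \<in> fgmod R. riso R M N"
proof -
  interpret right_module R M by fact
  obtain h :: "'m \<Rightarrow> nat \<Rightarrow> 'r" where h: "inj_on h (carrier M)" using span_inj assms(2) by blast
  define g where "g = inv_into (carrier M) h"
  have gh [simp]: "g (h x) = x" if "x \<in> carrier M" for x
    using that h unfolding g_def by simp
  define N :: "('r, nat \<Rightarrow> 'r) rmodule" where
    "N = \<lparr>carrier = h ` carrier M, mult = undefined, one = undefined, zero = h \<zero>\<^bsub>M\<^esub>,
          add = (\<lambda>x y. h (g x \<oplus>\<^bsub>M\<^esub> g y)), ract = (\<lambda>x a. h (g x \<triangleleft>\<^bsub>M\<^esub> a))\<rparr>"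
  have N [simp]: "carrier N = h ` carrier M" "\<zero>\<^bsub>N\<^esub> = h \<zero>\<^bsub>M\<^esub>"
    "\<And>x y. x \<oplus>\<^bsub>N\<^esub> y = h (g x \<oplus>\<^bsub>M\<^esub> g y)" "\<And>x a. x \<triangleleft>\<^bsub>N\<^esub> a = h (g x \<triangleleft>\<^bsub>M\<^esub> a)"
    by (simp_all add: N_def)
  have "abelian_group N"
  proof (rule abelian_groupI)
    fix x assume "x \<in> carrier N"
    then obtain v where "v \<in> carrier M" "x = h v" by auto
    then show "\<exists>y\<in>carrier N. y \<oplus>\<^bsub>N\<^esub> x = \<zero>\<^bsub>N\<^esub>"
      by (intro bexI[of _ "h (\<ominus>\<^bsub>M\<^esub> v)"]) (auto simp: M.l_neg)
  qed (auto simp: M.a_ac)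
  then have rm: "right_module R N"
    unfolding right_module_def right_module_axioms_def
    using R.ring_axioms by (auto simp: ract_l_distr ract_r_distr ract_assoc)
  have hom: "h \<in> rhom R M N" unfolding rhom_def by auto
  have "fin_gen R N"
  proof -
    obtain S where S: "finite S" "S \<subseteq> carrier M"
      "\<And>L. submod R M L \<Longrightarrow> S \<subseteq> L \<Longrightarrow> L = carrier M"
      using assms unfolding fin_gen_def by blast
    have "L = carrier N" if L: "submod R N L" "h ` S \<subseteq> L" for L
    proof -
      interpret N: right_module R N by (rule rm)
      have LN: "L \<subseteq> carrier N"
        using L(1) additive_subgroup.a_subset unfolding submod_def by blast
      have La: "additive_subgroup L N" and Lr: "\<And>x a. x \<in> L \<Longrightarrow> a \<in> carrier R \<Longrightarrow> x \<triangleleft>\<^bsub>N\<^esub> a \<in> L"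
        using L(1) by (auto simp: submod_def)
      let ?L = "{x \<in> carrier M. h x \<in> L}"
      have ha: "h (x \<oplus>\<^bsub>M\<^esub> y) \<in> L" if "x \<in> ?L" "y \<in> ?L" for x y
        using additive_subgroup.a_closed[OF La, of "h x" "h y"] that by simp
      have hr: "h (x \<triangleleft>\<^bsub>M\<^esub> a) \<in> L" if "x \<in> ?L" "a \<in> carrier R" for x a
        using Lr[of "h x" a] that by simp
      have "subgroup ?L (add_monoid M)"
      proof (rule group.subgroupI[OF M.a_group])
        show "?L \<noteq> {}" using additive_subgroup.zero_closed[OF La] by auto
        fix x assume x: "x \<in> ?L"
        have "\<ominus>\<^bsub>M\<^esub> x = x \<triangleleft>\<^bsub>M\<^esub> (\<ominus>\<^bsub>R\<^esub> \<one>\<^bsub>R\<^esub>)"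
          using x by (simp add: ract_minus_right)
        then show "inv\<^bsub>add_monoid M\<^esub> x \<in> ?L" 
          using hr[OF x, of "\<ominus>\<^bsub>R\<^esub> \<one>\<^bsub>R\<^esub>"] x unfolding a_inv_def[symmetric] by auto
      qed (use ha in auto)
      then have "submod R M ?L" using hr by (auto simp: submod_def additive_subgroup_def)
      moreover have "S \<subseteq> ?L" using S(2) L(2) by auto
      ultimately have "?L = carrier M" by (rule S(3))
      then show ?thesis using LN by auto
    qed
    then show ?thesis using S(1,2) unfolding fin_gen_def by (intro exI[of _ "h ` S"]) auto
  qed
  with rm have "N \<in> fgmod R" by (simp add: fgmod_def)
  moreover have "riso R M N" unfolding riso_def using hom h by (auto simp: bij_betw_def)
  ultimately show ?thesis by blast
qed

definition fgmod_copy :: "('r, 'u) ring_scheme \<Rightarrow> ('r, 'm) rmodule \<Rightarrow> ('r, nat \<Rightarrow> 'r) rmodule" where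
  "fgmod_copy R M = (SOME N. N \<in> fgmod R \<and> riso R M N)"

definition summand :: "('r, 'u) ring_scheme \<Rightarrow> ('r, nat \<Rightarrow> 'r) rmodule \<Rightarrow> ('r, nat \<Rightarrow> 'r) rmodule \<Rightarrow> bool"
  where "summand R N M \<longleftrightarrow> N \<in> fgmod R \<and> (\<exists>N' \<in> fgmod R. riso R M (dsum N N'))"

definition indecomposable :: "('r, 'u) ring_scheme \<Rightarrow> ('r, nat \<Rightarrow> 'r) rmodule \<Rightarrow> bool" where
  "indecomposable R M \<longleftrightarrow> M \<in> fgmod R \<and> carrier M \<noteq> {\<zero>\<^bsub>M\<^esub>} \<and>
     (\<forall>N \<in> fgmod R. \<forall>N' \<in> fgmod R. riso R M (dsum N N') \<longrightarrow>
        carrier N = {\<zero>\<^bsub>N\<^esub>} \<or> carrier N' = {\<zero>\<^bsub>N'\<^esub>})"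


section \<open>Syzygies, cosyzygies and projective dimension\<close>

text \<open>Projectivity and injectivity are meant in the category mod-\<open>R\<close>.\<close>

definition projective :: "('r, 'u) ring_scheme \<Rightarrow> ('r, nat \<Rightarrow> 'r) rmodule \<Rightarrow> bool" where
  "projective R P \<longleftrightarrow> P \<in> fgmod R \<and>
     (\<forall>M \<in> fgmod R. \<forall>N \<in> fgmod R. \<forall>g \<in> rhom R M N. \<forall>f \<in> rhom R P N.
        g ` carrier M = carrier N \<longrightarrow> (\<exists>h \<in> rhom R P M. \<forall>x\<in>carrier P. g (h x) = f x))"

definition injective :: "('r, 'u) ring_scheme \<Rightarrow> ('r, nat \<Rightarrow> 'r) rmodule \<Rightarrow> bool" where
  "injective R I \<longleftrightarrow> I \<in> fgmod R \<and>
     (\<forall>M \<in> fgmod R. \<forall>N \<in> fgmod R. \<forall>g \<in> rhom R M N. \<forall>f \<in> rhom R M I.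
        inj_on g (carrier M) \<longrightarrow> (\<exists>h \<in> rhom R N I. \<forall>x\<in>carrier M. h (g x) = f x))"

definition short_exact ::
  "('r, 'u) ring_scheme \<Rightarrow> ('r, 'l) rmodule \<Rightarrow> ('l \<Rightarrow> 'm) \<Rightarrow> ('r, 'm) rmodule \<Rightarrow> ('m \<Rightarrow> 'n) \<Rightarrow> ('r, 'n) rmodule \<Rightarrow> bool"
  where "short_exact R L f M g N \<longleftrightarrow>
     f \<in> rhom R L M \<and> g \<in> rhom R M N \<and> inj_on f (carrier L) \<and>
     f ` carrier L = a_kernel M N g \<and> g ` carrier M = carrier N"

definition superfluous :: "('r, 'u) ring_scheme \<Rightarrow> ('r, 'm) rmodule \<Rightarrow> 'm set \<Rightarrow> bool" where
  "superfluous R M K \<longleftrightarrow> submod R M K \<and>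
     (\<forall>L. submod R M L \<and> K <+>\<^bsub>M\<^esub> L = carrier M \<longrightarrow> L = carrier M)"

definition essential :: "('r, 'u) ring_scheme \<Rightarrow> ('r, 'm) rmodule \<Rightarrow> 'm set \<Rightarrow> bool" where
  "essential R M K \<longleftrightarrow> submod R M K \<and>
     (\<forall>L. submod R M L \<and> K \<inter> L = {\<zero>\<^bsub>M\<^esub>} \<longrightarrow> L = {\<zero>\<^bsub>M\<^esub>})"

text \<open>\<open>N\<close> is the kernel of a projective cover of \<open>M\<close>, respectively the cokernel of an injective
  envelope of \<open>M\<close>. Both are unique up to isomorphism whenever they exist; \<open>\<Omega>\<close> and \<open>\<Omega>\<^sup>-\<^sup>1\<close> pick a
  representative.\<close>

definition is_syzygy ::
  "('r, 'u) ring_scheme \<Rightarrow> ('r, nat \<Rightarrow> 'r) rmodule \<Rightarrow> ('r, nat \<Rightarrow> 'r) rmodule \<Rightarrow> bool" where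
  "is_syzygy R M N \<longleftrightarrow> N \<in> fgmod R \<and>
     (\<exists>P f g. projective R P \<and> short_exact R N f P g M \<and> superfluous R P (f ` carrier N))"

definition is_cosyzygy ::
  "('r, 'u) ring_scheme \<Rightarrow> ('r, nat \<Rightarrow> 'r) rmodule \<Rightarrow> ('r, nat \<Rightarrow> 'r) rmodule \<Rightarrow> bool" where
  "is_cosyzygy R M N \<longleftrightarrow> N \<in> fgmod R \<and>
     (\<exists>I f g. injective R I \<and> short_exact R M f I g N \<and> essential R I (f ` carrier M))"

definition syzygy :: "('r, 'u) ring_scheme \<Rightarrow> ('r, nat \<Rightarrow> 'r) rmodule \<Rightarrow> ('r, nat \<Rightarrow> 'r) rmodule" where
  "syzygy R M = (SOME N. is_syzygy R M N)"

definition cosyzygy :: "('r, 'u) ring_scheme \<Rightarrow> ('r, nat \<Rightarrow> 'r) rmodule \<Rightarrow> ('r, nat \<Rightarrow> 'r) rmodule" where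
  "cosyzygy R M = (SOME N. is_cosyzygy R M N)"

text \<open>A projective resolution \<open>0 \<rightarrow> P\<^sub>n \<rightarrow> \<dots> \<rightarrow> P\<^sub>0 \<rightarrow> M \<rightarrow> 0\<close> of length \<open>n\<close>, where \<open>d 0\<close> is the
  augmentation and \<open>d (Suc i)\<close> maps \<open>P (Suc i)\<close> to \<open>P i\<close>.\<close>

definition proj_resolution ::
  "('r, 'u) ring_scheme \<Rightarrow> ('r, nat \<Rightarrow> 'r) rmodule \<Rightarrow> nat \<Rightarrow>
     (nat \<Rightarrow> ('r, nat \<Rightarrow> 'r) rmodule) \<Rightarrow> (nat \<Rightarrow> (nat \<Rightarrow> 'r) \<Rightarrow> (nat \<Rightarrow> 'r)) \<Rightarrow> bool" where
  "proj_resolution R M n P d \<longleftrightarrow>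
     (\<forall>i\<le>n. projective R (P i)) \<and>
     d 0 \<in> rhom R (P 0) M \<and> d 0 ` carrier (P 0) = carrier M \<and>
     (\<forall>i<n. d (Suc i) \<in> rhom R (P (Suc i)) (P i)) \<and>
     (\<forall>i<n. d (Suc i) ` carrier (P (Suc i)) =
        a_kernel (P i) (case i of 0 \<Rightarrow> M | Suc j \<Rightarrow> P j) (d i)) \<and>
     inj_on (d n) (carrier (P n))"

definition pd :: "('r, 'u) ring_scheme \<Rightarrow> ('r, nat \<Rightarrow> 'r) rmodule \<Rightarrow> enat" where
  "pd R M = (INF n \<in> {n. \<exists>P d. proj_resolution R M n P d}. enat n)"


section \<open>The group \<open>K\<^sub>0\<close> and the Igusa-Todorov functions\<close>

definition iso_class ::
  "('r, 'u) ring_scheme \<Rightarrow> ('r, nat \<Rightarrow> 'r) rmodule \<Rightarrow> ('r, nat \<Rightarrow> 'r) rmodule set" where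
  "iso_class R M = {N \<in> fgmod R. riso R M N}"

definition free_iso ::
  "('r, 'u) ring_scheme \<Rightarrow> (('r, nat \<Rightarrow> 'r) rmodule set \<Rightarrow>\<^sub>0 int) monoid" where
  "free_iso R = free_Abelian_group (iso_class R ` fgmod R)"

definition K0_relations ::
  "('r, 'u) ring_scheme \<Rightarrow> (('r, nat \<Rightarrow> 'r) rmodule set \<Rightarrow>\<^sub>0 int) set" where
  "K0_relations R = generate (free_iso R)
     ({frag_of (iso_class R M) - frag_of (iso_class R M') - frag_of (iso_class R M'') | M M' M''.
         M \<in> fgmod R \<and> M' \<in> fgmod R \<and> M'' \<in> fgmod R \<and> riso R M (dsum M' M'')} \<union>
      {frag_of (iso_class R P) | P. projective R P})"

definition K0 :: "('r, 'u) ring_scheme \<Rightarrow> (('r, nat \<Rightarrow> 'r) rmodule set \<Rightarrow>\<^sub>0 int) set monoid" where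
  "K0 R = free_iso R Mod K0_relations R"

definition K0_class ::
  "('r, 'u) ring_scheme \<Rightarrow> ('r, nat \<Rightarrow> 'r) rmodule \<Rightarrow> (('r, nat \<Rightarrow> 'r) rmodule set \<Rightarrow>\<^sub>0 int) set" where
  "K0_class R M = K0_relations R #>\<^bsub>free_iso R\<^esub> frag_of (iso_class R M)"

text \<open>The conditions determine the endomorphism on \<open>carrier (K0 R)\<close>, as the classes of modules
  generate \<open>K0 R\<close>.\<close>

definition Omega_bar ::
  "('r, 'u) ring_scheme \<Rightarrow> (('r, nat \<Rightarrow> 'r) rmodule set \<Rightarrow>\<^sub>0 int) set \<Rightarrow>
     (('r, nat \<Rightarrow> 'r) rmodule set \<Rightarrow>\<^sub>0 int) set" where
  "Omega_bar R = (SOME h. h \<in> hom (K0 R) (K0 R) \<and>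
     (\<forall>M \<in> fgmod R. h (K0_class R M) = K0_class R (syzygy R M)))"

definition add_span ::
  "('r, 'u) ring_scheme \<Rightarrow> ('r, nat \<Rightarrow> 'r) rmodule \<Rightarrow> (('r, nat \<Rightarrow> 'r) rmodule set \<Rightarrow>\<^sub>0 int) set set" where
  "add_span R M = generate (K0 R) {K0_class R N | N. indecomposable R N \<and> summand R N M}"

definition phi :: "('r, 'u) ring_scheme \<Rightarrow> ('r, nat \<Rightarrow> 'r) rmodule \<Rightarrow> nat" where
  "phi R M = (LEAST l. \<forall>s. inj_on (Omega_bar R) ((Omega_bar R ^^ (l + s)) ` add_span R M))"

definition psi :: "('r, 'u) ring_scheme \<Rightarrow> ('r, nat \<Rightarrow> 'r) rmodule \<Rightarrow> enat" where
  "psi R M = enat (phi R M) +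
     (SUP N \<in> {N. summand R N ((syzygy R ^^ phi R M) M) \<and> pd R N < \<infinity>}. pd R N)"

definition phi_dim :: "('r, 'u) ring_scheme \<Rightarrow> enat" where
  "phi_dim R = (SUP M \<in> fgmod R. enat (phi R M))"

definition psi_dim :: "('r, 'u) ring_scheme \<Rightarrow> enat" where
  "psi_dim R = (SUP M \<in> fgmod R. psi R M)"


section \<open>Path algebras and radical square zero algebras\<close>

text \<open>A quiver is a \<^locale>\<open>wf_digraph\<close> (loops and multiple arrows are allowed). A path is given by its
  starting vertex together with its list of arrows, so that the trivial path at \<open>i\<close> is \<open>(i, [])\<close>.\<close>

definition paths :: "('v, 'a) pre_digraph \<Rightarrow> ('v \<times> 'a list) set" where
  "paths Q = {(u, p). \<exists>v. pre_digraph.awalk Q u p v}"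

text \<open>Paths are multiplied by concatenation from left to right, i.e. \<open>p \<cdot> q\<close> is \<open>p\<close> followed by \<open>q\<close>.
  For right modules this gives \<open>\<Omega>(S\<^sub>i) = \<Oplus> S\<^sub>j\<close>, the sum being over the arrows \<open>i \<rightarrow> j\<close>. The coefficient of
  the product at a path collects the contributions of all its factorisations.\<close>

definition path_algebra :: "('v, 'a) pre_digraph \<Rightarrow> ('v \<times> 'a list \<Rightarrow> 'k::field) ring" where
  "path_algebra Q =
     \<lparr>carrier = {f. finite {x. f x \<noteq> 0} \<and> {x. f x \<noteq> 0} \<subseteq> paths Q},
      mult = (\<lambda>f g (u, p).
        \<Sum>k\<le>length p. f (u, take k p) * g (pre_digraph.awlast Q u (take k p), drop k p)),
      one = (\<lambda>(u, p). if u \<in> verts Q \<and> p = [] then 1 else 0),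
      zero = (\<lambda>_. 0),
      add = (\<lambda>f g x. f x + g x)\<rparr>"

definition basis_path :: "'v \<times> 'a list \<Rightarrow> ('v \<times> 'a list \<Rightarrow> 'k::field)" where
  "basis_path x = (\<lambda>y. if y = x then 1 else 0)"

definition arrow_ideal :: "('v, 'a) pre_digraph \<Rightarrow> ('v \<times> 'a list \<Rightarrow> 'k::field) set" where
  "arrow_ideal Q = Idl\<^bsub>path_algebra Q\<^esub> {basis_path (tail Q e, [e]) | e. e \<in> arcs Q}"

definition arrow_ideal_sq :: "('v, 'a) pre_digraph \<Rightarrow> ('v \<times> 'a list \<Rightarrow> 'k::field) set" where
  "arrow_ideal_sq Q = ideal_prod (path_algebra Q) (arrow_ideal Q) (arrow_ideal Q)"

definition rad_sq_zero :: "('v, 'a) pre_digraph \<Rightarrow> ('v \<times> 'a list \<Rightarrow> 'k::field) set ring" where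
  "rad_sq_zero Q = path_algebra Q Quot arrow_ideal_sq Q"

definition idem :: "('v, 'a) pre_digraph \<Rightarrow> 'v \<Rightarrow> ('v \<times> 'a list \<Rightarrow> 'k::field) set" where
  "idem Q i = arrow_ideal_sq Q +>\<^bsub>path_algebra Q\<^esub> basis_path (i, [])"

text \<open>The simple module \<open>S\<^sub>i\<close> is the field itself, on which the residue class of \<open>f\<close> acts as its
  coefficient at the trivial path at \<open>i\<close> (all elements of the class have the same coefficient).\<close>

definition simple_at :: "'v \<Rightarrow> (('v \<times> 'a list \<Rightarrow> 'k::field) set, 'k) rmodule" where
  "simple_at i = \<lparr>carrier = UNIV, mult = undefined, one = undefined, zero = 0, add = (+),
     ract = (\<lambda>x F. x * (THE c. \<forall>f\<in>F. f (i, []) = c))\<rparr>"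

lemma paths_iff: "(u, p) \<in> paths Q \<longleftrightarrow> (\<exists>v. pre_digraph.awalk Q u p v)"
  by (simp add: paths_def)

lemma (in fin_digraph) ring_path_algebra:
  "ring (path_algebra G :: ('a \<times> 'b list \<Rightarrow> 'k::field) ring)" (is "ring ?K")
proof -
  have pa: "(u, p @ q) \<in> paths G" if "(u, p) \<in> paths G" "(awlast u p, q) \<in> paths G" for u p q
  proof -
    from that obtain v w where "awalk u p v" "awalk (awlast u p) q w" by (auto simp: paths_iff)
    moreover from this have "awlast u p = v" by (simp add: awalkE)
    ultimately show ?thesis unfolding paths_iff by (auto intro: awalk_appendI)
  qed
  have mem: "f \<in> carrier ?K \<longleftrightarrow> finite {x. f x \<noteq> 0} \<and> {x. f x \<noteq> 0} \<subseteq> paths G" for f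
    by (simp add: path_algebra_def)
  have mult: "(f \<otimes>\<^bsub>?K\<^esub> g) (u, p) = (\<Sum>k\<le>length p. f (u, take k p) * g (awlast u (take k p), drop k p))" for f g u p
    by (simp add: path_algebra_def)
  have add: "f \<oplus>\<^bsub>?K\<^esub> g = (\<lambda>x. f x + g x)" for f g by (simp add: path_algebra_def)
  have zero: "\<zero>\<^bsub>?K\<^esub> = (\<lambda>_. 0)" by (simp add: path_algebra_def)
  have one: "\<one>\<^bsub>?K\<^esub> = (\<lambda>(u, p). if u \<in> verts G \<and> p = [] then 1 else 0)" by (simp add: path_algebra_def)
  have last_app: "awlast u (p @ q) = awlast (awlast u p) q" for u p q
    by (auto simp: awalk_verts_conv)
  have mc: "f \<otimes>\<^bsub>?K\<^esub> g \<in> carrier ?K" if f: "f \<in> carrier ?K" and g: "g \<in> carrier ?K" for f g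
  proof -
    let ?S = "(\<lambda>((u, p), (v, q)). (u, p @ q)) ` ({x. f x \<noteq> 0} \<times> {x. g x \<noteq> 0})"
    have *: "x \<in> ?S \<and> x \<in> paths G" if "(f \<otimes>\<^bsub>?K\<^esub> g) x \<noteq> 0" for x
    proof -
      obtain u p where x: "x = (u, p)" by force
      from that obtain k where k: "f (u, take k p) \<noteq> 0" "g (awlast u (take k p), drop k p) \<noteq> 0"
        unfolding x mult by (metis (no_types, lifting) mult_eq_0_iff sum.not_neutral_contains_not_neutral)
      have "(u, take k p @ drop k p) \<in> paths G" by (rule pa) (use k f g in \<open>auto simp: mem\<close>)
      moreover have "x \<in> ?S" unfolding x image_iff
        using k by (intro bexI[of _ "((u, take k p), (awlast u (take k p), drop k p))"]) auto
      ultimately show ?thesis by (simp add: x)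
    qed
    have "finite ?S" using f g by (auto simp: mem)
    then have "finite {x. (f \<otimes>\<^bsub>?K\<^esub> g) x \<noteq> 0}" by (rule rev_finite_subset) (use * in blast)
    then show ?thesis unfolding mem using * by blast
  qed
  show ?thesis
  proof (rule ringI)
    show "abelian_group ?K"
    proof (rule abelian_groupI)
      fix f g assume fg: "f \<in> carrier ?K" "g \<in> carrier ?K"
      have "finite ({x. f x \<noteq> 0} \<union> {x. g x \<noteq> 0})" using fg by (auto simp: mem)
      then have "finite {x. f x + g x \<noteq> 0}" by (rule rev_finite_subset) auto
      then show "f \<oplus>\<^bsub>?K\<^esub> g \<in> carrier ?K" using fg by (force simp: mem add)
    next
      fix f assume "f \<in> carrier ?K"
      then show "\<exists>g\<in>carrier ?K. g \<oplus>\<^bsub>?K\<^esub> f = \<zero>\<^bsub>?K\<^esub>"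
        by (intro bexI[of _ "\<lambda>x. - f x"]) (auto simp: add zero mem)
    qed (auto simp: mem add zero add.assoc add.commute)
    show "monoid ?K"
    proof (rule monoidI)
      have "finite ((\<lambda>u. (u, [] :: 'b list)) ` verts G)" by simp
      then have "finite {x. \<one>\<^bsub>?K\<^esub> x \<noteq> 0}" by (rule rev_finite_subset) (auto simp: one split: if_splits)
      then show "\<one>\<^bsub>?K\<^esub> \<in> carrier ?K" by (auto simp: mem one paths_iff awalk_def split: if_splits)
    next
      fix f assume f: "f \<in> carrier ?K"
      have nz: "u \<in> verts G \<and> awlast u (take k p) \<in> verts G" if "f (u, p) \<noteq> 0" for u p k
      proof -
        have "(u, p) \<in> paths G" using f that by (auto simp: mem)
        then have "u \<in> verts G" "set p \<subseteq> arcs G" by (auto simp: paths_iff awalk_def)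
        then show ?thesis using awlast_in_verts[of u "take k p"] set_take_subset[of k p] by auto
      qed
      show "\<one>\<^bsub>?K\<^esub> \<otimes>\<^bsub>?K\<^esub> f = f"
      proof (rule ext, clarify)
        fix u p
        have "(\<one>\<^bsub>?K\<^esub> \<otimes>\<^bsub>?K\<^esub> f) (u, p) = (\<Sum>k\<le>length p. if k = 0 then f (u, p) else 0)"
          unfolding mult by (intro sum.cong refl) (use nz[of u p 0] in \<open>auto simp: one\<close>)
        then show "(\<one>\<^bsub>?K\<^esub> \<otimes>\<^bsub>?K\<^esub> f) (u, p) = f (u, p)" by simp
      qed
      show "f \<otimes>\<^bsub>?K\<^esub> \<one>\<^bsub>?K\<^esub> = f"
      proof (rule ext, clarify)
        fix u p
        have "(f \<otimes>\<^bsub>?K\<^esub> \<one>\<^bsub>?K\<^esub>) (u, p) = (\<Sum>k\<le>length p. if k = length p then f (u, p) else 0)"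
          unfolding mult by (intro sum.cong refl) (use nz[of u p "length p"] in \<open>auto simp: one\<close>)
        then show "(f \<otimes>\<^bsub>?K\<^esub> \<one>\<^bsub>?K\<^esub>) (u, p) = f (u, p)" by simp
      qed
    next
      fix f g h
      show "f \<otimes>\<^bsub>?K\<^esub> g \<otimes>\<^bsub>?K\<^esub> h = f \<otimes>\<^bsub>?K\<^esub> (g \<otimes>\<^bsub>?K\<^esub> h)"
      proof (rule ext, clarify)
        fix u p
        let ?t = "\<lambda>j k. f (u, take j p) * g (awlast u (take j p), drop j (take k p)) * h (awlast u (take k p), drop k p)"
        have "(f \<otimes>\<^bsub>?K\<^esub> g \<otimes>\<^bsub>?K\<^esub> h) (u, p) = (\<Sum>k\<le>length p. \<Sum>j\<le>k. ?t j k)"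
          unfolding mult sum_distrib_right by (intro sum.cong refl) (auto simp: min_def)
        also have "\<dots> = (\<Sum>(k, j)\<in>Sigma {..length p} (\<lambda>k. {..k}). ?t j k)" by (simp add: sum.Sigma)
        also have "\<dots> = (\<Sum>(j, m)\<in>Sigma {..length p} (\<lambda>j. {..length p - j}). ?t j (j + m))"
          by (rule sum.reindex_bij_witness[where i = "\<lambda>(j, m). (j + m, j)" and j = "\<lambda>(k, j). (j, k - j)"]) auto
        also have "\<dots> = (\<Sum>j\<le>length p. \<Sum>m\<le>length p - j. ?t j (j + m))" by (simp add: sum.Sigma)
        also have "\<dots> = (f \<otimes>\<^bsub>?K\<^esub> (g \<otimes>\<^bsub>?K\<^esub> h)) (u, p)"
          unfolding mult sum_distrib_left
          by (intro sum.cong refl) (auto simp: take_add last_app mult.assoc add.commute drop_take)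
        finally show "(f \<otimes>\<^bsub>?K\<^esub> g \<otimes>\<^bsub>?K\<^esub> h) (u, p) = (f \<otimes>\<^bsub>?K\<^esub> (g \<otimes>\<^bsub>?K\<^esub> h)) (u, p)" .
      qed
    qed (rule mc)
  next
    fix f g h
    show "(f \<oplus>\<^bsub>?K\<^esub> g) \<otimes>\<^bsub>?K\<^esub> h = f \<otimes>\<^bsub>?K\<^esub> h \<oplus>\<^bsub>?K\<^esub> g \<otimes>\<^bsub>?K\<^esub> h"
      by (rule ext, clarify) (simp only: add mult sum.distrib distrib_right)
    show "h \<otimes>\<^bsub>?K\<^esub> (f \<oplus>\<^bsub>?K\<^esub> g) = h \<otimes>\<^bsub>?K\<^esub> f \<oplus>\<^bsub>?K\<^esub> h \<otimes>\<^bsub>?K\<^esub> g"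
      by (rule ext, clarify) (simp only: add mult sum.distrib distrib_left)
  qed
qed

context fin_digraph
begin

lemma ideal_arrow_ideal: "ideal (arrow_ideal G) (path_algebra G :: ('a \<times> 'b list \<Rightarrow> 'k::field) ring)"
proof -
  let ?K = "path_algebra G :: ('a \<times> 'b list \<Rightarrow> 'k) ring"
  interpret K: ring ?K by (rule ring_path_algebra)
  have "basis_path (tail G e, [e]) \<in> carrier ?K" if "e \<in> arcs G" for e
    using that by (auto simp: path_algebra_def basis_path_def paths_iff awalk_def)
  then show ?thesis unfolding arrow_ideal_def by (intro K.genideal_ideal) auto
qed

lemma ideal_arrow_ideal_sq: "ideal (arrow_ideal_sq G) (path_algebra G :: ('a \<times> 'b list \<Rightarrow> 'k::field) ring)"
  unfolding arrow_ideal_sq_def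
  by (intro ring.ideal_prod_is_ideal ring_path_algebra ideal_arrow_ideal)

lemma arrow_ideal_trivial_path:
  assumes "f \<in> (arrow_ideal G :: ('a \<times> 'b list \<Rightarrow> 'k::field) set)"
  shows "f (u, []) = 0"
proof -
  let ?K = "path_algebra G :: ('a \<times> 'b list \<Rightarrow> 'k) ring"
  interpret K: ring ?K by (rule ring_path_algebra)
  let ?I = "{f \<in> carrier ?K. \<forall>u. f (u, []) = 0}"
  have minus: "(\<ominus>\<^bsub>?K\<^esub> f) x = - f x" if "f \<in> carrier ?K" for f x
  proof -
    have "(f \<oplus>\<^bsub>?K\<^esub> \<ominus>\<^bsub>?K\<^esub> f) x = \<zero>\<^bsub>?K\<^esub> x" using that by (simp add: K.r_neg)
    then show ?thesis by (simp add: path_algebra_def add_eq_0_iff)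
  qed
  have "ideal ?I ?K"
  proof (rule idealI)
    show "subgroup ?I (add_monoid ?K)"
    proof (rule group.subgroupI[OF K.a_group])
      show "?I \<noteq> {}" by (auto intro!: exI[of _ "\<zero>\<^bsub>?K\<^esub>"]) (auto simp: path_algebra_def)
      fix f assume f: "f \<in> ?I"
      then have "\<ominus>\<^bsub>?K\<^esub> f \<in> ?I" using minus by auto
      then show "inv\<^bsub>add_monoid ?K\<^esub> f \<in> ?I" by (simp only: a_inv_def)
    next
      fix f g assume "f \<in> ?I" "g \<in> ?I"
      moreover from this have "f \<oplus>\<^bsub>?K\<^esub> g \<in> carrier ?K" by blast
      ultimately show "f \<otimes>\<^bsub>add_monoid ?K\<^esub> g \<in> ?I" by (simp add: path_algebra_def)
    qed auto
  next
    fix f g assume "f \<in> ?I" and g: "g \<in> carrier ?K"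
    then have f: "f \<in> carrier ?K" "\<And>u. f (u, []) = 0" by auto
    show "g \<otimes>\<^bsub>?K\<^esub> f \<in> ?I" "f \<otimes>\<^bsub>?K\<^esub> g \<in> ?I"
      using K.m_closed[OF f(1) g] K.m_closed[OF g f(1)] f(2)
      by (auto simp: path_algebra_def)
  qed (rule ring_path_algebra)
  moreover have "basis_path (tail G e, [e]) \<in> ?I" if "e \<in> arcs G" for e
    using that by (auto simp: path_algebra_def basis_path_def paths_iff awalk_def)
  ultimately have "arrow_ideal G \<subseteq> ?I"
    unfolding arrow_ideal_def by (intro K.genideal_minimal) auto
  then show ?thesis using assms by auto
qed

lemma arrow_ideal_sq_short_path:
  assumes "f \<in> (arrow_ideal_sq G :: ('a \<times> 'b list \<Rightarrow> 'k::field) set)" "length p \<le> 1"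
  shows "f (u, p) = 0"
  using assms(1) unfolding arrow_ideal_sq_def
proof (induction f rule: ideal_prod.induct)
  case (prod f g)
  have "k = 0 \<or> k = 1" if "k \<le> length p" for k using that assms(2) by auto
  then have "f (u, take k p) = 0 \<or> g (awlast u (take k p), drop k p) = 0" if "k \<le> length p" for k
    using that assms(2) prod by (cases "k = 0") (auto simp: arrow_ideal_trivial_path le_Suc_eq)
  then show ?case by (auto simp: path_algebra_def intro!: sum.neutral)
qed (simp add: path_algebra_def)

lemma ring_rad_sq_zero: "ring (rad_sq_zero G :: ('a \<times> 'b list \<Rightarrow> 'k::field) set ring)"
  unfolding rad_sq_zero_def by (rule ideal.quotient_is_ring[OF ideal_arrow_ideal_sq])

lemma simple_at_class:
  assumes "f \<in> carrier (path_algebra G)"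
  shows "x \<triangleleft>\<^bsub>simple_at i\<^esub> (arrow_ideal_sq G +>\<^bsub>path_algebra G\<^esub> f) = x * (f (i, []) :: 'k::field)"
proof -
  let ?K = "path_algebra G :: ('a \<times> 'b list \<Rightarrow> 'k) ring"
  interpret K: ring ?K by (rule ring_path_algebra)
  interpret J: ideal "arrow_ideal_sq G" ?K by (rule ideal_arrow_ideal_sq)
  have "(THE c. \<forall>g\<in>arrow_ideal_sq G +>\<^bsub>?K\<^esub> f. g (i, []) = c) = f (i, [])"
  proof (rule the_equality)
    show *: "\<forall>g\<in>arrow_ideal_sq G +>\<^bsub>?K\<^esub> f. g (i, []) = f (i, [])"
      by (auto simp: a_r_coset_def' path_algebra_def arrow_ideal_sq_short_path)
    fix c assume "\<forall>g\<in>arrow_ideal_sq G +>\<^bsub>?K\<^esub> f. g (i, []) = c"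
    moreover have "f \<in> arrow_ideal_sq G +>\<^bsub>?K\<^esub> f" using assms by (rule J.a_rcos_self)
    ultimately show "c = f (i, [])" by (auto dest: bspec)
  qed
  then show ?thesis by (simp add: simple_at_def)
qed

lemma right_module_simple_at:
  assumes i: "i \<in> verts G"
  shows "right_module (rad_sq_zero G) (simple_at i :: (('a \<times> 'b list \<Rightarrow> 'k::field) set, 'k) rmodule)"
proof -
  let ?K = "path_algebra G :: ('a \<times> 'b list \<Rightarrow> 'k) ring"
  let ?A = "rad_sq_zero G :: ('a \<times> 'b list \<Rightarrow> 'k) set ring"
  let ?S = "simple_at i :: (('a \<times> 'b list \<Rightarrow> 'k) set, 'k) rmodule"
  let ?J = "arrow_ideal_sq G :: ('a \<times> 'b list \<Rightarrow> 'k) set"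
  interpret K: ring ?K by (rule ring_path_algebra)
  interpret J: ideal ?J ?K by (rule ideal_arrow_ideal_sq)
  have ab: "abelian_group ?S"
  proof (rule abelian_groupI)
    fix x assume "x \<in> carrier ?S"
    show "\<exists>y\<in>carrier ?S. y \<oplus>\<^bsub>?S\<^esub> x = \<zero>\<^bsub>?S\<^esub>"
      by (rule bexI[of _ "- x"]) (auto simp: simple_at_def)
  qed (auto simp: simple_at_def)
  have A: "\<exists>f\<in>carrier ?K. a = ?J +>\<^bsub>?K\<^esub> f" if "a \<in> carrier ?A" for a
    using that by (auto simp: rad_sq_zero_def FactRing_def A_RCOSETS_def')
  have add: "(?J +>\<^bsub>?K\<^esub> f) \<oplus>\<^bsub>?A\<^esub> (?J +>\<^bsub>?K\<^esub> g) = ?J +>\<^bsub>?K\<^esub> (f \<oplus>\<^bsub>?K\<^esub> g)"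
    and mult: "(?J +>\<^bsub>?K\<^esub> f) \<otimes>\<^bsub>?A\<^esub> (?J +>\<^bsub>?K\<^esub> g) = ?J +>\<^bsub>?K\<^esub> (f \<otimes>\<^bsub>?K\<^esub> g)"
    if "f \<in> carrier ?K" "g \<in> carrier ?K" for f g
    using that by (simp_all add: rad_sq_zero_def FactRing_def J.a_rcos_sum J.rcoset_mult_add)
  have one: "\<one>\<^bsub>?A\<^esub> = ?J +>\<^bsub>?K\<^esub> \<one>\<^bsub>?K\<^esub>" by (simp add: rad_sq_zero_def FactRing_def)
  have c: "(f \<oplus>\<^bsub>?K\<^esub> g) (i, []) = f (i, []) + g (i, [])"
    "(f \<otimes>\<^bsub>?K\<^esub> g) (i, []) = f (i, []) * g (i, [])" "\<one>\<^bsub>?K\<^esub> (i, []) = 1" for f g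
    using i by (simp_all add: path_algebra_def)
  have S: "carrier ?S = UNIV" "x \<oplus>\<^bsub>?S\<^esub> y = x + y" for x y by (simp_all add: simple_at_def)
  note act = simple_at_class[where 'k='k]
  show ?thesis
  proof (intro right_module.intro right_module_axioms.intro ring_rad_sq_zero ab)
    fix x y a b assume a: "a \<in> carrier ?A" and b: "b \<in> carrier ?A"
    obtain f where f: "f \<in> carrier ?K" "a = ?J +>\<^bsub>?K\<^esub> f" using A[OF a] by blast
    obtain g where g: "g \<in> carrier ?K" "b = ?J +>\<^bsub>?K\<^esub> g" using A[OF b] by blast
    show "x \<triangleleft>\<^bsub>?S\<^esub> (a \<oplus>\<^bsub>?A\<^esub> b) = (x \<triangleleft>\<^bsub>?S\<^esub> a) \<oplus>\<^bsub>?S\<^esub> (x \<triangleleft>\<^bsub>?S\<^esub> b)"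
      unfolding f(2) g(2) add[OF f(1) g(1)] act[OF f(1)] act[OF g(1)] act[OF K.a_closed[OF f(1) g(1)]] S c
      by (rule distrib_left)
    show "x \<triangleleft>\<^bsub>?S\<^esub> (a \<otimes>\<^bsub>?A\<^esub> b) = (x \<triangleleft>\<^bsub>?S\<^esub> a) \<triangleleft>\<^bsub>?S\<^esub> b"
      unfolding f(2) g(2) mult[OF f(1) g(1)] act[OF f(1)] act[OF g(1)] act[OF K.m_closed[OF f(1) g(1)]] S c
      by (rule mult.assoc[symmetric])
  next
    fix x y a assume a: "a \<in> carrier ?A"
    obtain f where f: "f \<in> carrier ?K" "a = ?J +>\<^bsub>?K\<^esub> f" using A[OF a] by blast
    show "(x \<oplus>\<^bsub>?S\<^esub> y) \<triangleleft>\<^bsub>?S\<^esub> a = (x \<triangleleft>\<^bsub>?S\<^esub> a) \<oplus>\<^bsub>?S\<^esub> (y \<triangleleft>\<^bsub>?S\<^esub> a)"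
      unfolding f(2) act[OF f(1)] S by (rule distrib_right)
  next
    fix x
    show "x \<triangleleft>\<^bsub>?S\<^esub> \<one>\<^bsub>?A\<^esub> = x"
      unfolding one act[OF K.one_closed] c by (rule mult_1_right)
  qed (simp add: S)
qed

end

type_synonym ('v, 'a, 'k) rsz_module =
  "(('v \<times> 'a list \<Rightarrow> 'k) set, nat \<Rightarrow> ('v \<times> 'a list \<Rightarrow> 'k) set) rmodule"

definition A0 :: "('v, 'a) pre_digraph \<Rightarrow> ('v, 'a, 'k::field) rsz_module" where
  "A0 Q = fgmod_copy (rad_sq_zero Q) (dsum_family (verts Q) simple_at)"

text \<open>\<open>S\<^sub>i\<close> is a composition factor of \<open>M\<close> iff \<open>M e\<^sub>i\<close> is nonzero.\<close>

definition supp :: "('v, 'a) pre_digraph \<Rightarrow> ('v, 'a, 'k::field) rsz_module \<Rightarrow> 'v set" where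
  "supp Q M = {i \<in> verts Q. \<exists>x \<in> carrier M. x \<triangleleft>\<^bsub>M\<^esub> idem Q i \<noteq> \<zero>\<^bsub>M\<^esub>}"

text \<open>The field \<open>'k\<close> enters the definitions of the heart and of the member through the modules.\<close>

definition heart_verts :: "'k::field itself \<Rightarrow> ('v, 'a) pre_digraph \<Rightarrow> 'v set" where
  "heart_verts _ Q = (let A = rad_sq_zero Q; n = card (verts Q); M = A0 Q :: ('v, 'a, 'k) rsz_module in
     supp Q ((syzygy A ^^ n) M) \<inter> supp Q ((cosyzygy A ^^ n) M))"

definition heart :: "'k::field itself \<Rightarrow> ('v, 'a) pre_digraph \<Rightarrow> ('v, 'a) pre_digraph" where
  "heart k Q = Q \<restriction> heart_verts k Q"

definition member_quiver :: "'k::field itself \<Rightarrow> ('v, 'a) pre_digraph \<Rightarrow> ('v, 'a) pre_digraph" where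
  "member_quiver k Q = Q \<restriction> (verts Q - verts (heart k Q))"

definition sink :: "('v, 'a) pre_digraph \<Rightarrow> 'v \<Rightarrow> bool" where
  "sink Q v \<longleftrightarrow> v \<in> verts Q \<and> out_arcs Q v = {}"

text \<open>If there is no sink, then this is the supremum of the empty set, which is \<open>0\<close>.\<close>

definition sink_length :: "'k::field itself \<Rightarrow> ('v, 'a) pre_digraph \<Rightarrow> enat" where
  "sink_length k Q =
     (SUP p \<in> {p. \<exists>u v. pre_digraph.awalk (member_quiver k Q) u p v \<and> sink Q v}. enat (length p))"

end

theory Submission
  imports Defs
begin

text \<open>Of the first Igusa-Todorov function only the bound \<open>\<phi> \<le> n - 1\<close> matters, so the group \<open>K\<^sub>0\<close> plays no
  role. Since \<open>J\<^sup>2 = 0\<close>, every syzygy is semisimple. If a semisimple module has finite projective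
  dimension, then the walks starting in its support have bounded length: given any finite projective
  resolution, an arrow \<open>i \<rightarrow> j\<close> turns a summand \<open>S\<^sub>i\<close> of one kernel into a summand \<open>S\<^sub>j\<close> of the next one.
  Such walks avoid the heart and extend to walks of the member that end in a sink, so their length is at
  most \<open>d\<close>, and the projective dimension is at most \<open>d\<close> as well. Hence \<open>\<psi>(M) \<le> \<phi>(M) + d\<close> if \<open>\<phi>(M) > 0\<close>,
  and if \<open>\<phi>(M) = 0\<close>, then \<open>\<psi>(M) \<le> 1 + d\<close>, as one syzygy is needed to reach a semisimple module; here
  \<open>1 \<le> n - 1\<close> because \<open>\<phi>dim(A) > 0\<close>.\<close>

section \<open>Modules over a ring\<close>

text \<open>The obstacle is that \<open>pd\<close> allows arbitrary finite resolutions, while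
  supports of syzygies are read off minimal ones. Rather than comparing resolutions, the proof
  follows one invariant through the kernels of whatever resolution is given: a homogeneous relation
  \<open>arc_sum M y\<close> = 0 whose coefficients are not all in MJ. It survives because in a
  projective module such a relation forces all coefficients into the radical
  (\<open>projective_relation\<close>). The work is done with elements, in coordinates given by
  idempotents and arrows, so neither uniqueness of covers nor Krull-Schmidt is invoked.
  \<open>syzygy\<close> and \<open>cosyzygy\<close> are choices and say something only once covers
  and envelopes are known to exist. Walks of bounded length avoid the heart because a vertex in the
  support of the n-th cosyzygy of \<open>A0\<close> starts a walk of length n, whereas with n
  vertices a bound on the walks from a vertex can always be improved to "shorter than n".\<close>

lemma rhomI:
  assumes "\<And>x. x \<in> carrier M \<Longrightarrow> h x \<in> carrier N"
    and "\<And>x y. x \<in> carrier M \<Longrightarrow> y \<in> carrier M \<Longrightarrow> h (x \<oplus>\<^bsub>M\<^esub> y) = h x \<oplus>\<^bsub>N\<^esub> h y"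
    and "\<And>x a. x \<in> carrier M \<Longrightarrow> a \<in> carrier R \<Longrightarrow> h (x \<triangleleft>\<^bsub>M\<^esub> a) = h x \<triangleleft>\<^bsub>N\<^esub> a"
  shows "h \<in> rhom R M N"
  using assms by (auto simp: rhom_def)

lemma rhomD:
  assumes "h \<in> rhom R M N"
  shows "x \<in> carrier M \<Longrightarrow> h x \<in> carrier N"
    and "x \<in> carrier M \<Longrightarrow> y \<in> carrier M \<Longrightarrow> h (x \<oplus>\<^bsub>M\<^esub> y) = h x \<oplus>\<^bsub>N\<^esub> h y"
    and "x \<in> carrier M \<Longrightarrow> a \<in> carrier R \<Longrightarrow> h (x \<triangleleft>\<^bsub>M\<^esub> a) = h x \<triangleleft>\<^bsub>N\<^esub> a"
  using assms by (auto simp: rhom_def)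

lemma rhom_comp: "g \<in> rhom R L M \<Longrightarrow> h \<in> rhom R M N \<Longrightarrow> (\<lambda>x. h (g x)) \<in> rhom R L N"
  by (rule rhomI) (simp_all add: rhomD)

lemma rhom_zero:
  assumes "right_module R M" "right_module R N" "h \<in> rhom R M N"
  shows "h \<zero>\<^bsub>M\<^esub> = \<zero>\<^bsub>N\<^esub>"
proof -
  interpret M: right_module R M by fact
  interpret N: right_module R N by fact
  have "h \<zero>\<^bsub>M\<^esub> \<oplus>\<^bsub>N\<^esub> h \<zero>\<^bsub>M\<^esub> = h \<zero>\<^bsub>M\<^esub>"
    using rhomD(2)[OF assms(3), of "\<zero>\<^bsub>M\<^esub>" "\<zero>\<^bsub>M\<^esub>"] by simp
  then show ?thesis using rhomD(1)[OF assms(3), of "\<zero>\<^bsub>M\<^esub>"] by simp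
qed

lemma rhom_minus:
  assumes "right_module R M" "right_module R N" "h \<in> rhom R M N" "x \<in> carrier M"
  shows "h (\<ominus>\<^bsub>M\<^esub> x) = \<ominus>\<^bsub>N\<^esub> h x"
proof -
  interpret M: right_module R M by fact
  interpret N: right_module R N by fact
  have "h (\<ominus>\<^bsub>M\<^esub> x) \<oplus>\<^bsub>N\<^esub> h x = \<zero>\<^bsub>N\<^esub>"
    using rhomD(2)[OF assms(3), of "\<ominus>\<^bsub>M\<^esub> x" x] assms(4) rhom_zero[OF assms(1-3)] by (simp add: M.l_neg)
  then show ?thesis using rhomD(1)[OF assms(3)] assms(4) by (simp add: N.minus_equality)
qed

lemma rhom_finsum:
  assumes "right_module R M" "right_module R N" "h \<in> rhom R M N" "f \<in> I \<rightarrow> carrier M"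
  shows "h (\<Oplus>\<^bsub>M\<^esub>i\<in>I. f i) = (\<Oplus>\<^bsub>N\<^esub>i\<in>I. h (f i))"
proof -
  interpret M: right_module R M by fact
  interpret N: right_module R N by fact
  show ?thesis
  proof (cases "finite I")
    case True
    then show ?thesis using assms(4)
    proof (induction I rule: finite_induct)
      case empty then show ?case using rhom_zero[OF assms(1-3)] by simp
    next
      case (insert i I)
      then have "f \<in> I \<rightarrow> carrier M" "f i \<in> carrier M" "(\<lambda>i. h (f i)) \<in> I \<rightarrow> carrier N" "h (f i) \<in> carrier N"
        using rhomD(1)[OF assms(3)] by auto
      with insert show ?case by (simp add: rhomD[OF assms(3)] M.finsum_closed)
    qed
  next
    case False
    then show ?thesis using rhom_zero[OF assms(1-3)] by (simp add: M.add.finprod_infinite N.add.finprod_infinite)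
  qed
qed

lemma rhom_inv:
  assumes "right_module R M" "h \<in> rhom R M N" "bij_betw h (carrier M) (carrier N)"
  shows "inv_into (carrier M) h \<in> rhom R N M"
    and "bij_betw (inv_into (carrier M) h) (carrier N) (carrier M)"
proof -
  interpret M: right_module R M by fact
  let ?g = "inv_into (carrier M) h"
  have g: "?g y \<in> carrier M" "h (?g y) = y" if "y \<in> carrier N" for y
    using that assms(3) by (auto simp: bij_betw_def intro: inv_into_into f_inv_into_f)
  have inj: "inj_on h (carrier M)" using assms(3) by (simp add: bij_betw_def)
  show "?g \<in> rhom R N M"
  proof (rule rhomI)
    fix x y assume "x \<in> carrier N" "y \<in> carrier N"
    then show "?g (x \<oplus>\<^bsub>N\<^esub> y) = ?g x \<oplus>\<^bsub>M\<^esub> ?g y"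
      using g rhomD[OF assms(2)] by (intro inv_into_f_eq[OF inj]) auto
  next
    fix x a assume "x \<in> carrier N" "a \<in> carrier R"
    then show "?g (x \<triangleleft>\<^bsub>N\<^esub> a) = ?g x \<triangleleft>\<^bsub>M\<^esub> a"
      using g rhomD[OF assms(2)] by (intro inv_into_f_eq[OF inj]) auto
  qed (rule g)
  show "bij_betw ?g (carrier N) (carrier M)" using assms(3) by (rule bij_betw_inv_into)
qed

text \<open>\<open>N\<close> is only a record here, so the conclusion creates the module structure:
  every element of \<open>N\<close> is some \<open>h x\<close>, and each law is the image of the
  same law in \<open>M\<close>. It serves for quotients.\<close>

lemma right_module_image:
  assumes "right_module R M"
    and c: "carrier N = h ` carrier M" and z: "h \<zero>\<^bsub>M\<^esub> = \<zero>\<^bsub>N\<^esub>"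
    and a: "\<And>x y. x \<in> carrier M \<Longrightarrow> y \<in> carrier M \<Longrightarrow> h (x \<oplus>\<^bsub>M\<^esub> y) = h x \<oplus>\<^bsub>N\<^esub> h y"
    and r: "\<And>x a. x \<in> carrier M \<Longrightarrow> a \<in> carrier R \<Longrightarrow> h (x \<triangleleft>\<^bsub>M\<^esub> a) = h x \<triangleleft>\<^bsub>N\<^esub> a"
  shows "right_module R N"
proof -
  interpret M: right_module R M by fact
  note s = a[symmetric] r[symmetric] z[symmetric]
  have "abelian_group N"
  proof (rule abelian_groupI)
    fix x assume "x \<in> carrier N"
    then obtain v where "v \<in> carrier M" "x = h v" using c by auto
    then show "\<exists>y\<in>carrier N. y \<oplus>\<^bsub>N\<^esub> x = \<zero>\<^bsub>N\<^esub>"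
      using c by (intro bexI[of _ "h (\<ominus>\<^bsub>M\<^esub> v)"]) (auto simp: s M.l_neg)
  qed (auto simp: c s M.a_ac)
  then show ?thesis
    unfolding right_module_def right_module_axioms_def
    using M.R.ring_axioms by (auto simp: c s M.ract_l_distr M.ract_r_distr M.ract_assoc)
qed

text \<open>Finiteness is kept apart because complements are later found with possibly infinite
  generating sets, such as the whole carrier.\<close>

definition generates :: "('r, 'u) ring_scheme \<Rightarrow> ('r, 'm) rmodule \<Rightarrow> 'm set \<Rightarrow> bool" where
  "generates R M X \<longleftrightarrow> X \<subseteq> carrier M \<and> (\<forall>N. submod R M N \<and> X \<subseteq> N \<longrightarrow> N = carrier M)"

lemma generatesD: "generates R M X \<Longrightarrow> submod R M N \<Longrightarrow> X \<subseteq> N \<Longrightarrow> N = carrier M"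
  by (simp add: generates_def)

lemma fin_gen_iff: "fin_gen R M \<longleftrightarrow> (\<exists>X. finite X \<and> generates R M X)"
  by (auto simp: fin_gen_def generates_def)

section \<open>Submodules, kernels and generating sets\<close>

context right_module
begin

lemma minus_eq_zero_iff: "x \<in> carrier M \<Longrightarrow> y \<in> carrier M \<Longrightarrow> x \<ominus>\<^bsub>M\<^esub> y = \<zero>\<^bsub>M\<^esub> \<longleftrightarrow> x = y"
  by (metis M.a_inv_closed M.l_zero M.minus_eq M.r_neg M.r_zero M.a_assoc M.l_neg)

lemma submodI:
  assumes "U \<subseteq> carrier M" "\<zero>\<^bsub>M\<^esub> \<in> U" "\<And>x y. x \<in> U \<Longrightarrow> y \<in> U \<Longrightarrow> x \<oplus>\<^bsub>M\<^esub> y \<in> U"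
    "\<And>x a. x \<in> U \<Longrightarrow> a \<in> carrier R \<Longrightarrow> x \<triangleleft>\<^bsub>M\<^esub> a \<in> U"
  shows "submod R M U"
proof -
  have "subgroup U (add_monoid M)"
  proof (rule group.subgroupI[OF M.a_group])
    fix x assume x: "x \<in> U"
    then have "x \<triangleleft>\<^bsub>M\<^esub> (\<ominus>\<^bsub>R\<^esub> \<one>\<^bsub>R\<^esub>) \<in> U" by (intro assms(4)) simp_all
    then have "\<ominus>\<^bsub>M\<^esub> x \<in> U" using x assms(1) by (auto simp: ract_minus_right)
    then show "inv\<^bsub>add_monoid M\<^esub> x \<in> U" by (simp add: a_inv_def)
  next
    show "U \<noteq> {}" using assms(2) by blast
  qed (use assms(1,3) in auto)
  then show ?thesis using assms(4) by (simp add: submod_def additive_subgroup_def)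
qed

lemma submodD:
  assumes "submod R M U"
  shows "U \<subseteq> carrier M" "\<zero>\<^bsub>M\<^esub> \<in> U" "x \<in> U \<Longrightarrow> x \<in> carrier M"
    "x \<in> U \<Longrightarrow> y \<in> U \<Longrightarrow> x \<oplus>\<^bsub>M\<^esub> y \<in> U" "x \<in> U \<Longrightarrow> \<ominus>\<^bsub>M\<^esub> x \<in> U" "x \<in> U \<Longrightarrow> y \<in> U \<Longrightarrow> x \<ominus>\<^bsub>M\<^esub> y \<in> U"
    "x \<in> U \<Longrightarrow> a \<in> carrier R \<Longrightarrow> x \<triangleleft>\<^bsub>M\<^esub> a \<in> U"
proof -
  have A: "additive_subgroup U M" and r: "\<And>x a. x \<in> U \<Longrightarrow> a \<in> carrier R \<Longrightarrow> x \<triangleleft>\<^bsub>M\<^esub> a \<in> U"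
    using assms by (auto simp: submod_def)
  interpret A: additive_subgroup U M by (rule A)
  show U: "U \<subseteq> carrier M" "\<zero>\<^bsub>M\<^esub> \<in> U" "x \<in> U \<Longrightarrow> x \<in> carrier M"
    "x \<in> U \<Longrightarrow> y \<in> U \<Longrightarrow> x \<oplus>\<^bsub>M\<^esub> y \<in> U" using A.a_subset A.zero_closed A.a_closed by auto
  show n: "x \<in> U \<Longrightarrow> \<ominus>\<^bsub>M\<^esub> x \<in> U" for x
    using r[of x "\<ominus>\<^bsub>R\<^esub> \<one>\<^bsub>R\<^esub>"] U(1) by (auto simp: ract_minus_right)
  show "x \<in> U \<Longrightarrow> y \<in> U \<Longrightarrow> x \<ominus>\<^bsub>M\<^esub> y \<in> U" using n[of y] A.a_closed by (simp add: a_minus_def)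
  show "x \<in> U \<Longrightarrow> a \<in> carrier R \<Longrightarrow> x \<triangleleft>\<^bsub>M\<^esub> a \<in> U" by (rule r)
qed

lemma submod_finsum:
  assumes "submod R M U" "finite I" "\<And>i. i \<in> I \<Longrightarrow> f i \<in> U"
  shows "(\<Oplus>\<^bsub>M\<^esub>i\<in>I. f i) \<in> U"
  using assms(2,3)
proof (induction I rule: finite_induct)
  case empty then show ?case using submodD(2)[OF assms(1)] by simp
next
  case (insert i I)
  then have "f \<in> I \<rightarrow> carrier M" "f i \<in> carrier M" using submodD(3)[OF assms(1)] by auto
  with insert show ?case using submodD(4)[OF assms(1)] by simp
qed

lemma finsum_ract:
  assumes "f \<in> I \<rightarrow> carrier M" "a \<in> carrier R"
  shows "(\<Oplus>\<^bsub>M\<^esub>i\<in>I. f i) \<triangleleft>\<^bsub>M\<^esub> a = (\<Oplus>\<^bsub>M\<^esub>i\<in>I. f i \<triangleleft>\<^bsub>M\<^esub> a)"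
proof (cases "finite I")
  case True
  then show ?thesis using assms(1)
  proof (induction I rule: finite_induct)
    case empty then show ?case using assms(2) by (simp add: ract_zero_left)
  next
    case (insert i I)
    then have "f \<in> I \<rightarrow> carrier M" "f i \<in> carrier M" "(\<lambda>i. f i \<triangleleft>\<^bsub>M\<^esub> a) \<in> I \<rightarrow> carrier M" "f i \<triangleleft>\<^bsub>M\<^esub> a \<in> carrier M"
      using assms(2) by auto
    with insert show ?case using assms(2) by (simp add: ract_l_distr M.finsum_closed)
  qed
next
  case False
  then show ?thesis using assms(2) by (simp add: M.add.finprod_infinite ract_zero_left)
qed

lemma right_module_submod:
  assumes "submod R M U"
  shows "right_module R (M\<lparr>carrier := U\<rparr>)"
proof -
  note U = submodD[OF assms]
  have "abelian_group (M\<lparr>carrier := U\<rparr>)"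
  proof (rule abelian_groupI)
    fix x assume "x \<in> carrier (M\<lparr>carrier := U\<rparr>)"
    then show "\<exists>y\<in>carrier (M\<lparr>carrier := U\<rparr>). y \<oplus>\<^bsub>M\<lparr>carrier := U\<rparr>\<^esub> x = \<zero>\<^bsub>M\<lparr>carrier := U\<rparr>\<^esub>"
      using U by (intro bexI[of _ "\<ominus>\<^bsub>M\<^esub> x"]) (auto simp: M.l_neg)
  qed (use U in \<open>auto simp: M.a_ac subset_iff\<close>)
  then show ?thesis
    unfolding right_module_def right_module_axioms_def
    using R.ring_axioms U by (auto simp: ract_l_distr ract_r_distr ract_assoc)
qed

lemma rhom_incl: "U \<subseteq> carrier M \<Longrightarrow> (\<lambda>x. x) \<in> rhom R (M\<lparr>carrier := U\<rparr>) M"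
  by (rule rhomI) auto

lemma submod_carrier: "submod R M (carrier M)"
  by (rule submodI) auto

lemma submod_zero: "submod R M {\<zero>\<^bsub>M\<^esub>}"
  by (rule submodI) (auto simp: ract_zero_left)

lemma mem_set_add: "x \<in> U <+>\<^bsub>M\<^esub> V \<longleftrightarrow> (\<exists>u\<in>U. \<exists>v\<in>V. x = u \<oplus>\<^bsub>M\<^esub> v)"
  by (auto simp: set_add_def')

lemma submod_set_add:
  assumes "submod R M U" "submod R M V"
  shows "submod R M (U <+>\<^bsub>M\<^esub> V)"
proof (rule submodI)
  note U = submodD[OF assms(1)] and V = submodD[OF assms(2)]
  show "U <+>\<^bsub>M\<^esub> V \<subseteq> carrier M" using U(3) V(3) by (auto simp: mem_set_add)
  show "\<zero>\<^bsub>M\<^esub> \<in> U <+>\<^bsub>M\<^esub> V" using U(2) V(2) M.r_zero[of "\<zero>\<^bsub>M\<^esub>"] unfolding mem_set_add by force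
  show "x \<oplus>\<^bsub>M\<^esub> y \<in> U <+>\<^bsub>M\<^esub> V" if "x \<in> U <+>\<^bsub>M\<^esub> V" "y \<in> U <+>\<^bsub>M\<^esub> V" for x y
  proof -
    from that obtain u v u' v' where *: "u \<in> U" "v \<in> V" "u' \<in> U" "v' \<in> V" "x = u \<oplus>\<^bsub>M\<^esub> v" "y = u' \<oplus>\<^bsub>M\<^esub> v'"
      unfolding mem_set_add by blast
    then have "x \<oplus>\<^bsub>M\<^esub> y = (u \<oplus>\<^bsub>M\<^esub> u') \<oplus>\<^bsub>M\<^esub> (v \<oplus>\<^bsub>M\<^esub> v')"
      using U(3) V(3) by (simp add: M.a_ac)
    then show ?thesis using * U(4) V(4) unfolding mem_set_add by blast
  qed
  show "x \<triangleleft>\<^bsub>M\<^esub> a \<in> U <+>\<^bsub>M\<^esub> V" if "x \<in> U <+>\<^bsub>M\<^esub> V" "a \<in> carrier R" for x a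
    using that U(3,7) V(3,7) unfolding mem_set_add by (metis ract_l_distr)
qed

lemma set_add_upper:
  assumes "submod R M U" "submod R M V"
  shows "U \<subseteq> U <+>\<^bsub>M\<^esub> V" "V \<subseteq> U <+>\<^bsub>M\<^esub> V"
  using submodD[OF assms(1)] submodD[OF assms(2)] by (auto simp: mem_set_add) (metis M.r_zero M.l_zero)+

end

lemma submod_vimage:
  assumes "right_module R M" "right_module R N" "h \<in> rhom R M N" "submod R N L"
  shows "submod R M {x \<in> carrier M. h x \<in> L}"
proof -
  interpret M: right_module R M by fact
  interpret N: right_module R N by fact
  note L = N.submodD[OF assms(4)]
  show ?thesis
    by (rule M.submodI) (use L rhomD[OF assms(3)] rhom_zero[OF assms(1-3)] in auto)
qed

lemma submod_image:
  assumes "right_module R M" "right_module R N" "h \<in> rhom R M N" "submod R M L"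
  shows "submod R N (h ` L)"
proof -
  interpret M: right_module R M by fact
  interpret N: right_module R N by fact
  note L = M.submodD[OF assms(4)]
  show ?thesis
  proof (rule N.submodI)
    show "h ` L \<subseteq> carrier N" using L rhomD[OF assms(3)] by auto
    show "\<zero>\<^bsub>N\<^esub> \<in> h ` L" using L(2) rhom_zero[OF assms(1-3)] by (metis imageI)
  qed (use L rhomD(2,3)[OF assms(3), symmetric] in auto)
qed

lemma submod_kernel:
  assumes "right_module R M" "right_module R N" "h \<in> rhom R M N"
  shows "submod R M (a_kernel M N h)"
  using submod_vimage[OF assms right_module.submod_zero[OF assms(2)]] by (simp add: a_kernel_def')

text \<open>The elements on which \<open>h\<close> and \<open>h'\<close> agree form a submodule, and
  it contains a generating set.\<close>

lemma rhom_eqI: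
  assumes "right_module R M" "right_module R N" "h \<in> rhom R M N" "h' \<in> rhom R M N"
    and "generates R M X" "\<And>x. x \<in> X \<Longrightarrow> h x = h' x" "y \<in> carrier M"
  shows "h y = h' y"
proof -
  interpret M: right_module R M by fact
  interpret N: right_module R N by fact
  have "submod R M {x \<in> carrier M. h x = h' x}"
    by (rule M.submodI)
       (use rhomD[OF assms(3)] rhomD[OF assms(4)] rhom_zero[OF assms(1-3)] rhom_zero[OF assms(1,2,4)] in auto)
  then have "{x \<in> carrier M. h x = h' x} = carrier M" using assms(5,6) unfolding generates_def by blast
  then show ?thesis using assms(7) by blast
qed

lemma generates_image:
  assumes "right_module R M" "right_module R N" "h \<in> rhom R M N" "h ` carrier M = carrier N" "generates R M X"
  shows "generates R N (h ` X)"
  unfolding generates_def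
proof (intro conjI allI impI)
  show "h ` X \<subseteq> carrier N" using assms(4,5) unfolding generates_def by blast
  fix L assume L: "submod R N L \<and> h ` X \<subseteq> L"
  have "submod R M {x \<in> carrier M. h x \<in> L}" using submod_vimage[OF assms(1-3)] L by blast
  moreover have "X \<subseteq> {x \<in> carrier M. h x \<in> L}" using L assms(5) unfolding generates_def by blast
  ultimately have "{x \<in> carrier M. h x \<in> L} = carrier M" using assms(5) unfolding generates_def by blast
  then have "h ` carrier M \<subseteq> L" by blast
  moreover have "L \<subseteq> carrier N" using right_module.submodD(1)[OF assms(2)] L by blast
  ultimately show "L = carrier N" using assms(4) by simp
qed

lemma fin_gen_image:
  assumes "right_module R M" "right_module R N" "h \<in> rhom R M N" "h ` carrier M = carrier N" "fin_gen R M"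
  shows "fin_gen R N"
  using assms(5) generates_image[OF assms(1-4)] unfolding fin_gen_iff by blast

lemma rhom_restrict_codomain: "h \<in> rhom R M N \<Longrightarrow> h ` carrier M \<subseteq> U \<Longrightarrow> h \<in> rhom R M (N\<lparr>carrier := U\<rparr>)"
  by (auto simp: rhom_def)

section \<open>Finite direct sums\<close>

lemma dsum_family_simps [simp]:
  "carrier (dsum_family I M) = (\<Pi>\<^sub>E i\<in>I. carrier (M i))"
  "\<zero>\<^bsub>dsum_family I M\<^esub> = (\<lambda>i\<in>I. \<zero>\<^bsub>M i\<^esub>)"
  "x \<oplus>\<^bsub>dsum_family I M\<^esub> y = (\<lambda>i\<in>I. x i \<oplus>\<^bsub>M i\<^esub> y i)"
  "x \<triangleleft>\<^bsub>dsum_family I M\<^esub> a = (\<lambda>i\<in>I. x i \<triangleleft>\<^bsub>M i\<^esub> a)"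
  by (simp_all add: dsum_family_def)

lemma right_module_dsum_family:
  assumes "ring R" "\<And>i. i \<in> I \<Longrightarrow> right_module R (M i)"
  shows "right_module R (dsum_family I M)"
proof -
  interpret R: ring R by fact
  note m = right_module.ract_l_distr[OF assms(2)] right_module.ract_r_distr[OF assms(2)]
    right_module.ract_assoc[OF assms(2)] right_module.ract_one[OF assms(2)] right_module.ract_closed[OF assms(2)]
  have ab: "abelian_group (M i)" if "i \<in> I" for i
    using assms(2)[OF that] by (simp add: right_module_def)
  have am: "abelian_monoid (M i)" if "i \<in> I" for i
    using ab[OF that] by (simp add: abelian_group_def)
  note g = abelian_monoid.a_closed[OF am] abelian_monoid.a_assoc[OF am] abelian_monoid.zero_closed[OF am]
    abelian_monoid.l_zero[OF am]
  have "abelian_group (dsum_family I M)"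
  proof (rule abelian_groupI)
    fix x assume x: "x \<in> carrier (dsum_family I M)"
    show "\<exists>y\<in>carrier (dsum_family I M). y \<oplus>\<^bsub>dsum_family I M\<^esub> x = \<zero>\<^bsub>dsum_family I M\<^esub>"
      by (rule bexI[of _ "\<lambda>i\<in>I. \<ominus>\<^bsub>M i\<^esub> x i"])
         (use x ab in \<open>auto simp: PiE_iff abelian_group.l_neg abelian_group.a_inv_closed intro!: restrict_ext\<close>)
  next
    fix x y assume "x \<in> carrier (dsum_family I M)" "y \<in> carrier (dsum_family I M)"
    then show "x \<oplus>\<^bsub>dsum_family I M\<^esub> y = y \<oplus>\<^bsub>dsum_family I M\<^esub> x"
      by (auto simp: abelian_monoid.a_comm[OF am] PiE_iff intro!: restrict_ext)
  qed (auto simp: PiE_iff g extensional_def intro!: ext)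
  then show ?thesis
    unfolding right_module_def right_module_axioms_def
    using R.ring_axioms by (auto simp: PiE_iff m extensional_def intro!: ext)
qed

lemma rhom_proj: "i \<in> I \<Longrightarrow> (\<lambda>x. x i) \<in> rhom R (dsum_family I M) (M i)"
  by (rule rhomI) auto

definition inj_at :: "'i set \<Rightarrow> ('i \<Rightarrow> ('r, 'm) rmodule) \<Rightarrow> 'i \<Rightarrow> 'm \<Rightarrow> 'i \<Rightarrow> 'm" where
  "inj_at I M i x = (\<lambda>j\<in>I. if j = i then x else \<zero>\<^bsub>M j\<^esub>)"

lemma rhom_inj_at:
  assumes "\<And>i. i \<in> I \<Longrightarrow> right_module R (M i)" "i \<in> I"
  shows "inj_at I M i \<in> rhom R (M i) (dsum_family I M)"
proof (rule rhomI)
  have ab: "abelian_monoid (M i)" if "i \<in> I" for i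
    using assms(1)[OF that] by (simp add: right_module_def abelian_group_def)
  note z = abelian_monoid.zero_closed[OF ab] abelian_monoid.l_zero[OF ab] right_module.ract_zero_left[OF assms(1)]
  show "inj_at I M i x \<in> carrier (dsum_family I M)" if "x \<in> carrier (M i)" for x
    using that z by (auto simp: inj_at_def)
  show "inj_at I M i (x \<oplus>\<^bsub>M i\<^esub> y) = inj_at I M i x \<oplus>\<^bsub>dsum_family I M\<^esub> inj_at I M i y"
    if "x \<in> carrier (M i)" "y \<in> carrier (M i)" for x y
    using that z by (auto simp: inj_at_def)
  show "inj_at I M i (x \<triangleleft>\<^bsub>M i\<^esub> a) = inj_at I M i x \<triangleleft>\<^bsub>dsum_family I M\<^esub> a"
    if "x \<in> carrier (M i)" "a \<in> carrier R" for x a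
    using that z by (auto simp: inj_at_def)
qed

lemma dsum_family_decomp:
  assumes "ring R" "\<And>i. i \<in> I \<Longrightarrow> right_module R (M i)" "finite I" "x \<in> carrier (dsum_family I M)"
  shows "x = (\<Oplus>\<^bsub>dsum_family I M\<^esub>i\<in>I. inj_at I M i (x i))"
proof (rule extensionalityI[of _ I])
  let ?D = "dsum_family I M"
  interpret D: right_module R ?D by (rule right_module_dsum_family[OF assms(1,2)])
  have cl: "(\<lambda>i. inj_at I M i (x i)) \<in> I \<rightarrow> carrier ?D"
  proof
    fix i assume "i \<in> I"
    then show "inj_at I M i (x i) \<in> carrier ?D"
      using assms(4) by (intro rhomD(1)[OF rhom_inj_at[OF assms(2)]]) auto
  qed
  show "x \<in> extensional I" using assms(4) by (auto simp: PiE_iff)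
  have "(\<Oplus>\<^bsub>?D\<^esub>i\<in>I. inj_at I M i (x i)) \<in> carrier ?D" using cl by (rule D.M.finsum_closed)
  then show "(\<Oplus>\<^bsub>?D\<^esub>i\<in>I. inj_at I M i (x i)) \<in> extensional I" by (auto simp: PiE_iff)
  fix j assume j: "j \<in> I"
  interpret j: right_module R "M j" by (rule assms(2)[OF j])
  have xj: "x j \<in> carrier (M j)" using assms(4) j by auto
  have "(\<Oplus>\<^bsub>?D\<^esub>i\<in>I. inj_at I M i (x i)) j = (\<Oplus>\<^bsub>M j\<^esub>i\<in>I. inj_at I M i (x i) j)"
    by (rule rhom_finsum[OF D.right_module_axioms j.right_module_axioms rhom_proj[OF j] cl])
  also have "\<dots> = (\<Oplus>\<^bsub>M j\<^esub>i\<in>I. if j = i then x j else \<zero>\<^bsub>M j\<^esub>)"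
    using j xj by (intro j.M.finsum_cong') (auto simp: inj_at_def)
  also have "\<dots> = x j" using j xj assms(3) by (simp add: j.M.finsum_singleton)
  finally show "x j = (\<Oplus>\<^bsub>?D\<^esub>i\<in>I. inj_at I M i (x i)) j" by simp
qed

lemma generates_dsum_family:
  assumes "ring R" "\<And>i. i \<in> I \<Longrightarrow> right_module R (M i)" "finite I" "\<And>i. i \<in> I \<Longrightarrow> generates R (M i) (X i)"
  shows "generates R (dsum_family I M) (\<Union>i\<in>I. inj_at I M i ` X i)"
  unfolding generates_def
proof (intro conjI allI impI)
  let ?D = "dsum_family I M"
  interpret D: right_module R ?D by (rule right_module_dsum_family[OF assms(1,2)])
  have rj: "inj_at I M i \<in> rhom R (M i) ?D" if "i \<in> I" for i
    by (intro rhom_inj_at assms(2) that)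
  show "(\<Union>i\<in>I. inj_at I M i ` X i) \<subseteq> carrier ?D"
  proof clarify
    fix i x assume i: "i \<in> I" and x: "x \<in> X i"
    then have "x \<in> carrier (M i)" using assms(4)[OF i] unfolding generates_def by blast
    then show "inj_at I M i x \<in> carrier ?D" by (rule rhomD(1)[OF rj[OF i]])
  qed
  fix N assume N: "submod R ?D N \<and> (\<Union>i\<in>I. inj_at I M i ` X i) \<subseteq> N"
  have 1: "inj_at I M i x \<in> N" if "i \<in> I" "x \<in> carrier (M i)" for i x
  proof -
    have "submod R (M i) {x \<in> carrier (M i). inj_at I M i x \<in> N}"
      using submod_vimage[OF assms(2)[OF that(1)] D.right_module_axioms rj[OF that(1)]] N by blast
    moreover have "X i \<subseteq> {x \<in> carrier (M i). inj_at I M i x \<in> N}"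
      using N assms(4)[OF that(1)] that(1) unfolding generates_def by blast
    ultimately show ?thesis using assms(4)[OF that(1)] that(2) unfolding generates_def by blast
  qed
  have "x \<in> N" if "x \<in> carrier ?D" for x
  proof -
    have "(\<Oplus>\<^bsub>?D\<^esub>i\<in>I. inj_at I M i (x i)) \<in> N"
      by (rule D.submod_finsum) (use N assms(3) 1 that in auto)
    then show ?thesis using dsum_family_decomp[OF assms(1-3) that] by simp
  qed
  then show "N = carrier ?D" using N D.submodD(1) by blast
qed

lemma fin_gen_dsum_family:
  assumes "ring R" "\<And>i. i \<in> I \<Longrightarrow> right_module R (M i)" "finite I" "\<And>i. i \<in> I \<Longrightarrow> fin_gen R (M i)"
  shows "fin_gen R (dsum_family I M)"
proof -
  have "\<forall>i\<in>I. \<exists>X. finite X \<and> generates R (M i) X" using assms(4) unfolding fin_gen_iff by blast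
  then obtain X where "\<forall>i\<in>I. finite (X i) \<and> generates R (M i) (X i)" by metis
  then show ?thesis unfolding fin_gen_iff using generates_dsum_family[OF assms(1-3)] assms(3)
    by (intro exI[of _ "\<Union>i\<in>I. inj_at I M i ` X i"]) auto
qed

section \<open>Restriction of scalars and complements\<close>

lemma ring_restrict:
  assumes "ring R" "S \<subseteq> carrier R" "\<one>\<^bsub>R\<^esub> \<in> S" "\<And>a b. a \<in> S \<Longrightarrow> b \<in> S \<Longrightarrow> a \<oplus>\<^bsub>R\<^esub> b \<in> S"
    "\<And>a b. a \<in> S \<Longrightarrow> b \<in> S \<Longrightarrow> a \<otimes>\<^bsub>R\<^esub> b \<in> S" "\<And>a. a \<in> S \<Longrightarrow> \<ominus>\<^bsub>R\<^esub> a \<in> S"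
  shows "ring (R\<lparr>carrier := S\<rparr>)"
proof -
  interpret R: ring R by fact
  note S = subsetD[OF assms(2)]
  have z: "\<zero>\<^bsub>R\<^esub> \<in> S" using assms(4)[OF assms(3) assms(6)[OF assms(3)]] by (simp add: R.r_neg)
  have "abelian_group (R\<lparr>carrier := S\<rparr>)"
  proof (rule abelian_groupI)
    fix x assume "x \<in> carrier (R\<lparr>carrier := S\<rparr>)"
    then show "\<exists>y\<in>carrier (R\<lparr>carrier := S\<rparr>). y \<oplus>\<^bsub>R\<lparr>carrier := S\<rparr>\<^esub> x = \<zero>\<^bsub>R\<lparr>carrier := S\<rparr>\<^esub>"
      using assms(6) S by (intro bexI[of _ "\<ominus>\<^bsub>R\<^esub> x"]) (auto simp: R.l_neg)
  qed (use S z assms(4) in \<open>auto simp: R.a_ac\<close>)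
  moreover have "monoid (R\<lparr>carrier := S\<rparr>)"
    by (rule monoidI) (use S assms(3,5) in \<open>auto simp: R.m_assoc\<close>)
  ultimately show ?thesis
    by (rule ringI) (use S in \<open>auto simp: R.l_distr R.r_distr\<close>)
qed

lemma right_module_restrict:
  assumes "right_module R M" "ring (R\<lparr>carrier := S\<rparr>)" "S \<subseteq> carrier R"
  shows "right_module (R\<lparr>carrier := S\<rparr>) M"
proof -
  interpret M: right_module R M by fact
  note S = subsetD[OF assms(3)]
  show ?thesis unfolding right_module_def right_module_axioms_def
    using assms(2) M.abelian_group_axioms S
    by (auto simp: M.ract_l_distr M.ract_r_distr M.ract_assoc)
qed

text \<open>The hypothesis \<open>simple\<close> makes each cyclic submodule dR simple or zero, so
  this is the classical fact that submodules of a sum of simple modules have complements. Zorn's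
  lemma gives a submodule C maximal among those meeting U trivially. If a generator d lay outside U
  + C, then C + dR would still meet U trivially, against maximality. Hence M is the direct sum of U
  and C, and \<open>p\<close> is the projection along C.\<close>

lemma (in right_module) retract_exists:
  assumes D: "generates R M D"
    and simple: "\<And>d s. d \<in> D \<Longrightarrow> s \<in> carrier R \<Longrightarrow> d \<triangleleft>\<^bsub>M\<^esub> s \<noteq> \<zero>\<^bsub>M\<^esub> \<Longrightarrow> \<exists>t\<in>carrier R. (d \<triangleleft>\<^bsub>M\<^esub> s) \<triangleleft>\<^bsub>M\<^esub> t = d"
    and U: "submod R M U"
  shows "\<exists>p \<in> rhom R M M. p ` carrier M \<subseteq> U \<and> (\<forall>u\<in>U. p u = u)"
proof -
  define F where "F = {C. submod R M C \<and> U \<inter> C = {\<zero>\<^bsub>M\<^esub>}}"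
  note U' = submodD[OF U]
  have "\<exists>C\<in>F. \<forall>X\<in>F. C \<subseteq> X \<longrightarrow> X = C"
  proof (rule subset_Zorn_nonempty)
    show "F \<noteq> {}" using submod_zero U'(2) unfolding F_def by blast
    fix Ch assume ne: "Ch \<noteq> {}" and ch: "subset.chain F Ch"
    then have c1: "\<And>X. X \<in> Ch \<Longrightarrow> submod R M X" "\<And>X. X \<in> Ch \<Longrightarrow> U \<inter> X = {\<zero>\<^bsub>M\<^esub>}"
      and c2: "\<And>X Y. X \<in> Ch \<Longrightarrow> Y \<in> Ch \<Longrightarrow> X \<subseteq> Y \<or> Y \<subseteq> X"
      unfolding F_def subset_chain_def by auto
    have "submod R M (\<Union>Ch)"
    proof (rule submodI)
      show "\<Union>Ch \<subseteq> carrier M" using submodD(1)[OF c1(1)] by blast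
      show "\<zero>\<^bsub>M\<^esub> \<in> \<Union>Ch" using ne submodD(2)[OF c1(1)] by blast
      fix x y assume "x \<in> \<Union>Ch" "y \<in> \<Union>Ch"
      then obtain X Y where XY: "X \<in> Ch" "x \<in> X" "Y \<in> Ch" "y \<in> Y" by blast
      then have "\<exists>Z\<in>Ch. x \<in> Z \<and> y \<in> Z" using c2 by blast
      then obtain Z where "Z \<in> Ch" "x \<in> Z" "y \<in> Z" by blast
      then show "x \<oplus>\<^bsub>M\<^esub> y \<in> \<Union>Ch" using submodD(4)[OF c1(1)] by blast
    next
      fix x a assume "x \<in> \<Union>Ch" "a \<in> carrier R"
      then show "x \<triangleleft>\<^bsub>M\<^esub> a \<in> \<Union>Ch" using submodD(7)[OF c1(1)] by blast
    qed
    moreover have "U \<inter> \<Union>Ch = {\<zero>\<^bsub>M\<^esub>}" using c1(2) ne by blast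
    ultimately show "\<Union>Ch \<in> F" by (simp add: F_def)
  qed
  then obtain C where CF: "C \<in> F" and mx: "\<And>X. X \<in> F \<Longrightarrow> C \<subseteq> X \<Longrightarrow> X = C" by blast
  have C: "submod R M C" "U \<inter> C = {\<zero>\<^bsub>M\<^esub>}" using CF by (simp_all add: F_def)
  note C' = submodD[OF C(1)]
  have dUC: "d \<in> U <+>\<^bsub>M\<^esub> C" if d: "d \<in> D" for d
  proof (rule ccontr)
    assume n: "d \<notin> U <+>\<^bsub>M\<^esub> C"
    have dM: "d \<in> carrier M" using d D by (auto simp: generates_def)
    let ?L = "(\<lambda>s. d \<triangleleft>\<^bsub>M\<^esub> s) ` carrier R"
    have L: "submod R M ?L"
    proof (rule submodI)
      show "\<zero>\<^bsub>M\<^esub> \<in> ?L" using ract_zero_right[OF dM] R.zero_closed by (metis imageI)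
    next
      fix x y assume "x \<in> ?L" "y \<in> ?L"
      then show "x \<oplus>\<^bsub>M\<^esub> y \<in> ?L" using dM by (auto simp: ract_r_distr[symmetric])
    next
      fix x a assume "x \<in> ?L" "a \<in> carrier R"
      then show "x \<triangleleft>\<^bsub>M\<^esub> a \<in> ?L" using dM by (auto simp: ract_assoc[symmetric])
    qed (use dM in auto)
    let ?C = "C <+>\<^bsub>M\<^esub> ?L"
    have sC: "submod R M ?C" by (rule submod_set_add[OF C(1) L])
    \<comment> \<open>If the part of u in dR is nonzero, acting by a suitable t returns d itself, so
      d = ut - ct lies in U + C, contrary to the choice of d.\<close>
    have "u = \<zero>\<^bsub>M\<^esub>" if u: "u \<in> U" "u \<in> ?C" for u
    proof -
      obtain c s where cs: "c \<in> C" "s \<in> carrier R" "u = c \<oplus>\<^bsub>M\<^esub> (d \<triangleleft>\<^bsub>M\<^esub> s)" using u(2) by (auto simp: mem_set_add)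
      show ?thesis
      proof (cases "d \<triangleleft>\<^bsub>M\<^esub> s = \<zero>\<^bsub>M\<^esub>")
        case True
        then have "u \<in> C" using cs C'(3) by simp
        then show ?thesis using u C(2) by blast
      next
        case False
        then obtain t where t: "t \<in> carrier R" "(d \<triangleleft>\<^bsub>M\<^esub> s) \<triangleleft>\<^bsub>M\<^esub> t = d" using simple[OF d cs(2)] by blast
        have cM: "c \<in> carrier M" "u \<in> carrier M" using cs(1) C'(3) u U'(3) by auto
        have "d \<triangleleft>\<^bsub>M\<^esub> s = u \<oplus>\<^bsub>M\<^esub> (\<ominus>\<^bsub>M\<^esub> c)" using cM dM cs(2) unfolding cs(3)
          by (simp add: M.a_ac M.r_neg1 M.r_neg2 M.r_neg M.l_neg)
        then have "d = (u \<triangleleft>\<^bsub>M\<^esub> t) \<oplus>\<^bsub>M\<^esub> ((\<ominus>\<^bsub>M\<^esub> c) \<triangleleft>\<^bsub>M\<^esub> t)" using t cM by (metis M.a_inv_closed ract_l_distr)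
        moreover have "u \<triangleleft>\<^bsub>M\<^esub> t \<in> U" "(\<ominus>\<^bsub>M\<^esub> c) \<triangleleft>\<^bsub>M\<^esub> t \<in> C" using u(1) cs(1) t(1) U'(7) C'(5,7) by auto
        ultimately have "d \<in> U <+>\<^bsub>M\<^esub> C" unfolding mem_set_add by blast
        with n show ?thesis by blast
      qed
    qed
    then have "?C \<in> F" using sC U'(2) submodD(2)[OF sC] unfolding F_def by blast
    moreover have "C \<subseteq> ?C" "?L \<subseteq> ?C" using set_add_upper[OF C(1) L] by auto
    ultimately have "?L \<subseteq> C" using mx by blast
    moreover have "d \<in> ?L" using ract_one[OF dM] R.one_closed by (metis imageI)
    ultimately have "d \<in> C" by blast
    then show False using n set_add_upper(2)[OF U C(1)] by blast
  qed
  then have "U <+>\<^bsub>M\<^esub> C = carrier M"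
    using D submod_set_add[OF U C(1)] unfolding generates_def by blast
  then have "\<forall>x\<in>carrier M. \<exists>u. u \<in> U \<and> (\<exists>c\<in>C. x = u \<oplus>\<^bsub>M\<^esub> c)"
    using mem_set_add[of _ U C] by blast
  then obtain p where p: "\<And>x. x \<in> carrier M \<Longrightarrow> p x \<in> U \<and> (\<exists>c\<in>C. x = p x \<oplus>\<^bsub>M\<^esub> c)" by metis
  \<comment> \<open>Two decompositions of x differ by an element of both U and C, hence by zero.
    This is what makes the arbitrarily chosen \<open>p\<close> additive and linear.\<close>
  have uniq: "p x = u" if *: "x = u \<oplus>\<^bsub>M\<^esub> c" "u \<in> U" "c \<in> C" for x u c
  proof -
    have M: "u \<in> carrier M" "c \<in> carrier M" "x \<in> carrier M" using * U'(3) C'(3) by auto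
    obtain c' where c': "c' \<in> C" "x = p x \<oplus>\<^bsub>M\<^esub> c'" "p x \<in> U" using p[OF M(3)] by blast
    have M': "p x \<in> carrier M" "c' \<in> carrier M" using c' U'(3) C'(3) by auto
    have "p x = p x \<oplus>\<^bsub>M\<^esub> c' \<oplus>\<^bsub>M\<^esub> (\<ominus>\<^bsub>M\<^esub> c')" using M' by (simp add: M.a_assoc M.r_neg)
    also have "\<dots> = u \<oplus>\<^bsub>M\<^esub> (c \<ominus>\<^bsub>M\<^esub> c')" using c'(2) *(1) M M' by (simp add: M.a_assoc a_minus_def)
    finally have "p x \<ominus>\<^bsub>M\<^esub> u = c \<ominus>\<^bsub>M\<^esub> c'"
      using M M' by (metis M.add.inv_solve_left' M.add.m_comm M.minus_closed M.a_inv_closed a_minus_def)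
    moreover have "p x \<ominus>\<^bsub>M\<^esub> u \<in> U" "c \<ominus>\<^bsub>M\<^esub> c' \<in> C" using c' * U'(6) C'(6) by auto
    ultimately have "p x \<ominus>\<^bsub>M\<^esub> u = \<zero>\<^bsub>M\<^esub>" using C(2) by (metis IntI singletonD)
    then show ?thesis using minus_eq_zero_iff[OF M'(1) M(1)] by blast
  qed
  have "p \<in> rhom R M M"
  proof (rule rhomI)
    show "p x \<in> carrier M" if "x \<in> carrier M" for x using p[OF that] U'(3) by blast
  next
    fix x y assume xy: "x \<in> carrier M" "y \<in> carrier M"
    obtain c d where cd: "c \<in> C" "x = p x \<oplus>\<^bsub>M\<^esub> c" "d \<in> C" "y = p y \<oplus>\<^bsub>M\<^esub> d" using p xy by metis
    have M: "p x \<in> carrier M" "p y \<in> carrier M" "c \<in> carrier M" "d \<in> carrier M" using p xy cd U'(3) C'(3) by auto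
    have "x \<oplus>\<^bsub>M\<^esub> y = (p x \<oplus>\<^bsub>M\<^esub> c) \<oplus>\<^bsub>M\<^esub> (p y \<oplus>\<^bsub>M\<^esub> d)" using cd by simp
    also have "\<dots> = (p x \<oplus>\<^bsub>M\<^esub> p y) \<oplus>\<^bsub>M\<^esub> (c \<oplus>\<^bsub>M\<^esub> d)" using M by (simp add: M.a_ac)
    finally show "p (x \<oplus>\<^bsub>M\<^esub> y) = p x \<oplus>\<^bsub>M\<^esub> p y" by (rule uniq) (use p xy cd U'(4) C'(4) in auto)
  next
    fix x a assume xa: "x \<in> carrier M" "a \<in> carrier R"
    obtain c where c: "c \<in> C" "x = p x \<oplus>\<^bsub>M\<^esub> c" using p xa by metis
    then have "x \<triangleleft>\<^bsub>M\<^esub> a = (p x \<triangleleft>\<^bsub>M\<^esub> a) \<oplus>\<^bsub>M\<^esub> (c \<triangleleft>\<^bsub>M\<^esub> a)"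
      using p[OF xa(1)] U'(3) C'(3) xa(2) by (metis ract_l_distr)
    then show "p (x \<triangleleft>\<^bsub>M\<^esub> a) = p x \<triangleleft>\<^bsub>M\<^esub> a" by (rule uniq) (use p xa c U'(7) C'(7) in auto)
  qed
  moreover have "p u = u" if "u \<in> U" for u
    by (rule uniq[of _ _ "\<zero>\<^bsub>M\<^esub>"]) (use that U'(3) C'(2) in auto)
  moreover have "p ` carrier M \<subseteq> U" using p by blast
  ultimately show ?thesis by blast
qed

section \<open>Copies of modules with the fixed element type\<close>

lemma (in right_module) right_module_copy:
  assumes "fin_gen R M"
  obtains N h where "N \<in> fgmod R" "h \<in> rhom R M N" "bij_betw h (carrier M) (carrier N)"
  using fgmod_copy_exists[OF right_module_axioms assms] unfolding riso_def by blast

text \<open>Both directions are kept as homomorphisms, since maps are transported into and out of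
  the copy.\<close>

definition iso_pair where
  "iso_pair R M N t t' \<longleftrightarrow> t \<in> rhom R M N \<and> t' \<in> rhom R N M \<and>
     (\<forall>a\<in>carrier M. t' (t a) = a) \<and> (\<forall>b\<in>carrier N. t (t' b) = b)"

lemma (in right_module) iso_pair_exists:
  assumes "fin_gen R M"
  obtains P t t' where "P \<in> fgmod R" "iso_pair R M P t t'"
proof -
  obtain P t where P: "P \<in> fgmod R" "t \<in> rhom R M P" "bij_betw t (carrier M) (carrier P)"
    by (rule right_module_copy[OF assms])
  have "iso_pair R M P t (inv_into (carrier M) t)"
    unfolding iso_pair_def using P(2,3) rhom_inv(1)[OF right_module_axioms P(2,3)]
    by (auto simp: bij_betw_inv_into_left bij_betw_inv_into_right)
  then show ?thesis by (rule that[OF P(1)])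
qed

text \<open>Syzygies must belong to \<open>fgmod\<close>, whose element type is fixed. A finitely
  generated submodule is therefore replaced by a copy, and \<open>f\<close> plays the part of the
  inclusion.\<close>

lemma (in right_module) submod_copy:
  assumes "submod R M U" "fin_gen R (M\<lparr>carrier := U\<rparr>)"
  obtains N f where "N \<in> fgmod R" "f \<in> rhom R N M" "inj_on f (carrier N)" "f ` carrier N = U"
proof -
  interpret U: right_module R "M\<lparr>carrier := U\<rparr>" by (rule right_module_submod[OF assms(1)])
  obtain N h where h: "N \<in> fgmod R" "h \<in> rhom R (M\<lparr>carrier := U\<rparr>) N" "bij_betw h U (carrier N)"
    using U.right_module_copy[OF assms(2)] by auto
  let ?f = "inv_into U h"
  have f: "?f \<in> rhom R N (M\<lparr>carrier := U\<rparr>)" "bij_betw ?f (carrier N) U"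
    using rhom_inv[OF U.right_module_axioms h(2)] h(3) by auto
  show ?thesis
  proof (rule that[OF h(1)])
    show "?f \<in> rhom R N M"
      using rhom_comp[OF f(1) rhom_incl] submodD(1)[OF assms(1)] by simp
  qed (use f(2) in \<open>auto simp: bij_betw_def\<close>)
qed

lemma (in right_module) quotient_copy:
  assumes "submod R M U" "fin_gen R M"
  obtains N g where "N \<in> fgmod R" "g \<in> rhom R M N" "g ` carrier M = carrier N" "a_kernel M N g = U"
proof -
  note U = submodD[OF assms(1)]
  have au: "additive_subgroup U M" using assms(1) by (simp add: submod_def)
  interpret U: abelian_subgroup U M by (rule abelian_subgroupI3[OF au M.abelian_group_axioms])
  let ?q = "\<lambda>x. U +>\<^bsub>M\<^esub> x"
  \<comment> \<open>The elementwise product of a coset with a need not fill a whole coset, so U is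
    added back in the action.\<close>
  define Q :: "('r, 'm set) rmodule" where
    "Q = \<lparr>carrier = ?q ` carrier M, mult = undefined, one = undefined, zero = U,
          add = (\<lambda>S T. S <+>\<^bsub>M\<^esub> T), ract = (\<lambda>S a. U <+>\<^bsub>M\<^esub> (\<lambda>x. x \<triangleleft>\<^bsub>M\<^esub> a) ` S)\<rparr>"
  have Q: "carrier Q = ?q ` carrier M" "\<zero>\<^bsub>Q\<^esub> = U" "S \<oplus>\<^bsub>Q\<^esub> T = S <+>\<^bsub>M\<^esub> T"
    "S \<triangleleft>\<^bsub>Q\<^esub> a = U <+>\<^bsub>M\<^esub> (\<lambda>x. x \<triangleleft>\<^bsub>M\<^esub> a) ` S" for S T a by (simp_all add: Q_def)
  have act: "U <+>\<^bsub>M\<^esub> (\<lambda>x. x \<triangleleft>\<^bsub>M\<^esub> a) ` (?q x) = ?q (x \<triangleleft>\<^bsub>M\<^esub> a)" if "x \<in> carrier M" "a \<in> carrier R" for x a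
  proof (intro equalityI subsetI)
    fix z assume "z \<in> U <+>\<^bsub>M\<^esub> (\<lambda>x. x \<triangleleft>\<^bsub>M\<^esub> a) ` (?q x)"
    then obtain u v where uv: "u \<in> U" "v \<in> U" "z = u \<oplus>\<^bsub>M\<^esub> ((v \<oplus>\<^bsub>M\<^esub> x) \<triangleleft>\<^bsub>M\<^esub> a)"
      by (auto simp: mem_set_add a_r_coset_def')
    then have "z = (u \<oplus>\<^bsub>M\<^esub> (v \<triangleleft>\<^bsub>M\<^esub> a)) \<oplus>\<^bsub>M\<^esub> (x \<triangleleft>\<^bsub>M\<^esub> a)"
      using that U(3) by (simp add: ract_l_distr M.a_assoc)
    moreover have "u \<oplus>\<^bsub>M\<^esub> (v \<triangleleft>\<^bsub>M\<^esub> a) \<in> U" using uv U(4,7) that by simp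
    ultimately show "z \<in> ?q (x \<triangleleft>\<^bsub>M\<^esub> a)" by (auto simp: a_r_coset_def')
  next
    fix z assume "z \<in> ?q (x \<triangleleft>\<^bsub>M\<^esub> a)"
    then obtain u where u: "u \<in> U" "z = u \<oplus>\<^bsub>M\<^esub> (x \<triangleleft>\<^bsub>M\<^esub> a)" by (auto simp: a_r_coset_def')
    moreover have "x \<in> ?q x" using that by (intro U.a_rcos_self) auto
    ultimately show "z \<in> U <+>\<^bsub>M\<^esub> (\<lambda>x. x \<triangleleft>\<^bsub>M\<^esub> a) ` (?q x)" unfolding mem_set_add by blast
  qed
  have z: "?q \<zero>\<^bsub>M\<^esub> = U" using U(1) by simp
  have rm: "right_module R Q"
    by (rule right_module_image[OF right_module_axioms, where h = ?q])
       (simp_all add: Q z act U.a_rcos_sum)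
  have q: "?q \<in> rhom R M Q" by (rule rhomI) (simp_all add: Q act U.a_rcos_sum)
  interpret Q: right_module R Q by (rule rm)
  have fg: "fin_gen R Q" by (rule fin_gen_image[OF right_module_axioms rm q _ assms(2)]) (simp add: Q)
  obtain N h where N: "N \<in> fgmod R" "h \<in> rhom R Q N" "bij_betw h (carrier Q) (carrier N)"
    by (rule Q.right_module_copy[OF fg])
  have rN: "right_module R N" using N(1) by (simp add: fgmod_def)
  have ker: "h (?q x) = \<zero>\<^bsub>N\<^esub> \<longleftrightarrow> x \<in> U" if x: "x \<in> carrier M" for x
  proof -
    have "h (?q x) = \<zero>\<^bsub>N\<^esub> \<longleftrightarrow> h (?q x) = h \<zero>\<^bsub>Q\<^esub>" using rhom_zero[OF rm rN N(2)] by simp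
    also have "\<dots> \<longleftrightarrow> ?q x = U"
      using N(3) x Q.M.zero_closed unfolding bij_betw_def by (subst inj_on_eq_iff) (auto simp: Q)
    also have "\<dots> \<longleftrightarrow> x \<in> U" using x U.a_rcos_const U.a_rcos_self by metis
    finally show ?thesis .
  qed
  show ?thesis
  proof (rule that[OF N(1) rhom_comp[OF q N(2)]])
    show "(\<lambda>x. h (?q x)) ` carrier M = carrier N" using N(3) Q(1) by (auto simp: bij_betw_def image_image)
    show "a_kernel M N (\<lambda>x. h (?q x)) = U" using ker U(1) by (auto simp: a_kernel_def')
  qed
qed

definition reg_module :: "('r, 'u) ring_scheme \<Rightarrow> ('r, 'r) rmodule" where
  "reg_module R = \<lparr>carrier = carrier R, mult = undefined, one = undefined, zero = \<zero>\<^bsub>R\<^esub>,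
     add = (\<lambda>x y. x \<oplus>\<^bsub>R\<^esub> y), ract = (\<lambda>x a. x \<otimes>\<^bsub>R\<^esub> a)\<rparr>"

lemma reg_module_simps [simp]:
  "carrier (reg_module R) = carrier R" "\<zero>\<^bsub>reg_module R\<^esub> = \<zero>\<^bsub>R\<^esub>"
  "x \<oplus>\<^bsub>reg_module R\<^esub> y = x \<oplus>\<^bsub>R\<^esub> y" "x \<triangleleft>\<^bsub>reg_module R\<^esub> a = x \<otimes>\<^bsub>R\<^esub> a"
  by (simp_all add: reg_module_def)

lemma (in ring) right_module_reg: "right_module R (reg_module R)"
proof -
  have "abelian_group (reg_module R)"
  proof (rule abelian_groupI)
    fix x assume "x \<in> carrier (reg_module R)"
    then show "\<exists>y\<in>carrier (reg_module R). y \<oplus>\<^bsub>reg_module R\<^esub> x = \<zero>\<^bsub>reg_module R\<^esub>"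
      by (intro bexI[of _ "\<ominus> x"]) (auto simp: l_neg)
  qed (auto simp: a_ac)
  then show ?thesis unfolding right_module_def right_module_axioms_def
    using ring_axioms by (auto simp: l_distr r_distr m_assoc)
qed

lemma (in right_module) rhom_mult: "x \<in> carrier M \<Longrightarrow> (\<lambda>a. x \<triangleleft>\<^bsub>M\<^esub> a) \<in> rhom R (reg_module R) M"
  by (rule rhomI) (auto simp: ract_r_distr ract_assoc)

section \<open>Radical square zero rings in coordinates\<close>

text \<open>The element \<open>el c d\<close> is the linear combination of the idempotents \<open>e\<^sub>i\<close> with coefficients \<open>c i\<close> and of
  the arrows with coefficients given by \<open>d\<close>.\<close>

locale rsz_ring = Q: fin_digraph Q + A: ring A
  for Q :: "('v, 'a) pre_digraph" and A :: "('r, 'u) ring_scheme" +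
  fixes el :: "('v \<Rightarrow> 'k::field) \<Rightarrow> ('a \<Rightarrow> 'k) \<Rightarrow> 'r"
  assumes el_closed [simp]: "el c d \<in> carrier A"
    and el_surj: "a \<in> carrier A \<Longrightarrow> \<exists>c d. a = el c d"
    and el_eq: "el c d = el c' d' \<longleftrightarrow> (\<forall>i\<in>verts Q. c i = c' i) \<and> (\<forall>e\<in>arcs Q. d e = d' e)"
    and el_add: "el c d \<oplus>\<^bsub>A\<^esub> el c' d' = el (\<lambda>i. c i + c' i) (\<lambda>e. d e + d' e)"
    and el_mult: "el c d \<otimes>\<^bsub>A\<^esub> el c' d' =
          el (\<lambda>i. c i * c' i) (\<lambda>e. c (tail Q e) * d' e + d e * c' (head Q e))"
    and el_one: "\<one>\<^bsub>A\<^esub> = el (\<lambda>_. 1) (\<lambda>_. 0)"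
begin

definition "ep i = el (\<lambda>j. if j = i then 1 else 0) (\<lambda>_. 0)"
definition "ar e = el (\<lambda>_. 0) (\<lambda>\<beta>. if \<beta> = e then 1 else 0)"
definition "sc k = el (\<lambda>_. k) (\<lambda>_. 0)"
text \<open>\<open>Br\<close> is a product of copies of the field, one for each vertex, and
  complements the span of the arrows in A. \<open>Kr\<close> is the image of the field in the centre
  of A, so its modules are vector spaces.\<close>

definition "Br = A\<lparr>carrier := range (\<lambda>c. el c (\<lambda>_. 0))\<rparr>"
definition "Kr = A\<lparr>carrier := range sc\<rparr>"

lemma basis_closed [simp]: "ep i \<in> carrier A" "ar e \<in> carrier A" "sc k \<in> carrier A"
  by (simp_all add: ep_def ar_def sc_def)

lemma tail_head [simp]: "e \<in> arcs Q \<Longrightarrow> tail Q e \<in> verts Q" "e \<in> arcs Q \<Longrightarrow> head Q e \<in> verts Q"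
  by auto

lemma el_zero: "\<zero>\<^bsub>A\<^esub> = el (\<lambda>_. 0) (\<lambda>_. 0)"
proof -
  have "el (\<lambda>_. 0) (\<lambda>_. 0) \<oplus>\<^bsub>A\<^esub> el (\<lambda>_. 0) (\<lambda>_. 0) = el (\<lambda>_. 0) (\<lambda>_. 0)" by (simp add: el_add)
  then show ?thesis by (metis A.add.l_cancel_one el_closed)
qed

lemma el_minus: "\<ominus>\<^bsub>A\<^esub> el c d = el (\<lambda>i. - c i) (\<lambda>e. - d e)"
  by (rule A.minus_equality) (simp_all add: el_add el_zero)

lemma ring_Br: "ring Br" unfolding Br_def
  by (rule ring_restrict[OF A.ring_axioms]) (auto simp: el_add el_mult el_one el_minus image_iff el_eq)

lemma ring_Kr: "ring Kr" unfolding Kr_def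
  by (rule ring_restrict[OF A.ring_axioms]) (auto simp: sc_def el_add el_mult el_one el_minus image_iff el_eq)

lemma Br_simps [simp]: "carrier Br = range (\<lambda>c. el c (\<lambda>_. 0))" by (simp add: Br_def)
lemma Kr_simps [simp]: "carrier Kr = range sc" by (simp add: Kr_def)

abbreviation arc_sum :: "('r, 'm) rmodule \<Rightarrow> ('a \<Rightarrow> 'm) \<Rightarrow> 'm" where
  "arc_sum M y \<equiv> \<Oplus>\<^bsub>M\<^esub>e\<in>arcs Q. y e \<triangleleft>\<^bsub>M\<^esub> ar e"

text \<open>Sums of ring elements are formed in the regular module, so that the homomorphism
  \<open>rhom_mult\<close> can carry them over to any module.\<close>

lemma finsum_el:
  "finite S \<Longrightarrow> (\<Oplus>\<^bsub>reg_module A\<^esub>s\<in>S. el (c s) (d s)) = el (\<lambda>i. \<Sum>s\<in>S. c s i) (\<lambda>e. \<Sum>s\<in>S. d s e)"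
proof (induction S rule: finite_induct)
  case empty
  interpret reg: right_module A "reg_module A" by (rule A.right_module_reg)
  show ?case by (simp add: el_zero)
next
  case (insert s S)
  interpret reg: right_module A "reg_module A" by (rule A.right_module_reg)
  show ?case using insert by (simp add: reg.M.finsum_insert el_add)
qed

lemma el_decomp_verts: "el c (\<lambda>_. 0) = (\<Oplus>\<^bsub>reg_module A\<^esub>i\<in>verts Q. sc (c i) \<otimes>\<^bsub>A\<^esub> ep i)"
  unfolding sc_def ep_def el_mult by (simp add: finsum_el el_eq if_distrib[of "times _"] cong: if_cong)

lemma el_decomp_arcs: "el (\<lambda>_. 0) d = (\<Oplus>\<^bsub>reg_module A\<^esub>e\<in>arcs Q. sc (d e) \<otimes>\<^bsub>A\<^esub> ar e)"
  unfolding sc_def ar_def el_mult by (simp add: finsum_el el_eq if_distrib[of "times _"] cong: if_cong)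

lemma ep_ep: "ep i \<otimes>\<^bsub>A\<^esub> ep j = (if i = j then ep i else \<zero>\<^bsub>A\<^esub>)"
  by (auto simp: ep_def el_mult el_eq el_zero)

lemma ep_ar: "e \<in> arcs Q \<Longrightarrow> ep i \<otimes>\<^bsub>A\<^esub> ar e = (if i = tail Q e then ar e else \<zero>\<^bsub>A\<^esub>)"
  by (auto simp: ep_def ar_def el_mult el_eq el_zero)

lemma ar_ep: "e \<in> arcs Q \<Longrightarrow> ar e \<otimes>\<^bsub>A\<^esub> ep i = (if i = head Q e then ar e else \<zero>\<^bsub>A\<^esub>)"
  by (auto simp: ep_def ar_def el_mult el_eq el_zero)

lemma ar_ar: "ar e \<otimes>\<^bsub>A\<^esub> ar \<beta> = \<zero>\<^bsub>A\<^esub>"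
  by (auto simp: ar_def el_mult el_eq el_zero)

lemma ar_el: "ar e \<otimes>\<^bsub>A\<^esub> el c d = sc (c (head Q e)) \<otimes>\<^bsub>A\<^esub> ar e"
  by (auto simp: ar_def sc_def el_mult el_eq)

lemma el_ar: "el c d \<otimes>\<^bsub>A\<^esub> ar e = sc (c (tail Q e)) \<otimes>\<^bsub>A\<^esub> ar e"
  by (auto simp: ar_def sc_def el_mult el_eq)

lemma ep_el: "ep i \<otimes>\<^bsub>A\<^esub> el c (\<lambda>_. 0) = sc (c i) \<otimes>\<^bsub>A\<^esub> ep i"
  by (auto simp: ep_def sc_def el_mult el_eq)

lemma sc_comm: "a \<in> carrier A \<Longrightarrow> sc k \<otimes>\<^bsub>A\<^esub> a = a \<otimes>\<^bsub>A\<^esub> sc k"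
  using el_surj[of a] by (auto simp: sc_def el_mult mult.commute)

lemma sc_sc: "sc k \<otimes>\<^bsub>A\<^esub> sc l = sc (k * l)" by (simp add: sc_def el_mult)
lemma sc_one: "sc 1 = \<one>\<^bsub>A\<^esub>" by (simp add: sc_def el_one)

lemma el_split: "el c d = el c (\<lambda>_. 0) \<oplus>\<^bsub>A\<^esub> el (\<lambda>_. 0) d" by (simp add: el_add)

end

section \<open>Vector space structure of modules over A\<close>

locale rsz_module = rsz_ring Q A el + right_module A M
  for Q :: "('v, 'a) pre_digraph" and A :: "('r, 'u) ring_scheme" and el :: "('v \<Rightarrow> 'k::field) \<Rightarrow> ('a \<Rightarrow> 'k) \<Rightarrow> 'r"
    and M :: "('r, 'm) rmodule"
begin

lemma ract_decomp_verts:
  assumes "x \<in> carrier M"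
  shows "x \<triangleleft>\<^bsub>M\<^esub> el c (\<lambda>_. 0) = (\<Oplus>\<^bsub>M\<^esub>i\<in>verts Q. (x \<triangleleft>\<^bsub>M\<^esub> sc (c i)) \<triangleleft>\<^bsub>M\<^esub> ep i)"
  unfolding el_decomp_verts
  by (subst rhom_finsum[OF A.right_module_reg right_module_axioms rhom_mult[OF assms]])
     (use assms in \<open>auto simp: ract_assoc\<close>)

lemma ract_decomp_arcs:
  assumes "x \<in> carrier M"
  shows "x \<triangleleft>\<^bsub>M\<^esub> el (\<lambda>_. 0) d = (\<Oplus>\<^bsub>M\<^esub>e\<in>arcs Q. (x \<triangleleft>\<^bsub>M\<^esub> sc (d e)) \<triangleleft>\<^bsub>M\<^esub> ar e)"
  unfolding el_decomp_arcs
  by (subst rhom_finsum[OF A.right_module_reg right_module_axioms rhom_mult[OF assms]])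
     (use assms in \<open>auto simp: ract_assoc\<close>)

lemma decomp_verts:
  assumes "x \<in> carrier M"
  shows "x = (\<Oplus>\<^bsub>M\<^esub>i\<in>verts Q. x \<triangleleft>\<^bsub>M\<^esub> ep i)"
  using ract_decomp_verts[OF assms, of "\<lambda>_. 1"] assms by (simp add: sc_one el_one[symmetric])

lemma right_module_Br: "right_module Br M"
  unfolding Br_def by (rule right_module_restrict[OF right_module_axioms ring_Br[unfolded Br_def]]) auto

lemma right_module_Kr: "right_module Kr M"
  unfolding Kr_def by (rule right_module_restrict[OF right_module_axioms ring_Kr[unfolded Kr_def]]) auto

lemma submod_Br: "submod A M U \<Longrightarrow> submod Br M U"
  by (auto simp: submod_def)

lemma submod_Kr: "submod A M U \<Longrightarrow> submod Kr M U"
  by (auto simp: submod_def)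

lemma retract_Kr:
  assumes "submod Kr M U"
  shows "\<exists>p \<in> rhom Kr M M. p ` carrier M \<subseteq> U \<and> (\<forall>u\<in>U. p u = u)"
proof -
  interpret K: right_module Kr M by (rule right_module_Kr)
  show ?thesis
  proof (rule K.retract_exists[OF _ _ assms])
    show "generates Kr M (carrier M)" using K.submodD(1) by (auto simp: generates_def)
    fix x s assume x: "x \<in> carrier M" and "s \<in> carrier Kr" and nz: "x \<triangleleft>\<^bsub>M\<^esub> s \<noteq> \<zero>\<^bsub>M\<^esub>"
    then obtain k where k: "s = sc k" by auto
    then have "k \<noteq> 0" using nz x by (auto simp: sc_def el_zero[symmetric] ract_zero_right)
    then have "(x \<triangleleft>\<^bsub>M\<^esub> s) \<triangleleft>\<^bsub>M\<^esub> sc (1 / k) = x" using x by (simp add: k ract_assoc[symmetric] sc_sc sc_one)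
    then show "\<exists>t\<in>carrier Kr. (x \<triangleleft>\<^bsub>M\<^esub> s) \<triangleleft>\<^bsub>M\<^esub> t = x" by auto
  qed
qed

text \<open>On an element of the form x \<open>ep i\<close>, the ring \<open>Br\<close> acts through
  the single scalar c i. Such elements therefore span zero or simple submodules over
  \<open>Br\<close>, and they generate M because the \<open>ep i\<close> sum to one.\<close>

lemma retract_Br:
  assumes "submod Br M U"
  shows "\<exists>p \<in> rhom Br M M. p ` carrier M \<subseteq> U \<and> (\<forall>u\<in>U. p u = u)"
proof -
  interpret B: right_module Br M by (rule right_module_Br)
  let ?D = "{x \<triangleleft>\<^bsub>M\<^esub> ep i | x i. x \<in> carrier M}"
  show ?thesis
  proof (rule B.retract_exists[OF _ _ assms])
    have "x \<in> N" if N: "submod Br M N" "?D \<subseteq> N" and x: "x \<in> carrier M" for x N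
    proof -
      have "(\<Oplus>\<^bsub>M\<^esub>i\<in>verts Q. x \<triangleleft>\<^bsub>M\<^esub> ep i) \<in> N"
        by (rule B.submod_finsum[OF N(1)]) (use N x in auto)
      then show ?thesis using decomp_verts[OF x] by simp
    qed
    then show "generates Br M ?D" using B.submodD(1) by (auto simp: generates_def)
    fix y s assume "y \<in> ?D" and "s \<in> carrier Br" and nz: "y \<triangleleft>\<^bsub>M\<^esub> s \<noteq> \<zero>\<^bsub>M\<^esub>"
    then obtain x i c where x: "x \<in> carrier M" "y = x \<triangleleft>\<^bsub>M\<^esub> ep i" "s = el c (\<lambda>_. 0)" by auto
    have *: "y \<triangleleft>\<^bsub>M\<^esub> el c' (\<lambda>_. 0) = x \<triangleleft>\<^bsub>M\<^esub> (sc (c' i) \<otimes>\<^bsub>A\<^esub> ep i)" for c'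
      using x by (simp add: ract_assoc[symmetric] ep_el)
    have "c i \<noteq> 0" using nz x(1,3) * by (auto simp: sc_def el_zero[symmetric] ract_zero_right)
    then have "(y \<triangleleft>\<^bsub>M\<^esub> s) \<triangleleft>\<^bsub>M\<^esub> el (\<lambda>_. 1 / c i) (\<lambda>_. 0) = y"
      unfolding x(2,3) using x(1)
      by (simp add: ract_assoc[symmetric] ep_el A.m_assoc sc_comm) (simp add: ep_def sc_def el_mult cong: if_cong)
    then show "\<exists>t\<in>carrier Br. (y \<triangleleft>\<^bsub>M\<^esub> s) \<triangleleft>\<^bsub>M\<^esub> t = y" by auto
  qed
qed

text \<open>A is spanned over \<open>Kr\<close> by the finitely many idempotents and arrows, so the
  translates of X by these span M. This identifies finite generation over A with finite
  dimension.\<close>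

lemma generates_Kr:
  assumes "generates A M X"
  shows "generates Kr M ((\<Union>i\<in>verts Q. (\<lambda>x. x \<triangleleft>\<^bsub>M\<^esub> ep i) ` X) \<union> (\<Union>e\<in>arcs Q. (\<lambda>x. x \<triangleleft>\<^bsub>M\<^esub> ar e) ` X))"
    (is "generates Kr M ?X")
proof -
  interpret K: right_module Kr M by (rule right_module_Kr)
  show ?thesis unfolding generates_def
  proof (intro conjI allI impI)
    show "?X \<subseteq> carrier M" using assms by (auto simp: generates_def)
    fix N assume "submod Kr M N \<and> ?X \<subseteq> N"
    then have N: "submod Kr M N" "?X \<subseteq> N" by auto
    note N' = K.submodD[OF N(1)]
    \<comment> \<open>This is the largest A-submodule inside N; it contains X and is therefore all
      of M.\<close>
    let ?N = "{x \<in> carrier M. \<forall>a\<in>carrier A. x \<triangleleft>\<^bsub>M\<^esub> a \<in> N}"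
    have "submod A M ?N"
      by (rule submodI) (use N' in \<open>auto simp: ract_zero_left ract_l_distr ract_assoc[symmetric]\<close>)
    moreover have "X \<subseteq> ?N"
    proof (intro subsetI CollectI conjI ballI)
      fix x assume x: "x \<in> X"
      then show xM: "x \<in> carrier M" using assms by (auto simp: generates_def)
      fix a assume "a \<in> carrier A"
      then obtain c d where a: "a = el c d" using el_surj by blast
      have 1: "x \<triangleleft>\<^bsub>M\<^esub> ep i \<in> N" if "i \<in> verts Q" for i using N(2) x that by blast
      have 2: "x \<triangleleft>\<^bsub>M\<^esub> ar e \<in> N" if "e \<in> arcs Q" for e using N(2) x that by blast
      have sw: "(x \<triangleleft>\<^bsub>M\<^esub> sc k) \<triangleleft>\<^bsub>M\<^esub> a = (x \<triangleleft>\<^bsub>M\<^esub> a) \<triangleleft>\<^bsub>M\<^esub> sc k" if "a \<in> carrier A" for k a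
        using xM that by (simp add: ract_assoc[symmetric] sc_comm)
      have "x \<triangleleft>\<^bsub>M\<^esub> el c (\<lambda>_. 0) \<in> N"
        unfolding ract_decomp_verts[OF xM] by (rule K.submod_finsum[OF N(1)]) (auto simp: sw intro!: N'(7) 1)
      moreover have "x \<triangleleft>\<^bsub>M\<^esub> el (\<lambda>_. 0) d \<in> N"
        unfolding ract_decomp_arcs[OF xM] by (rule K.submod_finsum[OF N(1)]) (auto simp: sw intro!: N'(7) 2)
      ultimately show "x \<triangleleft>\<^bsub>M\<^esub> a \<in> N"
        unfolding a el_split[of c d] using N'(4) xM by (simp add: ract_r_distr)
    qed
    ultimately have "?N = carrier M" using assms unfolding generates_def by blast
    then have "carrier M \<subseteq> N" using ract_one A.one_closed by (metis (no_types, lifting) mem_Collect_eq subsetI)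
    then show "N = carrier M" using N'(1) by blast
  qed
qed

lemma fin_gen_Kr_iff: "fin_gen Kr M \<longleftrightarrow> fin_gen A M"
proof
  assume "fin_gen Kr M"
  then obtain X where X: "finite X" "generates Kr M X" unfolding fin_gen_iff by blast
  have "generates A M X" unfolding generates_def
  proof (intro conjI allI impI)
    show "X \<subseteq> carrier M" using X(2) by (simp add: generates_def)
    fix N assume "submod A M N \<and> X \<subseteq> N"
    then show "N = carrier M" using X(2) submod_Kr[of N] by (simp add: generates_def)
  qed
  then show "fin_gen A M" using X(1) unfolding fin_gen_iff by blast
next
  interpret K: right_module Kr M by (rule right_module_Kr)
  assume "fin_gen A M"
  then obtain X where X: "finite X" "generates A M X" unfolding fin_gen_iff by blast
  let ?X = "(\<Union>i\<in>verts Q. (\<lambda>x. x \<triangleleft>\<^bsub>M\<^esub> ep i) ` X) \<union> (\<Union>e\<in>arcs Q. (\<lambda>x. x \<triangleleft>\<^bsub>M\<^esub> ar e) ` X)"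
  have "generates Kr M ?X" by (rule generates_Kr[OF X(2)])
  moreover have "finite ?X" using X(1) by auto
  ultimately show "fin_gen Kr M" unfolding fin_gen_iff by blast
qed

text \<open>This is the noetherian property, obtained by dimension: U is the image of M under a
  \<open>Kr\<close>-linear retraction, hence finite-dimensional.\<close>

lemma fin_gen_submod:
  assumes "fin_gen A M" "submod A M U"
  shows "fin_gen A (M\<lparr>carrier := U\<rparr>)"
proof -
  interpret K: right_module Kr M by (rule right_module_Kr)
  interpret U: rsz_module Q A el "M\<lparr>carrier := U\<rparr>"
    by (intro rsz_module.intro rsz_ring_axioms right_module_submod assms(2))
  obtain p where p: "p \<in> rhom Kr M M" "p ` carrier M \<subseteq> U" "\<And>u. u \<in> U \<Longrightarrow> p u = u"
    using retract_Kr[OF submod_Kr[OF assms(2)]] by blast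
  have "p ` carrier M = U" using p(2,3) submodD(1)[OF assms(2)] by force
  then have "fin_gen Kr (M\<lparr>carrier := U\<rparr>)"
    using fin_gen_image[OF right_module_Kr U.right_module_Kr rhom_restrict_codomain[OF p(1,2)]]
      fin_gen_Kr_iff assms(1) by simp
  then show ?thesis using U.fin_gen_Kr_iff by simp
qed

end

section \<open>Radical, support and relations along arrows\<close>

context rsz_ring
begin

text \<open>This is MJ. One coefficient for each arrow is enough, because the action of an arrow is
  additive and absorbs sums.\<close>

definition rad :: "('r, 'm) rmodule \<Rightarrow> 'm set" where
  "rad M = {arc_sum M y | y. y \<in> arcs Q \<rightarrow> carrier M}"

text \<open>The condition MJ = 0 makes M a module over the product of fields A/J. In this form no
  decomposition into simple modules has to be chosen.\<close>

definition semisimple :: "('r, 'm) rmodule \<Rightarrow> bool" where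
  "semisimple M \<longleftrightarrow> (\<forall>x\<in>carrier M. \<forall>e\<in>arcs Q. x \<triangleleft>\<^bsub>M\<^esub> ar e = \<zero>\<^bsub>M\<^esub>)"

definition support :: "('r, 'm) rmodule \<Rightarrow> 'v set" where
  "support M = {i \<in> verts Q. \<exists>x\<in>carrier M. x \<triangleleft>\<^bsub>M\<^esub> ep i \<noteq> \<zero>\<^bsub>M\<^esub>}"

text \<open>For finitely generated \<open>M\<close> this says that \<open>S\<^sub>j\<close> is a summand of \<open>\<Omega>M\<close>: the family \<open>y\<close> represents an
  element of the kernel of a minimal projective cover. In this form the condition can be lifted along
  projective resolutions that are not minimal.\<close>

definition syz_top :: "('r, 'm) rmodule \<Rightarrow> 'v \<Rightarrow> bool" where
  "syz_top M j \<longleftrightarrow> (\<exists>y \<in> arcs Q \<rightarrow> carrier M. (\<forall>e\<in>arcs Q. y e \<triangleleft>\<^bsub>M\<^esub> ep (tail Q e) = y e) \<and>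
     (\<forall>e\<in>arcs Q. head Q e \<noteq> j \<longrightarrow> y e = \<zero>\<^bsub>M\<^esub>) \<and> arc_sum M y = \<zero>\<^bsub>M\<^esub> \<and>
     (\<exists>e\<in>arcs Q. y e \<notin> rad M))"

text \<open>The line through x is a copy of the simple module at j. It splits off because x stays
  nonzero in the semisimple quotient M/MJ, where the line has a complement whose preimage is a
  complement in M.\<close>

definition simple_summand :: "('r, 'm) rmodule \<Rightarrow> 'v \<Rightarrow> bool" where
  "simple_summand M j \<longleftrightarrow> (\<exists>x\<in>carrier M. x \<triangleleft>\<^bsub>M\<^esub> ep j = x \<and> (\<forall>e\<in>arcs Q. x \<triangleleft>\<^bsub>M\<^esub> ar e = \<zero>\<^bsub>M\<^esub>) \<and> x \<notin> rad M)"

end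

lemma (in rsz_ring) rsz_moduleI: "right_module A M \<Longrightarrow> rsz_module Q A el M"
  by (intro rsz_module.intro rsz_ring_axioms)

context rsz_module
begin

lemma submod_rad: "submod A M (rad M)"
proof (rule submodI)
  show "rad M \<subseteq> carrier M" by (auto simp: rad_def intro!: M.finsum_closed)
  show "\<zero>\<^bsub>M\<^esub> \<in> rad M" unfolding rad_def
    by (intro CollectI exI[of _ "\<lambda>_. \<zero>\<^bsub>M\<^esub>"]) (simp add: ract_zero_left)
next
  fix v w assume "v \<in> rad M" "w \<in> rad M"
  then obtain y z where y: "y \<in> arcs Q \<rightarrow> carrier M" "v = arc_sum M y"
    and z: "z \<in> arcs Q \<rightarrow> carrier M" "w = arc_sum M z" unfolding rad_def by blast
  have "v \<oplus>\<^bsub>M\<^esub> w = (\<Oplus>\<^bsub>M\<^esub>e\<in>arcs Q. (y e \<triangleleft>\<^bsub>M\<^esub> ar e) \<oplus>\<^bsub>M\<^esub> (z e \<triangleleft>\<^bsub>M\<^esub> ar e))"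
    unfolding y z using y z by (intro M.finsum_addf[symmetric]) auto
  also have "\<dots> = (\<Oplus>\<^bsub>M\<^esub>e\<in>arcs Q. (y e \<oplus>\<^bsub>M\<^esub> z e) \<triangleleft>\<^bsub>M\<^esub> ar e)"
    using y z by (intro M.finsum_cong') (auto simp: ract_l_distr Pi_iff)
  finally show "v \<oplus>\<^bsub>M\<^esub> w \<in> rad M" unfolding rad_def
    using y z by (intro CollectI exI[of _ "\<lambda>e. y e \<oplus>\<^bsub>M\<^esub> z e"]) auto
next
  fix v a assume "v \<in> rad M" and "a \<in> carrier A"
  then obtain y c d where y: "y \<in> arcs Q \<rightarrow> carrier M" "v = arc_sum M y"
    and a: "a = el c d" using el_surj unfolding rad_def by blast
  have "v \<triangleleft>\<^bsub>M\<^esub> a = (\<Oplus>\<^bsub>M\<^esub>e\<in>arcs Q. (y e \<triangleleft>\<^bsub>M\<^esub> ar e) \<triangleleft>\<^bsub>M\<^esub> a)"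
    unfolding y(2) by (rule finsum_ract) (use y a in auto)
  also have "\<dots> = (\<Oplus>\<^bsub>M\<^esub>e\<in>arcs Q. (y e \<triangleleft>\<^bsub>M\<^esub> sc (c (head Q e))) \<triangleleft>\<^bsub>M\<^esub> ar e)"
    unfolding a using y by (intro M.finsum_cong') (auto simp: ract_assoc[symmetric] ar_el Pi_iff)
  finally show "v \<triangleleft>\<^bsub>M\<^esub> a \<in> rad M" unfolding rad_def
    using y by (intro CollectI exI[of _ "\<lambda>e. y e \<triangleleft>\<^bsub>M\<^esub> sc (c (head Q e))"]) auto
qed

lemma el_in_rad: "x \<in> carrier M \<Longrightarrow> x \<triangleleft>\<^bsub>M\<^esub> el (\<lambda>_. 0) d \<in> rad M"
  unfolding rad_def ract_decomp_arcs by (intro CollectI exI[of _ "\<lambda>e. x \<triangleleft>\<^bsub>M\<^esub> sc (d e)"]) auto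

lemma ar_in_rad: "x \<in> carrier M \<Longrightarrow> x \<triangleleft>\<^bsub>M\<^esub> ar e \<in> rad M"
  unfolding ar_def by (rule el_in_rad)

lemma rad_least:
  assumes "submod A M L" "\<And>x e. x \<in> carrier M \<Longrightarrow> e \<in> arcs Q \<Longrightarrow> x \<triangleleft>\<^bsub>M\<^esub> ar e \<in> L"
  shows "rad M \<subseteq> L"
  unfolding rad_def by (auto intro!: submod_finsum[OF assms(1)] assms(2))

lemma rad_ar: "x \<in> rad M \<Longrightarrow> x \<triangleleft>\<^bsub>M\<^esub> ar \<beta> = \<zero>\<^bsub>M\<^esub>"
proof -
  assume "x \<in> rad M"
  then obtain y where y: "y \<in> arcs Q \<rightarrow> carrier M" "x = arc_sum M y" unfolding rad_def by blast
  have "x \<triangleleft>\<^bsub>M\<^esub> ar \<beta> = (\<Oplus>\<^bsub>M\<^esub>e\<in>arcs Q. (y e \<triangleleft>\<^bsub>M\<^esub> ar e) \<triangleleft>\<^bsub>M\<^esub> ar \<beta>)"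
    unfolding y(2) by (rule finsum_ract) (use y in auto)
  also have "\<dots> = (\<Oplus>\<^bsub>M\<^esub>e\<in>arcs Q. \<zero>\<^bsub>M\<^esub>)"
    using y by (intro M.finsum_cong') (auto simp: ract_assoc[symmetric] ar_ar ract_zero_right Pi_iff)
  finally show ?thesis by simp
qed

lemma semisimple_rad: "semisimple M \<Longrightarrow> rad M = {\<zero>\<^bsub>M\<^esub>}"
  using rad_least[OF submod_zero] submodD(2)[OF submod_rad] by (auto simp: semisimple_def)

text \<open>Multiplying by \<open>ep j\<close> on the right kills the arrows whose head is not j. On
  the left, \<open>ep (tail Q e)\<close> can be inserted before each arrow without changing its
  contribution.\<close>

lemma rad_homogeneous:
  assumes "x \<in> rad M" "x \<triangleleft>\<^bsub>M\<^esub> ep j = x"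
  shows "\<exists>y \<in> arcs Q \<rightarrow> carrier M. x = arc_sum M y \<and>
    (\<forall>e\<in>arcs Q. y e \<triangleleft>\<^bsub>M\<^esub> ep (tail Q e) = y e \<and> (head Q e \<noteq> j \<longrightarrow> y e = \<zero>\<^bsub>M\<^esub>))"
proof -
  obtain y where y: "y \<in> arcs Q \<rightarrow> carrier M" "x = arc_sum M y"
    using assms(1) unfolding rad_def by blast
  define z where "z = (\<lambda>e. if head Q e = j then y e \<triangleleft>\<^bsub>M\<^esub> ep (tail Q e) else \<zero>\<^bsub>M\<^esub>)"
  have "x = (\<Oplus>\<^bsub>M\<^esub>e\<in>arcs Q. (y e \<triangleleft>\<^bsub>M\<^esub> ar e) \<triangleleft>\<^bsub>M\<^esub> ep j)"
  proof -
    have "(\<lambda>e. y e \<triangleleft>\<^bsub>M\<^esub> ar e) \<in> arcs Q \<rightarrow> carrier M" using y(1) by auto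
    from finsum_ract[OF this basis_closed(1)[of j]] show ?thesis using y(2) assms(2) by metis
  qed
  also have "\<dots> = arc_sum M z"
    using y by (intro M.finsum_cong')
      (auto simp: z_def ract_assoc[symmetric] ep_ar ar_ep ract_zero_right ract_zero_left Pi_iff)
  finally show ?thesis
    by (intro bexI[of _ z] conjI) (use y(1) in \<open>auto simp: z_def ract_assoc[symmetric] ep_ep ract_zero_left Pi_iff\<close>)
qed

lemma support_empty: "support M = {} \<Longrightarrow> carrier M = {\<zero>\<^bsub>M\<^esub>}"
proof -
  assume s: "support M = {}"
  have "x = \<zero>\<^bsub>M\<^esub>" if "x \<in> carrier M" for x
  proof -
    have "x = (\<Oplus>\<^bsub>M\<^esub>i\<in>verts Q. x \<triangleleft>\<^bsub>M\<^esub> ep i)" by (rule decomp_verts[OF that])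
    also have "\<dots> = (\<Oplus>\<^bsub>M\<^esub>i\<in>verts Q. \<zero>\<^bsub>M\<^esub>)" using s that by (intro M.finsum_cong') (auto simp: support_def)
    finally show ?thesis by simp
  qed
  then show ?thesis by auto
qed

text \<open>The relation has a single term, x times the arrow e, which is zero because x is killed
  by all arrows. It is not trivial because x lies outside the radical.\<close>

lemma simple_summand_syz_top:
  assumes "simple_summand M (tail Q e)" "e \<in> arcs Q"
  shows "syz_top M (head Q e)"
proof -
  obtain x where x: "x \<in> carrier M" "x \<triangleleft>\<^bsub>M\<^esub> ep (tail Q e) = x" "\<forall>e\<in>arcs Q. x \<triangleleft>\<^bsub>M\<^esub> ar e = \<zero>\<^bsub>M\<^esub>" "x \<notin> rad M"
    using assms(1) unfolding simple_summand_def by blast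
  let ?y = "\<lambda>\<beta>. if \<beta> = e then x else \<zero>\<^bsub>M\<^esub>"
  have "(\<Oplus>\<^bsub>M\<^esub>\<beta>\<in>arcs Q. ?y \<beta> \<triangleleft>\<^bsub>M\<^esub> ar \<beta>) = (\<Oplus>\<^bsub>M\<^esub>\<beta>\<in>arcs Q. \<zero>\<^bsub>M\<^esub>)"
    using x by (intro M.finsum_cong') (auto simp: ract_zero_left)
  then have "(\<Oplus>\<^bsub>M\<^esub>\<beta>\<in>arcs Q. ?y \<beta> \<triangleleft>\<^bsub>M\<^esub> ar \<beta>) = \<zero>\<^bsub>M\<^esub>" by simp
  then show ?thesis unfolding syz_top_def using x assms(2)
    by (intro bexI[of _ ?y] conjI bexI[of _ e]) (auto simp: ract_zero_left)
qed

lemma syz_top_tail: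
  assumes "syz_top M j"
  shows "\<exists>e\<in>arcs Q. head Q e = j \<and> tail Q e \<in> support M"
proof -
  obtain y e where y: "y \<in> arcs Q \<rightarrow> carrier M" "\<forall>e\<in>arcs Q. y e \<triangleleft>\<^bsub>M\<^esub> ep (tail Q e) = y e"
     "\<forall>e\<in>arcs Q. head Q e \<noteq> j \<longrightarrow> y e = \<zero>\<^bsub>M\<^esub>" "e \<in> arcs Q" "y e \<notin> rad M"
    using assms unfolding syz_top_def by blast
  then have "y e \<noteq> \<zero>\<^bsub>M\<^esub>" using submodD(2)[OF submod_rad] by metis
  moreover have ya: "y e \<in> carrier M" "y e \<triangleleft>\<^bsub>M\<^esub> ep (tail Q e) = y e" using y by (auto simp: Pi_iff)
  ultimately have "y e \<triangleleft>\<^bsub>M\<^esub> ep (tail Q e) \<noteq> \<zero>\<^bsub>M\<^esub>" "head Q e = j" using y by auto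
  then have "head Q e = j" "tail Q e \<in> support M" using y(4) ya(1) by (auto simp: support_def)
  with y(4) show ?thesis by blast
qed

lemma semisimple_simple_summand:
  assumes "semisimple M" "i \<in> support M"
  shows "simple_summand M i"
proof -
  obtain x where "x \<in> carrier M" "x \<triangleleft>\<^bsub>M\<^esub> ep i \<noteq> \<zero>\<^bsub>M\<^esub>" using assms(2) by (auto simp: support_def)
  then show ?thesis unfolding simple_summand_def using assms(1)
    by (intro bexI[of _ "x \<triangleleft>\<^bsub>M\<^esub> ep i"])
       (auto simp: semisimple_def semisimple_rad ract_assoc[symmetric] ep_ep)
qed

text \<open>Modulo MJ the image of K would have a complement, which superfluity forces to be
  everything. Concretely, take a \<open>Br\<close>-complement C of K + MJ. Then C + MJ is stable
  under A and its sum with K is M, so it equals M. Writing k = c + r with c in C and r in MJ, the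
  element c lies in both K + MJ and C, hence vanishes.\<close>

lemma superfluous_rad:
  assumes "superfluous A M K"
  shows "K \<subseteq> rad M"
proof
  interpret B: right_module Br M by (rule right_module_Br)
  have K: "submod A M K" and sup: "\<And>L. submod A M L \<Longrightarrow> K <+>\<^bsub>M\<^esub> L = carrier M \<Longrightarrow> L = carrier M"
    using assms unfolding superfluous_def by auto
  let ?U = "K <+>\<^bsub>M\<^esub> rad M"
  note R' = submodD[OF submod_rad] and K' = submodD[OF K]
  have U: "submod A M ?U" by (rule submod_set_add[OF K submod_rad])
  note U' = submodD[OF U]
  obtain p where p: "p \<in> rhom Br M M" "p ` carrier M \<subseteq> ?U" "\<And>u. u \<in> ?U \<Longrightarrow> p u = u"
    using retract_Br[OF submod_Br[OF U]] by blast
  note p' = rhomD[OF p(1)]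
  \<comment> \<open>The kernel of the retraction is the \<open>Br\<close>-complement; it need not be
    stable under the arrows.\<close>
  let ?C = "{x \<in> carrier M. p x \<in> {\<zero>\<^bsub>M\<^esub>}}"
  have C: "submod Br M ?C" by (rule submod_vimage[OF B.right_module_axioms B.right_module_axioms p(1) B.submod_zero])
  note C' = B.submodD[OF C]
  let ?L = "?C <+>\<^bsub>M\<^esub> rad M"
  have CR: "submod Br M ?L" by (rule B.submod_set_add[OF C submod_Br[OF submod_rad]])
  note CR' = B.submodD[OF CR]
  \<comment> \<open>Adding MJ restores stability: idempotents preserve the sum, and arrows send
    everything into MJ.\<close>
  have L: "submod A M ?L"
  proof (rule submodI)
    fix x a assume xL: "x \<in> ?L" and a: "a \<in> carrier A"
    obtain c d where cd: "a = el c d" using el_surj[OF a] by blast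
    have "x \<triangleleft>\<^bsub>M\<^esub> el c (\<lambda>_. 0) \<in> ?L" by (rule CR'(7)[OF xL]) auto
    moreover have "x \<triangleleft>\<^bsub>M\<^esub> el (\<lambda>_. 0) d \<in> ?L"
      using el_in_rad[OF CR'(3)[OF xL]] B.set_add_upper(2)[OF C submod_Br[OF submod_rad]] by blast
    ultimately show "x \<triangleleft>\<^bsub>M\<^esub> a \<in> ?L" unfolding cd el_split[of c d]
      using CR'(3,4) xL by (simp add: ract_r_distr)
  qed (use CR' in auto)
  have "K <+>\<^bsub>M\<^esub> ?L = carrier M"
  proof (intro equalityI subsetI)
    fix x assume "x \<in> K <+>\<^bsub>M\<^esub> ?L"
    then show "x \<in> carrier M" using K'(3) CR'(3) by (auto simp: mem_set_add[of _ K])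
  next
    fix x assume x: "x \<in> carrier M"
    obtain k r where kr: "k \<in> K" "r \<in> rad M" "p x = k \<oplus>\<^bsub>M\<^esub> r"
      using p(2) x mem_set_add[of "p x" K "rad M"] by blast
    have M: "k \<in> carrier M" "r \<in> carrier M" "p x \<in> carrier M" using kr K'(3) R'(3) p'(1)[OF x] by auto
    have pp: "p (p x) = p x" using p(2,3) x by blast
    have "p (x \<ominus>\<^bsub>M\<^esub> p x) = p x \<ominus>\<^bsub>M\<^esub> p (p x)"
      using x M(3) rhom_minus[OF B.right_module_axioms B.right_module_axioms p(1) M(3)]
      by (simp add: M.minus_eq p'(2))
    then have "x \<ominus>\<^bsub>M\<^esub> p x \<in> ?C" using x M(3) pp by (simp add: minus_eq_zero_iff)
    then have "(x \<ominus>\<^bsub>M\<^esub> p x) \<oplus>\<^bsub>M\<^esub> r \<in> ?L" using kr(2) unfolding mem_set_add by blast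
    moreover have "x = k \<oplus>\<^bsub>M\<^esub> ((x \<ominus>\<^bsub>M\<^esub> p x) \<oplus>\<^bsub>M\<^esub> r)"
    proof -
      have "k \<oplus>\<^bsub>M\<^esub> ((x \<ominus>\<^bsub>M\<^esub> p x) \<oplus>\<^bsub>M\<^esub> r) = (k \<oplus>\<^bsub>M\<^esub> r) \<oplus>\<^bsub>M\<^esub> (x \<ominus>\<^bsub>M\<^esub> p x)"
        using x M by (simp add: M.a_ac)
      also have "\<dots> = x" using x M unfolding kr(3)[symmetric] by (simp add: M.minus_eq M.a_lcomm M.r_neg)
      finally show ?thesis by simp
    qed
    ultimately show "x \<in> K <+>\<^bsub>M\<^esub> ?L" using kr(1) unfolding mem_set_add[of _ K] by blast
  qed
  then have LM: "?L = carrier M" by (rule sup[OF L])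
  fix k assume k: "k \<in> K"
  then have "k \<in> ?L" using LM K'(3) by blast
  then obtain c r where cr: "c \<in> carrier M" "p c = \<zero>\<^bsub>M\<^esub>" "r \<in> rad M" "k = c \<oplus>\<^bsub>M\<^esub> r"
    by (auto simp: mem_set_add)
  have M: "k \<in> carrier M" "r \<in> carrier M" using k K'(3) cr R'(3) by auto
  have "c = k \<ominus>\<^bsub>M\<^esub> r" using cr M by (simp add: M.minus_eq M.a_assoc M.r_neg)
  moreover have "k \<ominus>\<^bsub>M\<^esub> r \<in> ?U"
    using set_add_upper[OF K submod_rad] k cr(3) by (intro U'(6)) auto
  ultimately have "p c = c" using p(3) by blast
  then have "c = \<zero>\<^bsub>M\<^esub>" using cr(2) by simp
  then have "k = r" using cr(4) M(2) M.l_zero by blast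
  then show "k \<in> rad M" using cr(3) by simp
qed

end

section \<open>Syzygies in terms of elements\<close>

context rsz_ring
begin

lemma rad_hom:
  assumes "right_module A M" "right_module A N" "h \<in> rhom A M N" "x \<in> rad M"
  shows "h x \<in> rad N"
proof -
  interpret M: rsz_module Q A el M by (rule rsz_moduleI[OF assms(1)])
  interpret N: rsz_module Q A el N by (rule rsz_moduleI[OF assms(2)])
  have "rad M \<subseteq> {x \<in> carrier M. h x \<in> rad N}"
    by (rule M.rad_least[OF submod_vimage[OF assms(1-3) N.submod_rad]])
       (use rhomD[OF assms(3)] N.ar_in_rad in auto)
  then show ?thesis using assms(4) by blast
qed

lemma rad_surj:
  assumes "right_module A M" "right_module A N" "h \<in> rhom A M N" "h ` carrier M = carrier N"
  shows "rad N = h ` rad M"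
proof -
  interpret M: rsz_module Q A el M by (rule rsz_moduleI[OF assms(1)])
  interpret N: rsz_module Q A el N by (rule rsz_moduleI[OF assms(2)])
  have "rad N \<subseteq> h ` rad M"
  proof (rule N.rad_least[OF submod_image[OF assms(1-3) M.submod_rad]])
    fix x e assume "x \<in> carrier N" "e \<in> arcs Q"
    then obtain y where "y \<in> carrier M" "x = h y" using assms(4) by auto
    then show "x \<triangleleft>\<^bsub>N\<^esub> ar e \<in> h ` rad M"
      using M.ar_in_rad[of y e] rhomD(3)[OF assms(3), of y "ar e"] by (metis basis_closed(2) imageI)
  qed
  then show ?thesis using rad_hom[OF assms(1-3)] by auto
qed

lemma is_syzygyE:
  assumes "is_syzygy A M N"
  obtains P f g where "projective A P" "right_module A P" "right_module A N" "f \<in> rhom A N P" "g \<in> rhom A P M" "inj_on f (carrier N)"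
    "f ` carrier N = a_kernel P M g" "g ` carrier P = carrier M" "f ` carrier N \<subseteq> rad P"
proof -
  obtain P f g where *: "projective A P" "short_exact A N f P g M" "superfluous A P (f ` carrier N)" "N \<in> fgmod A"
    using assms unfolding is_syzygy_def by blast
  then have P: "right_module A P" and N: "right_module A N" by (auto simp: projective_def fgmod_def)
  interpret P: rsz_module Q A el P by (rule rsz_moduleI[OF P])
  show ?thesis by (rule that[OF *(1) P N]) (use * P.superfluous_rad in \<open>auto simp: short_exact_def\<close>)
qed

text \<open>The syzygy embeds into the radical of P, on which all arrows act by zero since J^2 =
  0.\<close>

lemma semisimple_syzygy:
  assumes "is_syzygy A M N"
  shows "semisimple N"
  using assms
proof (rule is_syzygyE)
  fix P f g
  assume P: "right_module A P" and N: "right_module A N" and f: "f \<in> rhom A N P" "inj_on f (carrier N)" "f ` carrier N \<subseteq> rad P"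
  interpret P: rsz_module Q A el P by (rule rsz_moduleI[OF P])
  interpret N: right_module A N by (rule N)
  have "x \<triangleleft>\<^bsub>N\<^esub> ar e = \<zero>\<^bsub>N\<^esub>" if "x \<in> carrier N" for x e
  proof -
    have "f (x \<triangleleft>\<^bsub>N\<^esub> ar e) = f \<zero>\<^bsub>N\<^esub>"
      using that f(3) rhomD(3)[OF f(1) that basis_closed(2)] P.rad_ar rhom_zero[OF N P f(1)] by (metis imageI subsetD)
    then show ?thesis using f(2) that by (simp add: inj_on_eq_iff)
  qed
  then show ?thesis by (simp add: semisimple_def)
qed

text \<open>A nonzero kernel element w at j lies in PJ, so it is a sum of homogeneous coefficients
  times arrows ending in j. Applying g to the coefficients gives a relation in M. Were it trivial,
  all coefficients in P would lie in PJ, and w would be zero.\<close>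

lemma support_syzygy:
  assumes "is_syzygy A M N" "right_module A M" "j \<in> support N"
  shows "syz_top M j"
  using assms(1)
proof (rule is_syzygyE)
  fix P f g
  assume P: "right_module A P" and N: "right_module A N" and f: "f \<in> rhom A N P" "inj_on f (carrier N)" "f ` carrier N \<subseteq> rad P"
    and g: "g \<in> rhom A P M" "g ` carrier P = carrier M" and ex: "f ` carrier N = a_kernel P M g"
  interpret P: rsz_module Q A el P by (rule rsz_moduleI[OF P])
  interpret N: right_module A N by (rule N)
  interpret M: rsz_module Q A el M by (rule rsz_moduleI[OF assms(2)])
  note g' = rhomD[OF g(1)]
  obtain x where x: "x \<in> carrier N" "x \<triangleleft>\<^bsub>N\<^esub> ep j \<noteq> \<zero>\<^bsub>N\<^esub>" using assms(3) by (auto simp: support_def)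
  define w where "w = f (x \<triangleleft>\<^bsub>N\<^esub> ep j)"
  have xj: "x \<triangleleft>\<^bsub>N\<^esub> ep j \<in> carrier N" using x by simp
  have w: "w \<in> rad P" "g w = \<zero>\<^bsub>M\<^esub>" using f(3) ex xj unfolding w_def a_kernel_def' by blast+
  have wj: "w \<triangleleft>\<^bsub>P\<^esub> ep j = w" unfolding w_def
    using rhomD(3)[OF f(1) xj basis_closed(1)[of j]] x(1) by (simp add: N.ract_assoc[symmetric] ep_ep)
  obtain y where y: "y \<in> arcs Q \<rightarrow> carrier P" "w = arc_sum P y"
    "\<And>e. e \<in> arcs Q \<Longrightarrow> y e \<triangleleft>\<^bsub>P\<^esub> ep (tail Q e) = y e" "\<And>e. e \<in> arcs Q \<Longrightarrow> head Q e \<noteq> j \<Longrightarrow> y e = \<zero>\<^bsub>P\<^esub>"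
    using P.rad_homogeneous[OF w(1) wj] by blast
  have w0: "w \<noteq> \<zero>\<^bsub>P\<^esub>" unfolding w_def
    using x(2) xj f(2) rhom_zero[OF N P f(1)] by (metis N.M.zero_closed inj_on_eq_iff)
  have "\<exists>e\<in>arcs Q. g (y e) \<notin> rad M"
  proof (rule ccontr)
    assume n: "\<not> ?thesis"
    \<comment> \<open>MJ is the image of PJ, so y e differs from an element of PJ by a kernel
      element, and the kernel is itself contained in PJ.\<close>
    have yr: "y e \<in> rad P" if e: "e \<in> arcs Q" for e
    proof -
      have yP: "y e \<in> carrier P" using y(1) e by auto
      obtain r where r: "r \<in> rad P" "g (y e) = g r"
        using n e rad_surj[OF P assms(2) g] by blast
      have rP: "r \<in> carrier P" using r(1) P.submodD(3)[OF P.submod_rad] by simp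
      have "g (y e \<ominus>\<^bsub>P\<^esub> r) = g (y e) \<ominus>\<^bsub>M\<^esub> g r"
        using yP rP rhom_minus[OF P assms(2) g(1) rP] by (simp add: P.M.minus_eq M.M.minus_eq g'(2))
      then have "g (y e \<ominus>\<^bsub>P\<^esub> r) = \<zero>\<^bsub>M\<^esub>" using r(2) g'(1)[OF rP] by (simp add: M.minus_eq_zero_iff)
      then have "y e \<ominus>\<^bsub>P\<^esub> r \<in> rad P" using yP rP ex f(3) unfolding a_kernel_def' by auto
      moreover have "y e = (y e \<ominus>\<^bsub>P\<^esub> r) \<oplus>\<^bsub>P\<^esub> r" using yP rP by (simp add: P.M.minus_eq P.M.a_assoc P.M.l_neg)
      ultimately show ?thesis using P.submodD(4)[OF P.submod_rad] r(1) by metis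
    qed
    have "w = (\<Oplus>\<^bsub>P\<^esub>e\<in>arcs Q. \<zero>\<^bsub>P\<^esub>)" unfolding y(2)
      by (intro P.M.finsum_cong') (auto simp: P.rad_ar[OF yr])
    then show False using w0 by simp
  qed
  moreover have "(\<Oplus>\<^bsub>M\<^esub>e\<in>arcs Q. g (y e) \<triangleleft>\<^bsub>M\<^esub> ar e) = \<zero>\<^bsub>M\<^esub>"
  proof -
    have "g w = (\<Oplus>\<^bsub>M\<^esub>e\<in>arcs Q. g (y e \<triangleleft>\<^bsub>P\<^esub> ar e))"
      unfolding y(2) by (rule rhom_finsum[OF P assms(2) g(1)]) (use y(1) in auto)
    also have "\<dots> = (\<Oplus>\<^bsub>M\<^esub>e\<in>arcs Q. g (y e) \<triangleleft>\<^bsub>M\<^esub> ar e)"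
      using y(1) g' by (intro M.M.finsum_cong') (auto simp: Pi_iff)
    finally show ?thesis using w(2) by simp
  qed
  moreover have "g (y e) \<triangleleft>\<^bsub>M\<^esub> ep (tail Q e) = g (y e)" if "e \<in> arcs Q" for e
    using y(3)[OF that] g'(3)[of "y e" "ep (tail Q e)"] y(1) that by (auto simp: Pi_iff)
  moreover have "g (y e) = \<zero>\<^bsub>M\<^esub>" if "e \<in> arcs Q" "head Q e \<noteq> j" for e
    using y(4)[OF that] rhom_zero[OF P assms(2) g(1)] by simp
  ultimately show ?thesis unfolding syz_top_def
    using y(1) g'(1) by (intro bexI[of _ "\<lambda>e. g (y e)"]) (auto simp: Pi_iff)
qed

end

section \<open>Projective covers\<close>

lemma projective_lift:
  assumes "projective R P" "M \<in> fgmod R" "N \<in> fgmod R" "g \<in> rhom R M N" "f \<in> rhom R P N"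
    "g ` carrier M = carrier N"
  shows "\<exists>h \<in> rhom R P M. \<forall>x\<in>carrier P. g (h x) = f x"
proof -
  note all = assms(1)[unfolded projective_def, THEN conjunct2, THEN bspec, OF assms(2), THEN bspec, OF assms(3)]
  show ?thesis by (rule all[THEN bspec, OF assms(4), THEN bspec, OF assms(5), THEN mp, OF assms(6)])
qed

text \<open>This is Nakayama's lemma, which is elementary when J^2 = 0. From M = K + L and KJ = 0,
  every product with an arrow already comes from L; thus L contains MJ, hence K, and is
  everything.\<close>

lemma (in rsz_module) rad_superfluous:
  assumes "submod A M K" "K \<subseteq> rad M"
  shows "superfluous A M K"
  unfolding superfluous_def
proof (intro conjI allI impI assms(1))
  fix L assume "submod A M L \<and> K <+>\<^bsub>M\<^esub> L = carrier M"
  then have L: "submod A M L" and KL: "K <+>\<^bsub>M\<^esub> L = carrier M" by auto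
  note K' = submodD[OF assms(1)] and L' = submodD[OF L]
  have "rad M \<subseteq> L"
  proof (rule rad_least[OF L])
    fix x e assume "x \<in> carrier M" "e \<in> arcs Q"
    then obtain k l where kl: "k \<in> K" "l \<in> L" "x = k \<oplus>\<^bsub>M\<^esub> l" using KL mem_set_add[of x K L] by blast
    then have "x \<triangleleft>\<^bsub>M\<^esub> ar e = l \<triangleleft>\<^bsub>M\<^esub> ar e"
      using K'(3) L'(3) assms(2) by (simp add: ract_l_distr rad_ar subset_iff)
    then show "x \<triangleleft>\<^bsub>M\<^esub> ar e \<in> L" using kl L'(7) by simp
  qed
  then have "K \<subseteq> L" using assms(2) by blast
  then have "x \<in> L" if "x \<in> K <+>\<^bsub>M\<^esub> L" for x
    using that L'(4) unfolding mem_set_add by auto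
  then show "L = carrier M" using KL L'(1) by blast
qed

section \<open>Sums of indecomposable projectives\<close>

context rsz_ring
begin

definition proj_at :: "'v \<Rightarrow> ('r, 'r) rmodule" where
  "proj_at i = (reg_module A)\<lparr>carrier := {a \<in> carrier A. ep i \<otimes>\<^bsub>A\<^esub> a = a}\<rparr>"

text \<open>The index set and its labelling by vertices are arbitrary, so the homogeneous generators
  of a module can index its own cover.\<close>

definition proj_sum :: "'i set \<Rightarrow> ('i \<Rightarrow> 'v) \<Rightarrow> ('r, 'i \<Rightarrow> 'r) rmodule" where
  "proj_sum X v = dsum_family X (\<lambda>x. proj_at (v x))"

definition proj_gen :: "'i set \<Rightarrow> ('i \<Rightarrow> 'v) \<Rightarrow> 'i \<Rightarrow> 'i \<Rightarrow> 'r" where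
  "proj_gen X v x = inj_at X (\<lambda>x. proj_at (v x)) x (ep (v x))"

lemma proj_at_simps [simp]:
  "carrier (proj_at i) = {a \<in> carrier A. ep i \<otimes>\<^bsub>A\<^esub> a = a}" "\<zero>\<^bsub>proj_at i\<^esub> = \<zero>\<^bsub>A\<^esub>"
  "x \<oplus>\<^bsub>proj_at i\<^esub> y = x \<oplus>\<^bsub>A\<^esub> y" "x \<triangleleft>\<^bsub>proj_at i\<^esub> a = x \<otimes>\<^bsub>A\<^esub> a"
  by (simp_all add: proj_at_def)

lemma submod_proj_at: "submod A (reg_module A) {a \<in> carrier A. ep i \<otimes>\<^bsub>A\<^esub> a = a}"
  by (rule right_module.submodI[OF A.right_module_reg]) (auto simp: A.r_distr A.m_assoc[symmetric])

lemma right_module_proj_at: "right_module A (proj_at i)"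
  unfolding proj_at_def by (rule right_module.right_module_submod[OF A.right_module_reg submod_proj_at])

lemma generates_proj_at: "generates A (proj_at i) {ep i}"
proof -
  interpret P: right_module A "proj_at i" by (rule right_module_proj_at)
  have "a \<in> N" if "submod A (proj_at i) N" "ep i \<in> N" "a \<in> carrier (proj_at i)" for a N
    using P.submodD(7)[OF that(1,2), of a] that(3) by simp
  then show ?thesis using P.submodD(1) by (auto simp: generates_def ep_ep)
qed

lemma right_module_proj_sum: "right_module A (proj_sum X v)"
  unfolding proj_sum_def by (intro right_module_dsum_family A.ring_axioms right_module_proj_at)

lemma fin_gen_proj_sum: "finite X \<Longrightarrow> fin_gen A (proj_sum X v)"
  unfolding proj_sum_def
  by (intro fin_gen_dsum_family A.ring_axioms right_module_proj_at) (use generates_proj_at in \<open>auto simp: fin_gen_iff\<close>)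

lemma proj_sum_coord: "a \<in> carrier (proj_sum X v) \<Longrightarrow> x \<in> X \<Longrightarrow> a x \<in> carrier A \<and> ep (v x) \<otimes>\<^bsub>A\<^esub> a x = a x"
  by (auto simp: proj_sum_def PiE_iff)

lemma proj_gen_closed: "x \<in> X \<Longrightarrow> proj_gen X v x \<in> carrier (proj_sum X v)"
  unfolding proj_gen_def proj_sum_def
  by (rule rhomD(1)[OF rhom_inj_at[of _ A]]) (auto intro: right_module_proj_at simp: ep_ep)

lemma proj_gen_ract:
  assumes "x \<in> X" "a \<in> carrier A" "ep (v x) \<otimes>\<^bsub>A\<^esub> a = a"
  shows "proj_gen X v x \<triangleleft>\<^bsub>proj_sum X v\<^esub> a = inj_at X (\<lambda>x. proj_at (v x)) x a"
  using rhomD(3)[OF rhom_inj_at[of X A "\<lambda>x. proj_at (v x)" x], of "ep (v x)" a] assms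
  by (simp add: proj_gen_def proj_sum_def right_module_proj_at ep_ep)

lemma proj_sum_decomp:
  assumes "finite X" "a \<in> carrier (proj_sum X v)"
  shows "a = (\<Oplus>\<^bsub>proj_sum X v\<^esub>x\<in>X. proj_gen X v x \<triangleleft>\<^bsub>proj_sum X v\<^esub> a x)"
proof -
  interpret F: right_module A "proj_sum X v" by (rule right_module_proj_sum)
  have "a = (\<Oplus>\<^bsub>proj_sum X v\<^esub>x\<in>X. inj_at X (\<lambda>x. proj_at (v x)) x (a x))"
    unfolding proj_sum_def
    by (rule dsum_family_decomp[OF A.ring_axioms right_module_proj_at assms(1) assms(2)[unfolded proj_sum_def]])
  also have "\<dots> = (\<Oplus>\<^bsub>proj_sum X v\<^esub>x\<in>X. proj_gen X v x \<triangleleft>\<^bsub>proj_sum X v\<^esub> a x)"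
    using proj_sum_coord[OF assms(2)] proj_gen_closed[of _ X v]
    by (intro F.M.finsum_cong') (auto simp: proj_gen_ract)
  finally show ?thesis .
qed

lemma rhom_proj_sum:
  assumes "right_module A N" "finite X" "\<And>x. x \<in> X \<Longrightarrow> y x \<in> carrier N"
  shows "(\<lambda>a. \<Oplus>\<^bsub>N\<^esub>x\<in>X. y x \<triangleleft>\<^bsub>N\<^esub> a x) \<in> rhom A (proj_sum X v) N"
proof (rule rhomI)
  interpret N: right_module A N by fact
  note co = proj_sum_coord
  show "(\<Oplus>\<^bsub>N\<^esub>x\<in>X. y x \<triangleleft>\<^bsub>N\<^esub> a x) \<in> carrier N" if "a \<in> carrier (proj_sum X v)" for a
    using assms(3) co[OF that] by (auto intro!: N.M.finsum_closed)
  fix a assume a: "a \<in> carrier (proj_sum X v)"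
  show "(\<Oplus>\<^bsub>N\<^esub>x\<in>X. y x \<triangleleft>\<^bsub>N\<^esub> (a \<oplus>\<^bsub>proj_sum X v\<^esub> b) x) = (\<Oplus>\<^bsub>N\<^esub>x\<in>X. y x \<triangleleft>\<^bsub>N\<^esub> a x) \<oplus>\<^bsub>N\<^esub> (\<Oplus>\<^bsub>N\<^esub>x\<in>X. y x \<triangleleft>\<^bsub>N\<^esub> b x)"
    if b: "b \<in> carrier (proj_sum X v)" for b
  proof -
    have "(\<Oplus>\<^bsub>N\<^esub>x\<in>X. y x \<triangleleft>\<^bsub>N\<^esub> (a \<oplus>\<^bsub>proj_sum X v\<^esub> b) x) = (\<Oplus>\<^bsub>N\<^esub>x\<in>X. (y x \<triangleleft>\<^bsub>N\<^esub> a x) \<oplus>\<^bsub>N\<^esub> (y x \<triangleleft>\<^bsub>N\<^esub> b x))"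
      using assms(3) co[OF a] co[OF b] by (intro N.M.finsum_cong') (auto simp: N.ract_r_distr proj_sum_def)
    then show ?thesis using assms(3) co[OF a] co[OF b] by (subst (asm) N.M.finsum_addf) auto
  qed
  show "(\<Oplus>\<^bsub>N\<^esub>x\<in>X. y x \<triangleleft>\<^bsub>N\<^esub> (a \<triangleleft>\<^bsub>proj_sum X v\<^esub> b) x) = (\<Oplus>\<^bsub>N\<^esub>x\<in>X. y x \<triangleleft>\<^bsub>N\<^esub> a x) \<triangleleft>\<^bsub>N\<^esub> b"
    if b: "b \<in> carrier A" for b
  proof -
    have "(\<Oplus>\<^bsub>N\<^esub>x\<in>X. y x \<triangleleft>\<^bsub>N\<^esub> (a \<triangleleft>\<^bsub>proj_sum X v\<^esub> b) x) = (\<Oplus>\<^bsub>N\<^esub>x\<in>X. (y x \<triangleleft>\<^bsub>N\<^esub> a x) \<triangleleft>\<^bsub>N\<^esub> b)"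
      using assms(3) co[OF a] b by (intro N.M.finsum_cong') (auto simp: N.ract_assoc proj_sum_def)
    then show ?thesis using assms(3) co[OF a] b by (subst N.finsum_ract) auto
  qed
qed

lemma rhom_proj_sum_gen:
  assumes "right_module A N" "finite X" "\<And>x. x \<in> X \<Longrightarrow> y x \<in> carrier N \<and> y x \<triangleleft>\<^bsub>N\<^esub> ep (v x) = y x" "z \<in> X"
  shows "(\<Oplus>\<^bsub>N\<^esub>x\<in>X. y x \<triangleleft>\<^bsub>N\<^esub> proj_gen X v z x) = y z"
proof -
  interpret N: right_module A N by fact
  have "(\<Oplus>\<^bsub>N\<^esub>x\<in>X. y x \<triangleleft>\<^bsub>N\<^esub> proj_gen X v z x) = (\<Oplus>\<^bsub>N\<^esub>x\<in>X. if z = x then y x else \<zero>\<^bsub>N\<^esub>)"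
    using assms(3,4) by (intro N.M.finsum_cong') (auto simp: proj_gen_def inj_at_def N.ract_zero_right)
  then show ?thesis using assms(2-4) by (simp add: N.M.finsum_singleton)
qed

text \<open>It suffices to lift the images of the generators, since each element is the sum of
  generators times its own coordinates. \<open>M\<close> and \<open>N\<close> may have any element
  type here, so the lift is available before anything is copied into \<open>fgmod\<close>.\<close>

lemma proj_sum_lift:
  assumes "finite X" "right_module A M" "right_module A N" "g \<in> rhom A M N" "g ` carrier M = carrier N"
    and f: "f \<in> rhom A (proj_sum X v) N"
  shows "\<exists>h \<in> rhom A (proj_sum X v) M. \<forall>a\<in>carrier (proj_sum X v). g (h a) = f a"
proof -
  interpret M: right_module A M by fact
  interpret N: right_module A N by fact
  interpret F: right_module A "proj_sum X v" by (rule right_module_proj_sum)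
  note g' = rhomD[OF assms(4)] and f' = rhomD[OF f]
  have gen: "proj_gen X v x \<triangleleft>\<^bsub>proj_sum X v\<^esub> ep (v x) = proj_gen X v x" if "x \<in> X" for x
    using proj_gen_ract[OF that basis_closed(1)] by (simp add: ep_ep proj_gen_def)
  have "\<exists>y. y \<in> carrier M \<and> g y = f (proj_gen X v x)" if "x \<in> X" for x
  proof -
    have "f (proj_gen X v x) \<in> g ` carrier M" using f'(1) proj_gen_closed[OF that] assms(5) by simp
    then show ?thesis by auto
  qed
  then obtain y where y: "\<And>x. x \<in> X \<Longrightarrow> y x \<in> carrier M \<and> g (y x) = f (proj_gen X v x)" by metis
  let ?h = "\<lambda>a. \<Oplus>\<^bsub>M\<^esub>x\<in>X. y x \<triangleleft>\<^bsub>M\<^esub> a x"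
  have h: "?h \<in> rhom A (proj_sum X v) M" using y by (intro rhom_proj_sum assms(1,2)) auto
  have gh: "g (?h a) = f a" if a: "a \<in> carrier (proj_sum X v)" for a
  proof -
    note co = proj_sum_coord[OF a]
    have "g (?h a) = (\<Oplus>\<^bsub>N\<^esub>x\<in>X. g (y x \<triangleleft>\<^bsub>M\<^esub> a x))"
      by (rule rhom_finsum[OF assms(2-4)]) (use y co in auto)
    also have "\<dots> = (\<Oplus>\<^bsub>N\<^esub>x\<in>X. f (proj_gen X v x \<triangleleft>\<^bsub>proj_sum X v\<^esub> a x))"
      using y co g'(3) f'(1,3) proj_gen_closed[of _ X v] by (intro N.M.finsum_cong') auto
    also have "\<dots> = f (\<Oplus>\<^bsub>proj_sum X v\<^esub>x\<in>X. proj_gen X v x \<triangleleft>\<^bsub>proj_sum X v\<^esub> a x)"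
      by (rule rhom_finsum[OF F.right_module_axioms assms(3) f, symmetric]) (use co proj_gen_closed[of _ X v] in auto)
    finally show ?thesis using proj_sum_decomp[OF assms(1) a] by simp
  qed
  show ?thesis by (intro bexI[OF _ h] ballI gh)
qed

lemma proj_sum_rad:
  assumes "finite X" "a \<in> carrier (proj_sum X v)" "\<And>x. x \<in> X \<Longrightarrow> \<exists>d. a x = el (\<lambda>_. 0) d"
  shows "a \<in> rad (proj_sum X v)"
proof -
  interpret F: rsz_module Q A el "proj_sum X v" by (intro rsz_moduleI right_module_proj_sum)
  have "(\<Oplus>\<^bsub>proj_sum X v\<^esub>x\<in>X. proj_gen X v x \<triangleleft>\<^bsub>proj_sum X v\<^esub> a x) \<in> rad (proj_sum X v)"
  proof (rule F.submod_finsum[OF F.submod_rad assms(1)])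
    fix x assume x: "x \<in> X"
    show "proj_gen X v x \<triangleleft>\<^bsub>proj_sum X v\<^esub> a x \<in> rad (proj_sum X v)"
      using assms(3)[OF x] F.el_in_rad[OF proj_gen_closed[OF x]] by auto
  qed
  then show ?thesis using proj_sum_decomp[OF assms(1,2)] by simp
qed

text \<open>In each coordinate, u e times the arrow e is the coefficient of u e at the idempotent of
  the tail, times e. Arrows are linearly independent, so these coefficients vanish. Homogeneity
  kills the remaining idempotent coefficients, and only a combination of arrows is left.\<close>

lemma proj_sum_relation:
  assumes "finite X" "u \<in> arcs Q \<rightarrow> carrier (proj_sum X v)"
    and "\<And>e. e \<in> arcs Q \<Longrightarrow> u e \<triangleleft>\<^bsub>proj_sum X v\<^esub> ep (tail Q e) = u e"
    and "arc_sum (proj_sum X v) u = \<zero>\<^bsub>proj_sum X v\<^esub>"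
    and "\<beta> \<in> arcs Q"
  shows "u \<beta> \<in> rad (proj_sum X v)"
proof (rule proj_sum_rad[OF assms(1)])
  let ?F = "proj_sum X v"
  interpret F: right_module A ?F by (rule right_module_proj_sum)
  interpret R: right_module A "reg_module A" by (rule A.right_module_reg)
  show "u \<beta> \<in> carrier ?F" using assms(2,5) by auto
  fix x assume x: "x \<in> X"
  have pr: "(\<lambda>a. a x) \<in> rhom A ?F (reg_module A)"
    by (rule rhomI) (use x in \<open>auto simp: proj_sum_def\<close>)
  have "\<exists>c d. u e x = el c d" if "e \<in> arcs Q" for e
    using proj_sum_coord[OF _ x, of "u e"] assms(2) that el_surj by blast
  then obtain c d where cd: "\<And>e. e \<in> arcs Q \<Longrightarrow> u e x = el (c e) (d e)" by metis
  have "el (\<lambda>_. 0) (\<lambda>_. 0) = (arc_sum ?F u) x"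
    using assms(4) x by (simp add: proj_sum_def el_zero)
  also have "\<dots> = (\<Oplus>\<^bsub>reg_module A\<^esub>e\<in>arcs Q. (u e \<triangleleft>\<^bsub>?F\<^esub> ar e) x)"
    by (rule rhom_finsum[OF F.right_module_axioms R.right_module_axioms pr]) (use assms(2) in auto)
  also have "\<dots> = (\<Oplus>\<^bsub>reg_module A\<^esub>e\<in>arcs Q. sc (c e (tail Q e)) \<otimes>\<^bsub>A\<^esub> ar e)"
    using x cd by (intro R.M.finsum_cong') (auto simp: proj_sum_def el_ar)
  also have "\<dots> = el (\<lambda>_. 0) (\<lambda>e. c e (tail Q e))" by (rule el_decomp_arcs[symmetric])
  finally have 1: "c \<beta> (tail Q \<beta>) = 0" using assms(5) by (auto simp: el_eq)
  have "u \<beta> x \<otimes>\<^bsub>A\<^esub> ep (tail Q \<beta>) = u \<beta> x"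
    using fun_cong[OF assms(3)[OF assms(5)], of x] x by (simp add: proj_sum_def)
  then have "c \<beta> j = 0" if "j \<in> verts Q" "j \<noteq> tail Q \<beta>" for j
    using that unfolding cd[OF assms(5)] by (auto simp: ep_def el_mult el_eq)
  with 1 have "u \<beta> x = el (\<lambda>_. 0) (d \<beta>)" unfolding cd[OF assms(5)] el_eq by metis
  then show "\<exists>d. u \<beta> x = el (\<lambda>_. 0) d" by blast
qed

lemma proj_sum_copy:
  assumes "finite X"
  obtains P t t' where "projective A P" "iso_pair A (proj_sum X v) P t t'"
proof -
  let ?F = "proj_sum X v"
  interpret F: right_module A ?F by (rule right_module_proj_sum)
  obtain P t t' where P: "P \<in> fgmod A" and iso: "iso_pair A ?F P t t'"
    by (rule F.iso_pair_exists[OF fin_gen_proj_sum[OF assms]])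
  then have t: "t \<in> rhom A ?F P" "t' \<in> rhom A P ?F" "\<forall>p\<in>carrier P. t (t' p) = p"
    by (simp_all add: iso_pair_def)
  have "projective A P" unfolding projective_def
  proof (intro conjI ballI impI P)
    fix M N g f assume M: "M \<in> fgmod A" and N: "N \<in> fgmod A" and g: "g \<in> rhom A M N" "g ` carrier M = carrier N"
      and f: "f \<in> rhom A P N"
    have "\<exists>h \<in> rhom A ?F M. \<forall>a\<in>carrier ?F. g (h a) = f (t a)"
      by (rule proj_sum_lift[OF assms _ _ g rhom_comp[OF t(1) f]]) (use M N in \<open>auto simp: fgmod_def\<close>)
    then obtain h where h: "h \<in> rhom A ?F M" "\<And>a. a \<in> carrier ?F \<Longrightarrow> g (h a) = f (t a)" by blast
    show "\<exists>h\<in>rhom A P M. \<forall>x\<in>carrier P. g (h x) = f x"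
      by (rule bexI[OF _ rhom_comp[OF t(2) h(1)]]) (simp add: h(2) t(3) rhomD(1)[OF t(2)])
  qed
  then show ?thesis by (rule that[OF _ iso])
qed

end

section \<open>Minimal sets of homogeneous generators\<close>

context rsz_module
begin

text \<open>A generator fixed by \<open>ep i\<close> is the image of the generator of the
  indecomposable projective at i. General generators would only give covers by free modules.\<close>

definition homogeneous_generators :: "'m set \<Rightarrow> bool" where
  "homogeneous_generators X \<longleftrightarrow> finite X \<and> (\<forall>x\<in>X. \<exists>i\<in>verts Q. x \<triangleleft>\<^bsub>M\<^esub> ep i = x) \<and> generates A M X"

lemma homogeneous_generators_exist:
  assumes "fin_gen A M"
  shows "\<exists>X. homogeneous_generators X"
proof -
  obtain Y where Y: "finite Y" "generates A M Y" using assms unfolding fin_gen_iff by blast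
  let ?X = "(\<lambda>(y, i). y \<triangleleft>\<^bsub>M\<^esub> ep i) ` (Y \<times> verts Q)"
  have YM: "y \<in> carrier M" if "y \<in> Y" for y using Y(2) that by (auto simp: generates_def)
  have "generates A M ?X" unfolding generates_def
  proof (intro conjI allI impI)
    show "?X \<subseteq> carrier M" using YM by auto
    fix N assume N: "submod A M N \<and> ?X \<subseteq> N"
    have "y \<in> N" if "y \<in> Y" for y
    proof -
      have "(\<Oplus>\<^bsub>M\<^esub>i\<in>verts Q. y \<triangleleft>\<^bsub>M\<^esub> ep i) \<in> N"
        by (rule submod_finsum) (use N that in auto)
      then show ?thesis using decomp_verts[OF YM[OF that]] by simp
    qed
    then have "Y \<subseteq> N" by blast
    then show "N = carrier M" using Y(2) N unfolding generates_def by blast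
  qed
  then have "homogeneous_generators ?X" unfolding homogeneous_generators_def
    using Y(1) YM by (auto simp: ract_assoc[symmetric] ep_ep)
  then show ?thesis by blast
qed

text \<open>A coefficient outside the radical would make its generator redundant, by Nakayama's lemma.\<close>

lemma minimal_generators_relation:
  assumes X: "homogeneous_generators X" and min: "\<And>Y. homogeneous_generators Y \<Longrightarrow> card X \<le> card Y"
    and v: "\<And>x. x \<in> X \<Longrightarrow> x \<triangleleft>\<^bsub>M\<^esub> ep (v x) = x" "\<And>x. x \<in> X \<Longrightarrow> v x \<in> verts Q"
    and a: "\<And>x. x \<in> X \<Longrightarrow> a x \<in> carrier A \<and> ep (v x) \<otimes>\<^bsub>A\<^esub> a x = a x"
    and rel: "(\<Oplus>\<^bsub>M\<^esub>x\<in>X. x \<triangleleft>\<^bsub>M\<^esub> a x) = \<zero>\<^bsub>M\<^esub>" and y: "y \<in> X"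
  shows "\<exists>d. a y = el (\<lambda>_. 0) d"
proof -
  have fX: "finite X" and gX: "generates A M X" using X by (auto simp: homogeneous_generators_def)
  have XM: "x \<in> carrier M" if "x \<in> X" for x using gX that by (auto simp: generates_def)
  obtain c d where cd: "a y = el c d" using a[OF y] el_surj by blast
  \<comment> \<open>Since a y starts at v y, the only idempotent coefficient left to exclude is the
    one at v y.\<close>
  have c0: "c j = 0" if "j \<in> verts Q" "j \<noteq> v y" for j
    using a[OF y] that unfolding cd by (auto simp: ep_def el_mult el_eq)
  have "c (v y) = 0"
  proof (rule ccontr)
    assume nz: "c (v y) \<noteq> 0"
    have "generates A M (X - {y})" unfolding generates_def
    proof (intro conjI allI impI)
      show "X - {y} \<subseteq> carrier M" using XM by auto
      fix N assume "submod A M N \<and> X - {y} \<subseteq> N"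
      then have N: "submod A M N" "X - {y} \<subseteq> N" by auto
      note N' = submodD[OF N(1)]
      let ?L = "rad M <+>\<^bsub>M\<^esub> N"
      have L: "submod A M ?L" by (rule submod_set_add[OF submod_rad N(1)])
      note L' = submodD[OF L]
      have up: "rad M \<subseteq> ?L" "N \<subseteq> ?L" using set_add_upper[OF submod_rad N(1)] by auto
      let ?s = "\<Oplus>\<^bsub>M\<^esub>x\<in>X - {y}. x \<triangleleft>\<^bsub>M\<^esub> a x"
      have sN: "?s \<in> N" by (rule submod_finsum[OF N(1)]) (use fX N a N'(7) in auto)
      have "(\<Oplus>\<^bsub>M\<^esub>x\<in>insert y (X - {y}). x \<triangleleft>\<^bsub>M\<^esub> a x) = (y \<triangleleft>\<^bsub>M\<^esub> a y) \<oplus>\<^bsub>M\<^esub> ?s"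
        by (rule M.finsum_insert) (use fX XM a y in auto)
      then have "(y \<triangleleft>\<^bsub>M\<^esub> a y) \<oplus>\<^bsub>M\<^esub> ?s = \<zero>\<^bsub>M\<^esub>" using rel y by (simp add: insert_absorb)
      then have "y \<triangleleft>\<^bsub>M\<^esub> a y = \<ominus>\<^bsub>M\<^esub> ?s" using M.minus_equality[of "y \<triangleleft>\<^bsub>M\<^esub> a y" ?s] XM[OF y] a[OF y] N'(3)[OF sN] by simp
      then have "y \<triangleleft>\<^bsub>M\<^esub> a y \<in> ?L" using N'(5)[OF sN] up(2) by auto
      moreover have "y \<triangleleft>\<^bsub>M\<^esub> el (\<lambda>_. 0) d \<in> ?L" using el_in_rad[OF XM[OF y]] up(1) by blast
      moreover have "y \<triangleleft>\<^bsub>M\<^esub> a y = (y \<triangleleft>\<^bsub>M\<^esub> sc (c (v y))) \<oplus>\<^bsub>M\<^esub> (y \<triangleleft>\<^bsub>M\<^esub> el (\<lambda>_. 0) d)"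
      proof -
        have "y \<triangleleft>\<^bsub>M\<^esub> el c (\<lambda>_. 0) = y \<triangleleft>\<^bsub>M\<^esub> (ep (v y) \<otimes>\<^bsub>A\<^esub> el c (\<lambda>_. 0))"
          using XM[OF y] v(1)[OF y] by (simp add: ract_assoc)
        also have "\<dots> = y \<triangleleft>\<^bsub>M\<^esub> sc (c (v y))"
          using XM[OF y] v(1)[OF y] by (simp add: ep_el sc_comm ract_assoc)
        finally show ?thesis unfolding cd el_split[of c d] using XM[OF y] by (simp add: ract_r_distr)
      qed
      ultimately have "(y \<triangleleft>\<^bsub>M\<^esub> sc (c (v y))) \<oplus>\<^bsub>M\<^esub> (y \<triangleleft>\<^bsub>M\<^esub> el (\<lambda>_. 0) d) \<ominus>\<^bsub>M\<^esub> (y \<triangleleft>\<^bsub>M\<^esub> el (\<lambda>_. 0) d) \<in> ?L"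
        using L'(6) by metis
      then have "y \<triangleleft>\<^bsub>M\<^esub> sc (c (v y)) \<in> ?L" using XM[OF y] by (simp add: M.minus_eq M.a_assoc M.r_neg)
      then have "(y \<triangleleft>\<^bsub>M\<^esub> sc (c (v y))) \<triangleleft>\<^bsub>M\<^esub> sc (1 / c (v y)) \<in> ?L" by (rule L'(7)) simp
      then have "y \<in> ?L" using XM[OF y] nz by (simp add: ract_assoc[symmetric] sc_sc sc_one)
      then have "X \<subseteq> ?L" using N(2) up(2) by blast
      then have "?L = carrier M" using gX L unfolding generates_def by blast
      then show "N = carrier M" using rad_superfluous[OF submod_rad order_refl] N(1) unfolding superfluous_def by blast
    qed
    then have "homogeneous_generators (X - {y})" using X unfolding homogeneous_generators_def by auto
    then have "card X \<le> card (X - {y})" by (rule min)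
    then show False using fX y by (metis card_Diff1_less not_less)
  qed
  then have "a y = el (\<lambda>_. 0) d" unfolding cd el_eq using c0 by metis
  then show ?thesis by blast
qed

text \<open>A homogeneous generating set of least cardinality indexes the cover. A kernel element is
  then a relation between minimal generators, so each of its coordinates is a combination of
  arrows.\<close>

lemma minimal_cover:
  assumes "fin_gen A M"
  obtains X :: "'m set" and v g where "finite X" "g \<in> rhom A (proj_sum X v) M"
    "g ` carrier (proj_sum X v) = carrier M" "a_kernel (proj_sum X v) M g \<subseteq> rad (proj_sum X v)"
proof -
  obtain X where X: "homogeneous_generators X" and min: "\<And>Y. homogeneous_generators Y \<Longrightarrow> card X \<le> card Y"
    using homogeneous_generators_exist[OF assms] ex_has_least_nat[of homogeneous_generators _ card] by blast
  have fX: "finite X" and gX: "generates A M X" using X by (auto simp: homogeneous_generators_def)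
  have XM: "x \<in> carrier M" if "x \<in> X" for x using gX that by (auto simp: generates_def)
  have "\<exists>i. i \<in> verts Q \<and> x \<triangleleft>\<^bsub>M\<^esub> ep i = x" if "x \<in> X" for x using X that by (auto simp: homogeneous_generators_def)
  then obtain v where v: "\<And>x. x \<in> X \<Longrightarrow> v x \<in> verts Q \<and> x \<triangleleft>\<^bsub>M\<^esub> ep (v x) = x" by metis
  let ?F = "proj_sum X v" and ?g = "\<lambda>a. \<Oplus>\<^bsub>M\<^esub>x\<in>X. x \<triangleleft>\<^bsub>M\<^esub> a x"
  have g: "?g \<in> rhom A ?F M" by (rule rhom_proj_sum[OF right_module_axioms fX XM])
  show ?thesis
  proof (rule that[OF fX g])
    have "X \<subseteq> ?g ` carrier ?F"
    proof
      fix x assume x: "x \<in> X"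
      have 1: "?g (proj_gen X v x) = x"
        by (rule rhom_proj_sum_gen[OF right_module_axioms fX _ x]) (use XM v in auto)
      show "x \<in> ?g ` carrier ?F" 
        by (rule image_eqI[where x = "proj_gen X v x"]) (simp_all only: 1 proj_gen_closed[OF x])
    qed
    then show "?g ` carrier ?F = carrier M"
      by (intro generatesD[OF gX] submod_image[OF right_module_proj_sum right_module_axioms g]
          right_module.submod_carrier[OF right_module_proj_sum])
    show "a_kernel ?F M ?g \<subseteq> rad ?F"
    proof
      fix a assume "a \<in> a_kernel ?F M ?g"
      then have a: "a \<in> carrier ?F" "?g a = \<zero>\<^bsub>M\<^esub>" by (auto simp: a_kernel_def')
      show "a \<in> rad ?F"
        by (rule proj_sum_rad[OF fX a(1)], rule minimal_generators_relation[OF X min _ _ _ a(2), of v])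
           (use v proj_sum_coord[OF a(1)] in auto)
    qed
  qed
qed

end

section \<open>Existence of projective covers\<close>

context rsz_ring
begin

text \<open>The isomorphism with \<open>proj_sum\<close> stays visible in the conclusion because
  relations in a general projective module are later computed through its coordinates.\<close>

lemma projective_cover:
  fixes M :: "('r, 'm) rmodule"
  assumes "right_module A M" "fin_gen A M"
  obtains X :: "'m set" and v P t t' g where "finite X" "projective A P" "iso_pair A (proj_sum X v) P t t'"
    "g \<in> rhom A P M" "g ` carrier P = carrier M" "a_kernel P M g \<subseteq> rad P"
proof -
  interpret M: rsz_module Q A el M by (rule rsz_moduleI[OF assms(1)])
  obtain X :: "'m set" and v g where X: "finite X" "g \<in> rhom A (proj_sum X v) M"
    "g ` carrier (proj_sum X v) = carrier M" "a_kernel (proj_sum X v) M g \<subseteq> rad (proj_sum X v)"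
    by (rule M.minimal_cover[OF assms(2)])
  obtain P t t' where iso: "projective A P" "iso_pair A (proj_sum X v) P t t'"
    by (rule proj_sum_copy[OF X(1)])
  then have P: "t \<in> rhom A (proj_sum X v) P" "t' \<in> rhom A P (proj_sum X v)"
    "\<forall>a\<in>carrier (proj_sum X v). t' (t a) = a" "\<forall>p\<in>carrier P. t (t' p) = p"
    by (simp_all add: iso_pair_def)
  have rP: "right_module A P" using iso(1) by (simp add: projective_def fgmod_def)
  let ?g = "\<lambda>p. g (t' p)"
  have g: "?g \<in> rhom A P M" by (rule rhom_comp[OF P(2) X(2)])
  have surj: "?g ` carrier P = carrier M"
  proof (intro equalityI subsetI)
    show "x \<in> carrier M" if "x \<in> ?g ` carrier P" for x using that rhomD(1)[OF g] by auto
    fix x assume "x \<in> carrier M"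
    then obtain a where a: "a \<in> carrier (proj_sum X v)" "x = g a" using X(3) by auto
    then have "x = ?g (t a)" using P(3) by simp
    then show "x \<in> ?g ` carrier P" using rhomD(1)[OF P(1) a(1)] by blast
  qed
  have "a_kernel P M ?g \<subseteq> rad P"
  proof
    fix p assume "p \<in> a_kernel P M ?g"
    then have pP: "p \<in> carrier P" "g (t' p) = \<zero>\<^bsub>M\<^esub>" by (auto simp: a_kernel_def')
    then have "t' p \<in> rad (proj_sum X v)" using X(4) rhomD(1)[OF P(2) pP(1)] unfolding a_kernel_def' by blast
    then show "p \<in> rad P" using rad_hom[OF right_module_proj_sum rP P(1)] bspec[OF P(4) pP(1)] by metis
  qed
  then show ?thesis by (rule that[OF X(1) iso g surj])
qed

lemma syzygy_exists:
  assumes "M \<in> fgmod A"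
  shows "is_syzygy A M (syzygy A M)"
proof -
  have M: "right_module A M" "fin_gen A M" using assms by (auto simp: fgmod_def)
  obtain X :: "(nat \<Rightarrow> 'r) set" and v P t t' g where X: "finite X" and P: "projective A P"
    "iso_pair A (proj_sum X v) P t t'" "g \<in> rhom A P M" "g ` carrier P = carrier M" "a_kernel P M g \<subseteq> rad P"
    by (rule projective_cover[OF M])
  have rP: "right_module A P" "fin_gen A P" using P(1) by (auto simp: projective_def fgmod_def)
  interpret P: rsz_module Q A el P by (rule rsz_moduleI[OF rP(1)])
  have K: "submod A P (a_kernel P M g)" by (rule submod_kernel[OF rP(1) M(1) P(3)])
  obtain N f where N: "N \<in> fgmod A" "f \<in> rhom A N P" "inj_on f (carrier N)" "f ` carrier N = a_kernel P M g"
    by (rule P.submod_copy[OF K P.fin_gen_submod[OF rP(2) K]])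
  have "superfluous A P (f ` carrier N)" unfolding N(4) by (rule P.rad_superfluous[OF K P(5)])
  then have "is_syzygy A M N" unfolding is_syzygy_def short_exact_def
    using P N by (intro conjI exI[of _ P] exI[of _ f] exI[of _ g]) auto
  then show ?thesis unfolding syzygy_def by (rule someI)
qed

text \<open>A projective module is a retract of its cover, which is a \<open>proj_sum\<close> up to
  isomorphism. The section carries the relation into coordinates, where the coefficients are seen to
  be radical, and the retraction carries them back.\<close>

lemma projective_relation:
  assumes "projective A P" "u \<in> arcs Q \<rightarrow> carrier P"
    and "\<And>e. e \<in> arcs Q \<Longrightarrow> u e \<triangleleft>\<^bsub>P\<^esub> ep (tail Q e) = u e"
    and "arc_sum P u = \<zero>\<^bsub>P\<^esub>" and "\<beta> \<in> arcs Q"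
  shows "u \<beta> \<in> rad P"
proof -
  have P: "P \<in> fgmod A" "right_module A P" "fin_gen A P" using assms(1) by (auto simp: projective_def fgmod_def)
  interpret P: right_module A P by (rule P(2))
  obtain X :: "(nat \<Rightarrow> 'r) set" and v R t t' g where X: "finite X" and R: "projective A R"
    "iso_pair A (proj_sum X v) R t t'" "g \<in> rhom A R P" "g ` carrier R = carrier P" "a_kernel R P g \<subseteq> rad R"
    by (rule projective_cover[OF P(2,3)])
  let ?F = "proj_sum X v"
  interpret F: right_module A ?F by (rule right_module_proj_sum)
  have t: "t \<in> rhom A ?F R" "t' \<in> rhom A R ?F" "\<forall>r\<in>carrier R. t (t' r) = r"
    using R(2) by (simp_all add: iso_pair_def)
  have rR: "R \<in> fgmod A" "right_module A R" using R(1) by (auto simp: projective_def fgmod_def)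
  have "(\<lambda>x. x) \<in> rhom A P P" by (rule rhomI) auto
  then have "\<exists>h\<in>rhom A P R. \<forall>x\<in>carrier P. g (h x) = x"
    by (intro projective_lift[OF assms(1) rR(1) P(1) R(3) _ R(4)])
  then obtain h where h: "h \<in> rhom A P R" "\<And>x. x \<in> carrier P \<Longrightarrow> g (h x) = x" by blast
  let ?s = "\<lambda>x. t' (h x)"
  have s: "?s \<in> rhom A P ?F" by (rule rhom_comp[OF h(1) t(2)])
  note s' = rhomD[OF s]
  have uP: "u e \<in> carrier P" if "e \<in> arcs Q" for e using assms(2) that by auto
  have "?s (u \<beta>) \<in> rad ?F"
  proof (rule proj_sum_relation[OF X _ _ _ assms(5)])
    show "(\<lambda>e. ?s (u e)) \<in> arcs Q \<rightarrow> carrier ?F" using uP s'(1) by auto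
    show "?s (u e) \<triangleleft>\<^bsub>?F\<^esub> ep (tail Q e) = ?s (u e)" if "e \<in> arcs Q" for e
      using s'(3)[OF uP[OF that] basis_closed(1)[of "tail Q e"]] assms(3)[OF that] by simp
    have "(\<Oplus>\<^bsub>?F\<^esub>e\<in>arcs Q. ?s (u e) \<triangleleft>\<^bsub>?F\<^esub> ar e) = (\<Oplus>\<^bsub>?F\<^esub>e\<in>arcs Q. ?s (u e \<triangleleft>\<^bsub>P\<^esub> ar e))"
      using uP s' by (intro F.M.finsum_cong') auto
    also have "\<dots> = ?s (arc_sum P u)"
      by (rule rhom_finsum[OF P(2) F.right_module_axioms s, symmetric]) (use uP in auto)
    also have "\<dots> = \<zero>\<^bsub>?F\<^esub>" unfolding assms(4) by (rule rhom_zero[OF P(2) F.right_module_axioms s])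
    finally show "(\<Oplus>\<^bsub>?F\<^esub>e\<in>arcs Q. ?s (u e) \<triangleleft>\<^bsub>?F\<^esub> ar e) = \<zero>\<^bsub>?F\<^esub>" .
  qed
  then have "g (t (?s (u \<beta>))) \<in> rad P"
    by (rule rad_hom[OF rR(2) P(2) R(3) rad_hom[OF F.right_module_axioms rR(2) t(1)]])
  moreover have "t (?s (u \<beta>)) = h (u \<beta>)" using bspec[OF t(3) rhomD(1)[OF h(1) uP[OF assms(5)]]] .
  ultimately show ?thesis using h(2)[OF uP[OF assms(5)]] by simp
qed

end

section \<open>Injective envelopes of semisimple modules\<close>

text \<open>Only the length and the starting vertex are recorded. Splitting off the first arrow
  matches both the passage from a module to its syzygy and, read upwards, the passage to its
  cosyzygy.\<close>

primrec has_walk :: "('v, 'a) pre_digraph \<Rightarrow> nat \<Rightarrow> 'v \<Rightarrow> bool" where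
  "has_walk Q 0 j \<longleftrightarrow> j \<in> verts Q"
| "has_walk Q (Suc k) j \<longleftrightarrow> (\<exists>e\<in>arcs Q. tail Q e = j \<and> has_walk Q k (head Q e))"

context rsz_ring
begin

text \<open>The module of \<open>B\<close>-linear maps from \<open>A\<close> to \<open>M\<close>, where \<open>B\<close> is spanned by the idempotents \<open>e\<^sub>i\<close>.\<close>

definition coind :: "('r, 'm) rmodule \<Rightarrow> ('r, 'r \<Rightarrow> 'm) rmodule" where
  "coind M = \<lparr>carrier = rhom Br (reg_module A) M \<inter> extensional (carrier A), mult = undefined, one = undefined,
     zero = (\<lambda>a\<in>carrier A. \<zero>\<^bsub>M\<^esub>), add = (\<lambda>f g. \<lambda>a\<in>carrier A. f a \<oplus>\<^bsub>M\<^esub> g a),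
     ract = (\<lambda>f b. \<lambda>a\<in>carrier A. f (b \<otimes>\<^bsub>A\<^esub> a))\<rparr>"

lemma coind_simps [simp]:
  "carrier (coind M) = rhom Br (reg_module A) M \<inter> extensional (carrier A)"
  "\<zero>\<^bsub>coind M\<^esub> = (\<lambda>a\<in>carrier A. \<zero>\<^bsub>M\<^esub>)"
  "f \<oplus>\<^bsub>coind M\<^esub> g = (\<lambda>a\<in>carrier A. f a \<oplus>\<^bsub>M\<^esub> g a)"
  "f \<triangleleft>\<^bsub>coind M\<^esub> b = (\<lambda>a\<in>carrier A. f (b \<otimes>\<^bsub>A\<^esub> a))"
  by (simp_all add: coind_def)

lemma coindI:
  assumes "f \<in> extensional (carrier A)" "\<And>a. a \<in> carrier A \<Longrightarrow> f a \<in> carrier M"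
    "\<And>a b. a \<in> carrier A \<Longrightarrow> b \<in> carrier A \<Longrightarrow> f (a \<oplus>\<^bsub>A\<^esub> b) = f a \<oplus>\<^bsub>M\<^esub> f b"
    "\<And>a c. a \<in> carrier A \<Longrightarrow> f (a \<otimes>\<^bsub>A\<^esub> el c (\<lambda>_. 0)) = f a \<triangleleft>\<^bsub>M\<^esub> el c (\<lambda>_. 0)"
  shows "f \<in> carrier (coind M)"
  using assms by (auto intro!: rhomI)

lemma coindD:
  assumes "f \<in> carrier (coind M)"
  shows "f \<in> extensional (carrier A)" "a \<in> carrier A \<Longrightarrow> f a \<in> carrier M"
    "a \<in> carrier A \<Longrightarrow> b \<in> carrier A \<Longrightarrow> f (a \<oplus>\<^bsub>A\<^esub> b) = f a \<oplus>\<^bsub>M\<^esub> f b"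
    "a \<in> carrier A \<Longrightarrow> f (a \<otimes>\<^bsub>A\<^esub> el c (\<lambda>_. 0)) = f a \<triangleleft>\<^bsub>M\<^esub> el c (\<lambda>_. 0)"
  using assms rhomD[of f Br "reg_module A" M] by auto

end

section \<open>Coinduced modules\<close>

context rsz_module
begin

lemma right_module_coind: "right_module A (coind M)"
proof -
  have cl: "f \<oplus>\<^bsub>coind M\<^esub> g \<in> carrier (coind M)" if "f \<in> carrier (coind M)" "g \<in> carrier (coind M)" for f g
    by (rule coindI) (use coindD[OF that(1)] coindD[OF that(2)] in \<open>auto simp: ract_l_distr M.a_ac simp del: coind_simps(1)\<close>)
  have z: "\<zero>\<^bsub>coind M\<^esub> \<in> carrier (coind M)"
    by (rule coindI) (auto simp: ract_zero_left)
  have neg: "(\<lambda>a\<in>carrier A. \<ominus>\<^bsub>M\<^esub> f a) \<in> carrier (coind M)" if f: "f \<in> carrier (coind M)" for f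
  proof (rule coindI)
    have mr: "(\<ominus>\<^bsub>M\<^esub> x) \<triangleleft>\<^bsub>M\<^esub> b = \<ominus>\<^bsub>M\<^esub> (x \<triangleleft>\<^bsub>M\<^esub> b)" if "x \<in> carrier M" "b \<in> carrier A" for x b
      using rhom_minus[of Kr M M "\<lambda>x. x"] that ract_l_distr[of "\<ominus>\<^bsub>M\<^esub> x" x b] ract_zero_left[of b]
      by (metis M.a_inv_closed M.l_neg M.minus_equality ract_closed)
    show "(\<lambda>a\<in>carrier A. \<ominus>\<^bsub>M\<^esub> f a) (a \<otimes>\<^bsub>A\<^esub> el c (\<lambda>_. 0)) = (\<lambda>a\<in>carrier A. \<ominus>\<^bsub>M\<^esub> f a) a \<triangleleft>\<^bsub>M\<^esub> el c (\<lambda>_. 0)"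
      if "a \<in> carrier A" for a c
      using coindD[OF f] that by (simp add: mr)
  qed (use coindD[OF f] in \<open>auto simp: M.minus_add simp del: coind_simps(1)\<close>)
  have act: "f \<triangleleft>\<^bsub>coind M\<^esub> b \<in> carrier (coind M)" if f: "f \<in> carrier (coind M)" and b: "b \<in> carrier A" for f b
    by (rule coindI) (use coindD[OF f] b in \<open>auto simp: A.r_distr A.m_assoc[symmetric] simp del: coind_simps(1)\<close>)
  have ext: "f = g" if "f \<in> carrier (coind M)" "g \<in> carrier (coind M)" "\<And>a. a \<in> carrier A \<Longrightarrow> f a = g a" for f g
    using that coindD(1) by (intro extensionalityI) auto
  have "abelian_group (coind M)"
  proof (rule abelian_groupI)
    fix f assume f: "f \<in> carrier (coind M)"
    show "\<exists>g\<in>carrier (coind M). g \<oplus>\<^bsub>coind M\<^esub> f = \<zero>\<^bsub>coind M\<^esub>"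
      by (rule bexI[OF _ neg[OF f]]) (use coindD(2)[OF f] in \<open>auto simp: M.l_neg intro!: restrict_ext\<close>)
    show "\<zero>\<^bsub>coind M\<^esub> \<oplus>\<^bsub>coind M\<^esub> f = f"
      by (rule ext[OF cl[OF z f] f]) (use coindD(2)[OF f] in auto)
    fix g assume g: "g \<in> carrier (coind M)"
    show "f \<oplus>\<^bsub>coind M\<^esub> g = g \<oplus>\<^bsub>coind M\<^esub> f"
      using coindD(2)[OF f] coindD(2)[OF g] by (auto simp: M.a_comm intro!: restrict_ext)
    fix h assume h: "h \<in> carrier (coind M)"
    show "f \<oplus>\<^bsub>coind M\<^esub> g \<oplus>\<^bsub>coind M\<^esub> h = f \<oplus>\<^bsub>coind M\<^esub> (g \<oplus>\<^bsub>coind M\<^esub> h)"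
      using coindD(2)[OF f] coindD(2)[OF g] coindD(2)[OF h] by (auto simp: M.a_assoc intro!: restrict_ext)
  qed (fact cl z)+
  then show ?thesis
  proof (intro right_module.intro right_module_axioms.intro A.ring_axioms)
    fix f a assume f: "f \<in> carrier (coind M)" and a: "a \<in> carrier A"
    show "f \<triangleleft>\<^bsub>coind M\<^esub> a \<in> carrier (coind M)" by (rule act[OF f a])
    show "(f \<oplus>\<^bsub>coind M\<^esub> g) \<triangleleft>\<^bsub>coind M\<^esub> a = (f \<triangleleft>\<^bsub>coind M\<^esub> a) \<oplus>\<^bsub>coind M\<^esub> (g \<triangleleft>\<^bsub>coind M\<^esub> a)" for g
      using a by (auto intro!: restrict_ext)
    show "f \<triangleleft>\<^bsub>coind M\<^esub> (a \<oplus>\<^bsub>A\<^esub> b) = (f \<triangleleft>\<^bsub>coind M\<^esub> a) \<oplus>\<^bsub>coind M\<^esub> (f \<triangleleft>\<^bsub>coind M\<^esub> b)" if "b \<in> carrier A" for b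
      using a that coindD(3)[OF f] by (auto simp: A.l_distr intro!: restrict_ext)
    show "f \<triangleleft>\<^bsub>coind M\<^esub> (a \<otimes>\<^bsub>A\<^esub> b) = (f \<triangleleft>\<^bsub>coind M\<^esub> a) \<triangleleft>\<^bsub>coind M\<^esub> b" if "b \<in> carrier A" for b
      using a that by (auto simp: A.m_assoc intro!: restrict_ext)
  next
    fix f assume f: "f \<in> carrier (coind M)"
    show "f \<triangleleft>\<^bsub>coind M\<^esub> \<one>\<^bsub>A\<^esub> = f"
      by (rule ext[OF act[OF f A.one_closed] f]) auto
  qed
qed

text \<open>A linear map out of A is determined by its values on the finite spanning set of
  idempotents and arrows. So \<open>coind M\<close> embeds as a vector space into a finite power of
  M, and a subspace of a finite-dimensional space is finite-dimensional by retraction.\<close>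

lemma fin_gen_coind:
  assumes "fin_gen A M"
  shows "fin_gen A (coind M)"
proof -
  let ?G = "ep ` verts Q \<union> ar ` arcs Q" and ?E = "coind M"
  let ?D = "dsum_family ?G (\<lambda>_. M)"
  interpret R: rsz_module Q A el "reg_module A" by (rule rsz_moduleI[OF A.right_module_reg])
  interpret E: rsz_module Q A el ?E by (rule rsz_moduleI[OF right_module_coind])
  interpret D: rsz_module Q A el ?D
    by (intro rsz_moduleI right_module_dsum_family A.ring_axioms right_module_axioms)
  have "generates A (reg_module A) {\<one>\<^bsub>A\<^esub>}"
  proof -
    have "a \<in> N" if "submod A (reg_module A) N" "\<one>\<^bsub>A\<^esub> \<in> N" "a \<in> carrier A" for a N
      using R.submodD(7)[OF that] that(3) by simp
    then show ?thesis using R.submodD(1) by (auto simp: generates_def)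
  qed
  from R.generates_Kr[OF this] have G: "generates Kr (reg_module A) ?G" by (simp add: UNION_singleton_eq_range)
  have res: "f \<in> rhom Kr (reg_module A) M" if "f \<in> carrier ?E" for f
    using coindD(2,3)[OF that] coindD(4)[OF that] by (auto intro!: rhomI simp: sc_def simp del: coind_simps)
  let ?h = "\<lambda>f. \<lambda>g\<in>?G. f g"
  have h: "?h \<in> rhom Kr ?E ?D"
  proof (rule rhomI)
    fix f assume f: "f \<in> carrier ?E"
    show "?h f \<in> carrier ?D" using coindD(2)[OF f] by (auto simp del: coind_simps(1))
    show "?h (f \<oplus>\<^bsub>?E\<^esub> g) = ?h f \<oplus>\<^bsub>?D\<^esub> ?h g" for g by (auto intro!: restrict_ext)
    fix k assume "k \<in> carrier Kr"
    then show "?h (f \<triangleleft>\<^bsub>?E\<^esub> k) = ?h f \<triangleleft>\<^bsub>?D\<^esub> k"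
      using coindD(4)[OF f] by (auto intro!: restrict_ext simp: sc_comm) (simp_all add: sc_def)
  qed
  have inj: "inj_on ?h (carrier ?E)"
  proof (rule inj_onI)
    fix f f' assume f: "f \<in> carrier ?E" and f': "f' \<in> carrier ?E" and eq: "?h f = ?h f'"
    have "f g = f' g" if "g \<in> ?G" for g using fun_cong[OF eq, of g] that by simp
    then have "f a = f' a" if "a \<in> carrier A" for a
      using rhom_eqI[OF R.right_module_Kr right_module_Kr res[OF f] res[OF f'] G] that by simp
    then show "f = f'" using coindD(1)[OF f] coindD(1)[OF f'] by (intro extensionalityI) auto
  qed
  let ?U = "?h ` carrier ?E"
  have U: "submod Kr ?D ?U"
    by (rule submod_image[OF E.right_module_Kr D.right_module_Kr h right_module.submod_carrier[OF E.right_module_Kr]])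
  have rU: "right_module Kr (?D\<lparr>carrier := ?U\<rparr>)"
    by (rule right_module.right_module_submod[OF D.right_module_Kr U])
  have "fin_gen A ?D" by (rule fin_gen_dsum_family) (use assms A.ring_axioms right_module_axioms in auto)
  then have D: "fin_gen Kr ?D" using D.fin_gen_Kr_iff by simp
  obtain p where p: "p \<in> rhom Kr ?D ?D" "p ` carrier ?D \<subseteq> ?U" "\<And>u. u \<in> ?U \<Longrightarrow> p u = u"
    using D.retract_Kr[OF U] by blast
  have "p ` carrier ?D = ?U"
  proof (intro equalityI p(2) subsetI)
    fix u assume u: "u \<in> ?U"
    then have "u \<in> carrier ?D" using right_module.submodD(3)[OF D.right_module_Kr U] by blast
    then show "u \<in> p ` carrier ?D" using p(3)[OF u] by (metis imageI)
  qed
  then have fU: "fin_gen Kr (?D\<lparr>carrier := ?U\<rparr>)"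
    using fin_gen_image[OF D.right_module_Kr rU rhom_restrict_codomain[OF p(1,2)]] D by simp
  have hU: "?h \<in> rhom Kr ?E (?D\<lparr>carrier := ?U\<rparr>)" by (rule rhom_restrict_codomain[OF h order_refl])
  have bU: "bij_betw ?h (carrier ?E) (carrier (?D\<lparr>carrier := ?U\<rparr>))" using inj by (simp add: bij_betw_def)
  note inv = rhom_inv[OF E.right_module_Kr hU bU]
  have "fin_gen Kr ?E"
    by (rule fin_gen_image[OF rU E.right_module_Kr inv(1) _ fU]) (use inv(2) in \<open>simp add: bij_betw_def\<close>)
  then show ?thesis using E.fin_gen_Kr_iff by simp
qed

text \<open>This is the unit of the adjunction between restriction to \<open>Br\<close> and
  coinduction.\<close>

definition coind_emb :: "'m \<Rightarrow> 'r \<Rightarrow> 'm" where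
  "coind_emb x = (\<lambda>a\<in>carrier A. x \<triangleleft>\<^bsub>M\<^esub> a)"

lemma rhom_coind_emb: "coind_emb \<in> rhom A M (coind M)"
proof (rule rhomI)
  show "coind_emb x \<in> carrier (coind M)" if "x \<in> carrier M" for x
    by (rule coindI) (use that in \<open>auto simp: coind_emb_def ract_r_distr ract_assoc\<close>)
qed (auto simp: coind_emb_def ract_l_distr ract_assoc intro!: restrict_ext)

lemma inj_coind_emb: "inj_on coind_emb (carrier M)"
proof (rule inj_onI)
  fix x y assume xy: "x \<in> carrier M" "y \<in> carrier M" and eq: "coind_emb x = coind_emb y"
  from eq have "coind_emb x \<one>\<^bsub>A\<^esub> = coind_emb y \<one>\<^bsub>A\<^esub>" by simp
  then show "x = y" using xy by (simp add: coind_emb_def)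
qed

lemma semisimple_ract_el: "semisimple M \<Longrightarrow> x \<in> carrier M \<Longrightarrow> x \<triangleleft>\<^bsub>M\<^esub> el c d = x \<triangleleft>\<^bsub>M\<^esub> el c (\<lambda>_. 0)"
  using el_in_rad[of x d] by (subst el_split) (simp add: ract_r_distr semisimple_rad)

text \<open>For f in L, the product of f with an arrow e is the embedded element f(e), since M is
  semisimple. It lies in both submodules, so f(e) = 0. Hence f vanishes on the radical of A and is
  itself the embedded element f(1), which must be zero as well.\<close>

lemma coind_essential:
  assumes ss: "semisimple M" and L: "submod A (coind M) L" and int: "coind_emb ` carrier M \<inter> L \<subseteq> {\<zero>\<^bsub>coind M\<^esub>}"
    and f: "f \<in> L"
  shows "f = \<zero>\<^bsub>coind M\<^esub>"
proof -
  interpret R: rsz_module Q A el "reg_module A" by (rule rsz_moduleI[OF A.right_module_reg])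
  interpret E: right_module A "coind M" by (rule right_module_coind)
  have fE: "f \<in> carrier (coind M)" by (rule E.submodD(3)[OF L f])
  note f' = coindD[OF fE]
  have far: "f (ar e) = \<zero>\<^bsub>M\<^esub>" for e
  proof -
    have "f \<triangleleft>\<^bsub>coind M\<^esub> ar e = coind_emb (f (ar e))"
      unfolding coind_simps coind_emb_def
    proof (rule restrict_ext)
      fix a assume "a \<in> carrier A"
      then obtain c d where a: "a = el c d" using el_surj by blast
      have "ar e \<otimes>\<^bsub>A\<^esub> a = ar e \<otimes>\<^bsub>A\<^esub> el c (\<lambda>_. 0)" by (simp add: a ar_el)
      then have "f (ar e \<otimes>\<^bsub>A\<^esub> a) = f (ar e) \<triangleleft>\<^bsub>M\<^esub> el c (\<lambda>_. 0)"
        using f'(4)[OF basis_closed(2)[of e], of c] by simp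
      also have "\<dots> = f (ar e) \<triangleleft>\<^bsub>M\<^esub> a"
        unfolding a by (rule semisimple_ract_el[OF ss, symmetric]) (rule f'(2)[OF basis_closed(2)])
      finally show "f (ar e \<otimes>\<^bsub>A\<^esub> a) = f (ar e) \<triangleleft>\<^bsub>M\<^esub> a" .
    qed
    moreover have "f \<triangleleft>\<^bsub>coind M\<^esub> ar e \<in> L" by (rule E.submodD(7)[OF L f basis_closed(2)])
    ultimately have "coind_emb (f (ar e)) \<in> coind_emb ` carrier M \<inter> L"
      using imageI[OF f'(2)[OF basis_closed(2)[of e]], of coind_emb] by simp
    from subsetD[OF int this] have "coind_emb (f (ar e)) = \<zero>\<^bsub>coind M\<^esub>" by (rule singletonD)
    then have "coind_emb (f (ar e)) \<one>\<^bsub>A\<^esub> = \<zero>\<^bsub>coind M\<^esub> \<one>\<^bsub>A\<^esub>" by simp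
    then show ?thesis using f'(2)[OF basis_closed(2)[of e]] by (simp add: coind_emb_def)
  qed
  have fr: "f \<in> rhom Br (reg_module A) M" using fE by simp
  have fel: "f (el (\<lambda>_. 0) d) = \<zero>\<^bsub>M\<^esub>" for d
  proof -
    have "f (el (\<lambda>_. 0) d) = (\<Oplus>\<^bsub>M\<^esub>e\<in>arcs Q. f (sc (d e) \<otimes>\<^bsub>A\<^esub> ar e))"
      unfolding el_decomp_arcs by (rule rhom_finsum[OF R.right_module_Br right_module_Br fr]) auto
    also have "\<dots> = (\<Oplus>\<^bsub>M\<^esub>e\<in>arcs Q. \<zero>\<^bsub>M\<^esub>)"
    proof (rule M.finsum_cong')
      fix e
      have "f (sc (d e) \<otimes>\<^bsub>A\<^esub> ar e) = f (ar e) \<triangleleft>\<^bsub>M\<^esub> sc (d e)"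
        using f'(4)[OF basis_closed(2)[of e], of "\<lambda>_. d e"] by (simp add: sc_comm sc_def[symmetric])
      then show "f (sc (d e) \<otimes>\<^bsub>A\<^esub> ar e) = \<zero>\<^bsub>M\<^esub>" by (simp add: far ract_zero_left)
    qed auto
    finally show ?thesis by simp
  qed
  have f1: "f \<one>\<^bsub>A\<^esub> \<in> carrier M" by (rule f'(2)) simp
  have "f = coind_emb (f \<one>\<^bsub>A\<^esub>)"
  proof (rule extensionalityI[OF f'(1)])
    show "coind_emb (f \<one>\<^bsub>A\<^esub>) \<in> extensional (carrier A)" by (simp add: coind_emb_def)
    fix a assume "a \<in> carrier A"
    then obtain c d where a: "a = el c d" using el_surj by blast
    have "f a = f (el c (\<lambda>_. 0)) \<oplus>\<^bsub>M\<^esub> f (el (\<lambda>_. 0) d)"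
      unfolding a el_split[of c d] by (rule f'(3)) auto
    also have "\<dots> = f (\<one>\<^bsub>A\<^esub> \<otimes>\<^bsub>A\<^esub> el c (\<lambda>_. 0))" using f'(2)[of "el c (\<lambda>_. 0)"] by (simp add: fel)
    also have "\<dots> = f \<one>\<^bsub>A\<^esub> \<triangleleft>\<^bsub>M\<^esub> el c (\<lambda>_. 0)" by (rule f'(4)) simp
    also have "\<dots> = f \<one>\<^bsub>A\<^esub> \<triangleleft>\<^bsub>M\<^esub> el c d" by (rule semisimple_ract_el[OF ss f1, symmetric])
    finally show "f a = coind_emb (f \<one>\<^bsub>A\<^esub>) a" by (simp add: coind_emb_def a)
  qed
  then have "f \<in> coind_emb ` carrier M \<inter> L" using f imageI[OF f1, of coind_emb] by simp
  from subsetD[OF int this] show ?thesis by (rule singletonD)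
qed

text \<open>Coinduction is right adjoint to restriction. Evaluating at 1 turns f into a
  \<open>Br\<close>-linear map from N to M; this extends to N' because the image of N is a
  \<open>Br\<close>-direct summand, and the extension is transposed back.\<close>

lemma coind_extend:
  fixes N :: "('r, 'n) rmodule" and N' :: "('r, 'l) rmodule"
  assumes N: "right_module A N" and N': "right_module A N'"
    and g: "g \<in> rhom A N N'" "inj_on g (carrier N)" and f: "f \<in> rhom A N (coind M)"
  shows "\<exists>h \<in> rhom A N' (coind M). \<forall>x\<in>carrier N. h (g x) = f x"
proof -
  interpret N: rsz_module Q A el N by (rule rsz_moduleI[OF N])
  interpret N': rsz_module Q A el N' by (rule rsz_moduleI[OF N'])
  note g' = rhomD[OF g(1)] and f' = rhomD[OF f]
  have fc: "f n \<in> carrier (coind M)" if "n \<in> carrier N" for n using f'(1)[OF that] .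
  have f0: "(\<lambda>n. f n \<one>\<^bsub>A\<^esub>) \<in> rhom Br N M"
  proof (rule rhomI)
    fix n b assume n: "n \<in> carrier N" and "b \<in> carrier Br"
    then obtain c where b: "b = el c (\<lambda>_. 0)" by auto
    have "f (n \<triangleleft>\<^bsub>N\<^esub> b) \<one>\<^bsub>A\<^esub> = (f n \<triangleleft>\<^bsub>coind M\<^esub> b) \<one>\<^bsub>A\<^esub>" using f'(3)[OF n] b by simp
    also have "\<dots> = f n (\<one>\<^bsub>A\<^esub> \<otimes>\<^bsub>A\<^esub> b)" using b by simp
    also have "\<dots> = f n \<one>\<^bsub>A\<^esub> \<triangleleft>\<^bsub>M\<^esub> b" unfolding b by (rule coindD(4)[OF fc[OF n]]) simp
    finally show "f (n \<triangleleft>\<^bsub>N\<^esub> b) \<one>\<^bsub>A\<^esub> = f n \<one>\<^bsub>A\<^esub> \<triangleleft>\<^bsub>M\<^esub> b" .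
  qed (use coindD(2)[OF fc] f'(2) in auto)
  have gB: "g \<in> rhom Br N N'" using g' by (intro rhomI) auto
  let ?U = "g ` carrier N"
  have U: "submod Br N' ?U"
    by (rule submod_image[OF N.right_module_Br N'.right_module_Br gB right_module.submod_carrier[OF N.right_module_Br]])
  obtain p where p: "p \<in> rhom Br N' N'" "p ` carrier N' \<subseteq> ?U" "\<And>u. u \<in> ?U \<Longrightarrow> p u = u"
    using N'.retract_Br[OF U] by blast
  have "bij_betw g (carrier N) (carrier (N'\<lparr>carrier := ?U\<rparr>))" using g(2) by (simp add: bij_betw_def)
  from rhom_inv(1)[OF N.right_module_Br rhom_restrict_codomain[OF gB order_refl] this]
  have gi: "inv_into (carrier N) g \<in> rhom Br (N'\<lparr>carrier := ?U\<rparr>) N" .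
  define F where "F x = f (inv_into (carrier N) g (p x)) \<one>\<^bsub>A\<^esub>" for x
  have F: "F \<in> rhom Br N' M" unfolding F_def
    by (rule rhom_comp[OF rhom_comp[OF rhom_restrict_codomain[OF p(1,2)] gi] f0])
  note F' = rhomD[OF F]
  have Fg: "F (g n) = f n \<one>\<^bsub>A\<^esub>" if "n \<in> carrier N" for n
    unfolding F_def using p(3)[of "g n"] g(2) that by simp
  let ?h = "\<lambda>n. \<lambda>a\<in>carrier A. F (n \<triangleleft>\<^bsub>N'\<^esub> a)"
  have h: "?h \<in> rhom A N' (coind M)"
  proof (rule rhomI)
    fix n assume n: "n \<in> carrier N'"
    show "?h n \<in> carrier (coind M)"
      by (rule coindI) (use F' n in \<open>auto simp: N'.ract_r_distr N'.ract_assoc\<close>)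
    show "?h (n \<oplus>\<^bsub>N'\<^esub> n') = ?h n \<oplus>\<^bsub>coind M\<^esub> ?h n'" if "n' \<in> carrier N'" for n'
      using F'(2) n that by (auto simp: N'.ract_l_distr intro!: restrict_ext)
    show "?h (n \<triangleleft>\<^bsub>N'\<^esub> b) = ?h n \<triangleleft>\<^bsub>coind M\<^esub> b" if "b \<in> carrier A" for b
      using n that by (auto simp: N'.ract_assoc intro!: restrict_ext)
  qed
  have "?h (g n) = f n" if n: "n \<in> carrier N" for n
  proof (rule extensionalityI[OF _ coindD(1)[OF fc[OF n]]])
    fix a assume a: "a \<in> carrier A"
    have "?h (g n) a = F (g (n \<triangleleft>\<^bsub>N\<^esub> a))" using a n g'(3) by simp
    also have "\<dots> = f (n \<triangleleft>\<^bsub>N\<^esub> a) \<one>\<^bsub>A\<^esub>" using n a by (intro Fg) simp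
    also have "\<dots> = f n a" using f'(3)[OF n a] a by simp
    finally show "?h (g n) a = f n a" .
  qed auto
  then show ?thesis by (intro bexI[OF _ h] ballI)
qed

end

section \<open>Cosyzygies of semisimple modules\<close>

context rsz_ring
begin

text \<open>For semisimple M the coinduced module is an injective envelope. This reaches all
  iterated cosyzygies of \<open>A0\<close>, since cosyzygies are semisimple again.\<close>

lemma cosyzygy_exists:
  assumes "M \<in> fgmod A" "semisimple M"
  shows "is_cosyzygy A M (cosyzygy A M)"
proof -
  have M: "right_module A M" "fin_gen A M" using assms by (auto simp: fgmod_def)
  interpret M: rsz_module Q A el M by (rule rsz_moduleI[OF M(1)])
  let ?E = "coind M"
  interpret E: right_module A ?E by (rule M.right_module_coind)
  obtain I t t' where I: "I \<in> fgmod A" "iso_pair A ?E I t t'"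
    by (rule E.iso_pair_exists[OF M.fin_gen_coind[OF M(2)]])
  have t: "t \<in> rhom A ?E I" "t' \<in> rhom A I ?E" "\<And>f. f \<in> carrier ?E \<Longrightarrow> t' (t f) = f" "\<And>x. x \<in> carrier I \<Longrightarrow> t (t' x) = x"
    using I(2) unfolding iso_pair_def by blast+
  have rI: "right_module A I" "fin_gen A I" using I(1) by (auto simp: fgmod_def)
  interpret I: right_module A I by (rule rI(1))
  have inj: "injective A I" unfolding injective_def
  proof (intro conjI ballI impI I(1))
    fix N N' g f assume N: "N \<in> fgmod A" "N' \<in> fgmod A" and g: "g \<in> rhom A N N'" "inj_on g (carrier N)" and f: "f \<in> rhom A N I"
    have "\<exists>h \<in> rhom A N' ?E. \<forall>x\<in>carrier N. h (g x) = t' (f x)"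
      by (rule M.coind_extend[OF _ _ g rhom_comp[OF f t(2)]]) (use N in \<open>auto simp: fgmod_def\<close>)
    then obtain h where h: "h \<in> rhom A N' ?E" "\<And>x. x \<in> carrier N \<Longrightarrow> h (g x) = t' (f x)" by blast
    show "\<exists>h\<in>rhom A N' I. \<forall>x\<in>carrier N. h (g x) = f x"
      by (rule bexI[OF _ rhom_comp[OF h(1) t(1)]]) (use h(2) t(4) rhomD(1)[OF f] in simp)
  qed
  let ?f = "\<lambda>x. t (M.coind_emb x)"
  have f: "?f \<in> rhom A M I" by (rule rhom_comp[OF M.rhom_coind_emb t(1)])
  note em = rhomD(1)[OF M.rhom_coind_emb]
  have finj: "inj_on ?f (carrier M)"
  proof (rule inj_onI)
    fix x y assume xy: "x \<in> carrier M" "y \<in> carrier M" "?f x = ?f y"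
    then have "M.coind_emb x = M.coind_emb y" using t(3)[OF em] by metis
    then show "x = y" using M.inj_coind_emb xy by (auto dest: inj_onD)
  qed
  have K: "submod A I (?f ` carrier M)" by (rule submod_image[OF M(1) rI(1) f M.submod_carrier])
  have ess: "essential A I (?f ` carrier M)" unfolding essential_def
  proof (intro conjI allI impI K)
    fix L assume "submod A I L \<and> ?f ` carrier M \<inter> L = {\<zero>\<^bsub>I\<^esub>}"
    then have L: "submod A I L" and int: "?f ` carrier M \<inter> L = {\<zero>\<^bsub>I\<^esub>}" by auto
    have L': "submod A ?E (t' ` L)" by (rule submod_image[OF rI(1) E.right_module_axioms t(2) L])
    have int': "M.coind_emb ` carrier M \<inter> t' ` L \<subseteq> {\<zero>\<^bsub>?E\<^esub>}"
    proof
      fix e assume "e \<in> M.coind_emb ` carrier M \<inter> t' ` L"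
      then obtain x l where e: "x \<in> carrier M" "e = M.coind_emb x" "l \<in> L" "e = t' l" by blast
      have "t e = l" using e(3,4) t(4) I.submodD(3)[OF L] by simp
      then have "l \<in> ?f ` carrier M \<inter> L" using e by blast
      then have "l = \<zero>\<^bsub>I\<^esub>" using int by blast
      then show "e \<in> {\<zero>\<^bsub>?E\<^esub>}" using e(4) rhom_zero[OF rI(1) E.right_module_axioms t(2)] by simp
    qed
    have "l = \<zero>\<^bsub>I\<^esub>" if "l \<in> L" for l
    proof -
      have "t' l = \<zero>\<^bsub>?E\<^esub>" by (rule M.coind_essential[OF assms(2) L' int']) (use that in blast)
      then show ?thesis using t(4)[OF I.submodD(3)[OF L that]] rhom_zero[OF E.right_module_axioms rI(1) t(1)] by simp
    qed
    then show "L = {\<zero>\<^bsub>I\<^esub>}" using I.submodD(2)[OF L] by blast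
  qed
  obtain N g where N: "N \<in> fgmod A" "g \<in> rhom A I N" "g ` carrier I = carrier N" "a_kernel I N g = ?f ` carrier M"
    by (rule I.quotient_copy[OF K rI(2)])
  have "is_cosyzygy A M N" unfolding is_cosyzygy_def short_exact_def
    using inj N f finj ess by (intro conjI exI[of _ I] exI[of _ ?f] exI[of _ g]) auto
  then show ?thesis unfolding cosyzygy_def by (rule someI)
qed

end

text \<open>The line spanned by z is a submodule without proper nonzero submodules. An essential K
  either contains it, or meets it in zero and forces z = 0; in both cases z lies in K.\<close>

lemma (in rsz_module) socle_essential:
  assumes "essential A M K" "z \<in> carrier M" "z \<triangleleft>\<^bsub>M\<^esub> ep j = z" "\<And>e. e \<in> arcs Q \<Longrightarrow> z \<triangleleft>\<^bsub>M\<^esub> ar e = \<zero>\<^bsub>M\<^esub>"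
  shows "z \<in> K"
proof (rule ccontr)
  assume n: "z \<notin> K"
  have K: "submod A M K" and ess: "\<And>L. submod A M L \<Longrightarrow> K \<inter> L = {\<zero>\<^bsub>M\<^esub>} \<Longrightarrow> L = {\<zero>\<^bsub>M\<^esub>}"
    using assms(1) unfolding essential_def by auto
  note K' = submodD[OF K]
  \<comment> \<open>Every ring element acts on z through its coefficient at the idempotent of j, so
    the multiples of z by scalars are stable under A.\<close>
  have zel: "z \<triangleleft>\<^bsub>M\<^esub> el c d = z \<triangleleft>\<^bsub>M\<^esub> sc (c j)" for c d
  proof -
    have "z \<triangleleft>\<^bsub>M\<^esub> el (\<lambda>_. 0) d = (\<Oplus>\<^bsub>M\<^esub>e\<in>arcs Q. \<zero>\<^bsub>M\<^esub>)"
      unfolding ract_decomp_arcs[OF assms(2)]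
    proof (rule M.finsum_cong')
      fix e assume "e \<in> arcs Q"
      then show "(z \<triangleleft>\<^bsub>M\<^esub> sc (d e)) \<triangleleft>\<^bsub>M\<^esub> ar e = \<zero>\<^bsub>M\<^esub>"
        using assms(2) assms(4)[of e] by (simp add: ract_assoc[symmetric] sc_comm) (simp add: ract_assoc ract_zero_left)
    qed auto
    moreover have "z \<triangleleft>\<^bsub>M\<^esub> el c (\<lambda>_. 0) = z \<triangleleft>\<^bsub>M\<^esub> (ep j \<otimes>\<^bsub>A\<^esub> el c (\<lambda>_. 0))"
      using assms(2,3) by (simp add: ract_assoc)
    moreover have "z \<triangleleft>\<^bsub>M\<^esub> (ep j \<otimes>\<^bsub>A\<^esub> el c (\<lambda>_. 0)) = z \<triangleleft>\<^bsub>M\<^esub> sc (c j)"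
      using assms(2,3) by (simp add: ep_el sc_comm ract_assoc)
    ultimately show ?thesis unfolding el_split[of c d] using assms(2) by (simp add: ract_r_distr)
  qed
  let ?L = "range (\<lambda>k. z \<triangleleft>\<^bsub>M\<^esub> sc k)"
  have z0: "z \<triangleleft>\<^bsub>M\<^esub> sc 0 = \<zero>\<^bsub>M\<^esub>" using assms(2) by (simp add: sc_def el_zero[symmetric] ract_zero_right)
  have L: "submod A M ?L"
  proof (rule submodI)
    show "\<zero>\<^bsub>M\<^esub> \<in> ?L" using z0 by (metis rangeI)
    show "x \<oplus>\<^bsub>M\<^esub> y \<in> ?L" if xy: "x \<in> ?L" "y \<in> ?L" for x y
    proof -
      obtain k l where "x = z \<triangleleft>\<^bsub>M\<^esub> sc k" "y = z \<triangleleft>\<^bsub>M\<^esub> sc l" using xy by auto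
      then have "x \<oplus>\<^bsub>M\<^esub> y = z \<triangleleft>\<^bsub>M\<^esub> sc (k + l)"
        using assms(2) by (simp add: ract_r_distr[symmetric]) (simp add: sc_def el_add)
      then show ?thesis by blast
    qed
    show "x \<triangleleft>\<^bsub>M\<^esub> a \<in> ?L" if x: "x \<in> ?L" and a: "a \<in> carrier A" for x a
    proof -
      obtain k where k: "x = z \<triangleleft>\<^bsub>M\<^esub> sc k" using x by auto
      obtain c d where cd: "sc k \<otimes>\<^bsub>A\<^esub> a = el c d" using el_surj[of "sc k \<otimes>\<^bsub>A\<^esub> a"] a by auto
      have "x \<triangleleft>\<^bsub>M\<^esub> a = z \<triangleleft>\<^bsub>M\<^esub> sc (c j)" using k assms(2) a by (simp add: ract_assoc[symmetric] cd zel)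
      then show ?thesis by blast
    qed
  qed (use assms(2) in auto)
  have "x = \<zero>\<^bsub>M\<^esub>" if x: "x \<in> K" "x \<in> ?L" for x
  proof (rule ccontr)
    assume x0: "x \<noteq> \<zero>\<^bsub>M\<^esub>"
    obtain k where k: "x = z \<triangleleft>\<^bsub>M\<^esub> sc k" using x(2) by auto
    then have "k \<noteq> 0" using x0 z0 by auto
    then have "x \<triangleleft>\<^bsub>M\<^esub> sc (1 / k) = z" using k assms(2) by (simp add: ract_assoc[symmetric] sc_sc sc_one)
    then have "z \<in> K" using K'(7)[OF x(1) basis_closed(3)[of "1 / k"]] by simp
    with n show False ..
  qed
  then have "K \<inter> ?L = {\<zero>\<^bsub>M\<^esub>}" using K'(2) submodD(2)[OF L] by blast
  from ess[OF L this] have "z \<triangleleft>\<^bsub>M\<^esub> sc 1 = \<zero>\<^bsub>M\<^esub>" by blast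
  then have "z = \<zero>\<^bsub>M\<^esub>" using assms(2) by (simp add: sc_one)
  then show False using n K'(2) by simp
qed

context rsz_ring
begin

text \<open>Essentiality puts every homogeneous element of I killed by all arrows into the image of
  M, which is the kernel of g. Products with arrows are such elements, so N is semisimple. An
  element of I at j that survives in N is not killed by all arrows; some arrow e moves it to a
  nonzero element of M at the head of e, and the tail of e is then j.\<close>

lemma is_cosyzygy_support:
  assumes "is_cosyzygy A M N" "right_module A M"
  shows "semisimple N" and "j \<in> support N \<Longrightarrow> \<exists>e\<in>arcs Q. tail Q e = j \<and> head Q e \<in> support M"
proof -
  obtain I f g where *: "injective A I" "short_exact A M f I g N" "essential A I (f ` carrier M)" and N: "N \<in> fgmod A"
    using assms(1) unfolding is_cosyzygy_def by blast
  then have rI: "right_module A I" and rN: "right_module A N" by (auto simp: injective_def fgmod_def)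
  have f: "f \<in> rhom A M I" "inj_on f (carrier M)" and g: "g \<in> rhom A I N" "g ` carrier I = carrier N"
    and ex: "f ` carrier M = a_kernel I N g" using *(2) by (auto simp: short_exact_def)
  interpret I: rsz_module Q A el I by (rule rsz_moduleI[OF rI])
  interpret N: right_module A N by (rule rN)
  interpret M: right_module A M by (rule assms(2))
  have soc: "z \<in> f ` carrier M" if "z \<in> carrier I" "z \<triangleleft>\<^bsub>I\<^esub> ep i = z" "\<And>e. e \<in> arcs Q \<Longrightarrow> z \<triangleleft>\<^bsub>I\<^esub> ar e = \<zero>\<^bsub>I\<^esub>" for z i
    by (rule I.socle_essential[OF *(3) that])
  have xa: "x \<triangleleft>\<^bsub>I\<^esub> ar e \<in> f ` carrier M" if "x \<in> carrier I" "e \<in> arcs Q" for x e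
    by (rule soc[of _ "head Q e"]) (use that in \<open>auto simp: I.ract_assoc[symmetric] ar_ep ar_ar I.ract_zero_right\<close>)
  show "semisimple N" unfolding semisimple_def
  proof (intro ballI)
    fix y e assume "y \<in> carrier N" and e: "e \<in> arcs Q"
    then obtain x where x: "x \<in> carrier I" "y = g x" using g(2) by auto
    have "g (x \<triangleleft>\<^bsub>I\<^esub> ar e) = \<zero>\<^bsub>N\<^esub>" using xa[OF x(1) e] unfolding ex a_kernel_def' by blast
    then show "y \<triangleleft>\<^bsub>N\<^esub> ar e = \<zero>\<^bsub>N\<^esub>" using rhomD(3)[OF g(1) x(1) basis_closed(2)[of e]] x(2) by simp
  qed
  assume "j \<in> support N"
  then obtain y where y: "y \<in> carrier N" "y \<triangleleft>\<^bsub>N\<^esub> ep j \<noteq> \<zero>\<^bsub>N\<^esub>" by (auto simp: support_def)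
  then obtain x where x: "x \<in> carrier I" "y = g x" using g(2) by auto
  let ?x = "x \<triangleleft>\<^bsub>I\<^esub> ep j"
  have "g ?x \<noteq> \<zero>\<^bsub>N\<^esub>" using rhomD(3)[OF g(1) x(1) basis_closed(1)[of j]] x(2) y(2) by simp
  then have "?x \<notin> f ` carrier M" unfolding ex a_kernel_def' by blast
  then obtain e where e: "e \<in> arcs Q" "?x \<triangleleft>\<^bsub>I\<^esub> ar e \<noteq> \<zero>\<^bsub>I\<^esub>"
    using soc[of ?x j] x(1) by (auto simp: I.ract_assoc[symmetric] ep_ep)
  have t: "tail Q e = j" using e x(1) by (auto simp: I.ract_assoc[symmetric] ep_ar I.ract_zero_right split: if_splits)
  obtain w where w: "w \<in> carrier M" "?x \<triangleleft>\<^bsub>I\<^esub> ar e = f w" using xa[of ?x e] x(1) e(1) by auto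
  have "f (w \<triangleleft>\<^bsub>M\<^esub> ep (head Q e)) = ?x \<triangleleft>\<^bsub>I\<^esub> ar e"
    using rhomD(3)[OF f(1) w(1) basis_closed(1)[of "head Q e"]] w(2)[symmetric] x(1) e(1)
    by (simp add: I.ract_assoc[symmetric] ar_ep A.m_assoc)
  then have "w \<triangleleft>\<^bsub>M\<^esub> ep (head Q e) \<noteq> \<zero>\<^bsub>M\<^esub>" using e(2) rhom_zero[OF assms(2) rI f(1)] by metis
  then show "\<exists>e\<in>arcs Q. tail Q e = j \<and> head Q e \<in> support M"
    using e(1) t w(1) by (intro bexI[of _ e]) (auto simp: support_def)
qed

text \<open>Each cosyzygy puts one arrow in front of a walk that starts in the support of the
  previous module. This is how long walks arise at the vertices of the heart.\<close>

lemma cosyzygy_iterate: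
  assumes "M \<in> fgmod A" "semisimple M"
  shows "(cosyzygy A ^^ k) M \<in> fgmod A \<and> semisimple ((cosyzygy A ^^ k) M) \<and>
    (\<forall>j\<in>support ((cosyzygy A ^^ k) M). has_walk Q k j)"
proof (induction k)
  case 0 then show ?case using assms by (auto simp: support_def)
next
  case (Suc k)
  let ?N = "(cosyzygy A ^^ k) M"
  have c: "is_cosyzygy A ?N (cosyzygy A ?N)" using Suc by (intro cosyzygy_exists) auto
  have r: "right_module A ?N" using Suc by (simp add: fgmod_def)
  have "cosyzygy A ?N \<in> fgmod A" using c by (simp add: is_cosyzygy_def)
  moreover have "has_walk Q (Suc k) j" if "j \<in> support (cosyzygy A ?N)" for j
    using is_cosyzygy_support(2)[OF c r that] Suc by auto
  ultimately show ?case using is_cosyzygy_support(1)[OF c r] by simp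
qed

end

section \<open>Projective dimension and walks\<close>

lemma pd_leI: "proj_resolution R M n P d \<Longrightarrow> pd R M \<le> enat n"
  unfolding pd_def by (intro INF_lower) blast

text \<open>The infimum of the empty set is \<infinity>, so a finite value means that some
  resolution exists, and the infimum is then attained by one.\<close>

lemma pd_finiteE:
  assumes "pd R M < \<infinity>"
  obtains n P d where "proj_resolution R M n P d" "pd R M = enat n"
proof -
  let ?S = "enat ` {n. \<exists>P d. proj_resolution R M n P d}"
  have ne: "?S \<noteq> {}"
  proof
    assume e: "?S = {}"
    have "pd R M = \<infinity>" unfolding pd_def e Inf_enat_def by simp
    then show False using assms by simp
  qed
  have "Inf ?S = (LEAST x. x \<in> ?S)" using ne by (simp only: Inf_enat_def if_False)
  moreover obtain s where "s \<in> ?S" using ne by blast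
  ultimately have "Inf ?S \<in> ?S" using LeastI[of "\<lambda>x. x \<in> ?S" s] by (simp only:)
  then obtain n where "Inf ?S = enat n" "n \<in> {n. \<exists>P d. proj_resolution R M n P d}" by blast
  then show ?thesis using that unfolding pd_def by blast
qed

text \<open>Indices shift by one. The old augmentation ends in N, so it is composed with f to become
  a map into P; injectivity of f keeps its kernel, and with it exactness one step further
  on.\<close>

lemma proj_resolution_splice:
  assumes P: "projective R P" and f: "f \<in> rhom R N P" "inj_on f (carrier N)" "f ` carrier N = a_kernel P M g"
    and g: "g \<in> rhom R P M" "g ` carrier P = carrier M"
    and mod: "right_module R N" "right_module R P"
    and res: "proj_resolution R N n P' d"
  shows "proj_resolution R M (Suc n) (case_nat P P') (\<lambda>i. case i of 0 \<Rightarrow> g | Suc 0 \<Rightarrow> (\<lambda>x. f (d 0 x)) | Suc (Suc k) \<Rightarrow> d (Suc k))"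
    (is "proj_resolution R M _ ?P ?d")
proof -
  have r: "\<And>i. i \<le> n \<Longrightarrow> projective R (P' i)" "d 0 \<in> rhom R (P' 0) N" "d 0 ` carrier (P' 0) = carrier N"
    "\<And>i. i < n \<Longrightarrow> d (Suc i) \<in> rhom R (P' (Suc i)) (P' i)"
    "\<And>i. i < n \<Longrightarrow> d (Suc i) ` carrier (P' (Suc i)) = a_kernel (P' i) (case i of 0 \<Rightarrow> N | Suc j \<Rightarrow> P' j) (d i)"
    "inj_on (d n) (carrier (P' n))"
    using res unfolding proj_resolution_def by auto
  have f0: "f x = \<zero>\<^bsub>P\<^esub> \<longleftrightarrow> x = \<zero>\<^bsub>N\<^esub>" if "x \<in> carrier N" for x
  proof -
    interpret N: right_module R N by (rule mod(1))
    show ?thesis using f(2) that rhom_zero[OF mod f(1)] by (metis N.M.zero_closed inj_on_eq_iff)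
  qed
  have d0: "d 0 x \<in> carrier N" if "x \<in> carrier (P' 0)" for x using rhomD(1)[OF r(2) that] .
  show ?thesis unfolding proj_resolution_def
  proof (intro conjI allI impI)
    fix i
    show "projective R (?P i)" if "i \<le> Suc n" using that P r(1) by (cases i) auto
    show "?d (Suc i) \<in> rhom R (?P (Suc i)) (?P i)" if "i < Suc n"
      using that r(4) rhom_comp[OF r(2) f(1)] by (cases i) auto
    show "?d (Suc i) ` carrier (?P (Suc i)) = a_kernel (?P i) (case i of 0 \<Rightarrow> M | Suc j \<Rightarrow> ?P j) (?d i)" if "i < Suc n"
    proof (cases i)
      case 0
      have "(\<lambda>x. f (d 0 x)) ` carrier (P' 0) = f ` carrier N" unfolding r(3)[symmetric] by auto
      then show ?thesis using 0 f(3) by simp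
    next
      case (Suc k)
      show ?thesis
      proof (cases k)
        case 0
        then show ?thesis using Suc that r(5)[of 0] f0[OF d0] by (auto simp: a_kernel_def')
      next
        case (Suc l)
        then show ?thesis using \<open>i = Suc k\<close> that r(5)[of k] by simp
      qed
    qed
  next
    show "inj_on (?d (Suc n)) (carrier (?P (Suc n)))"
    proof (cases n)
      case 0
      then have "inj_on (d 0) (carrier (P' 0))" using r(6) by simp
      then have "inj_on (\<lambda>x. f (d 0 x)) (carrier (P' 0))" using f(2) d0 by (auto simp: inj_on_def)
      then show ?thesis using 0 by simp
    qed (use r(6) in auto)
  qed (use g in auto)
qed

lemma (in rsz_ring) pd_syzygy:
  assumes "is_syzygy A M N" "pd A N \<le> enat k"
  shows "pd A M \<le> enat (Suc k)"
proof -
  have "pd A N < \<infinity>" using assms(2) by (metis enat_ord_simps(4) infinity_ileE not_le linorder_neq_iff enat_ord_simps(6))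
  then obtain n P' d where r: "proj_resolution A N n P' d" "pd A N = enat n" by (rule pd_finiteE)
  obtain P f g where "projective A P" "right_module A P" "right_module A N" "f \<in> rhom A N P" "g \<in> rhom A P M"
    "inj_on f (carrier N)" "f ` carrier N = a_kernel P M g" "g ` carrier P = carrier M"
    using assms(1) by (rule is_syzygyE)
  then have "pd A M \<le> enat (Suc n)" using r(1) by (intro pd_leI[OF proj_resolution_splice]) auto
  then show ?thesis using r(2) assms(2) by (metis enat_ord_simps(1) order_trans Suc_le_mono)
qed

text \<open>A zero syzygy makes the cover injective, so the cover alone is a resolution of length
  0.\<close>

lemma (in rsz_ring) pd_zero:
  assumes "is_syzygy A M N" "carrier N = {\<zero>\<^bsub>N\<^esub>}" "right_module A M"
  shows "pd A M \<le> enat 0"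
proof -
  obtain P f g where *: "projective A P" "right_module A P" "right_module A N" "f \<in> rhom A N P" "g \<in> rhom A P M"
    "f ` carrier N = a_kernel P M g" "g ` carrier P = carrier M"
    using assms(1) by (rule is_syzygyE)
  interpret P: right_module A P by (rule *(2))
  interpret M: right_module A M by (rule assms(3))
  have k: "a_kernel P M g = {\<zero>\<^bsub>P\<^esub>}" using *(6) assms(2) rhom_zero[OF *(3,2,4)] by simp
  have "inj_on g (carrier P)"
  proof (rule inj_onI)
    fix x y assume xy: "x \<in> carrier P" "y \<in> carrier P" "g x = g y"
    have "g (x \<ominus>\<^bsub>P\<^esub> y) = g x \<ominus>\<^bsub>M\<^esub> g y"
      using xy rhom_minus[OF *(2) assms(3) *(5)] rhomD(2)[OF *(5)] by (simp add: P.M.minus_eq M.M.minus_eq)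
    then have "g (x \<ominus>\<^bsub>P\<^esub> y) = \<zero>\<^bsub>M\<^esub>" using xy rhomD(1)[OF *(5)] by (simp add: M.minus_eq_zero_iff)
    then have "x \<ominus>\<^bsub>P\<^esub> y \<in> a_kernel P M g" using xy by (simp add: a_kernel_def')
    then have "x \<ominus>\<^bsub>P\<^esub> y = \<zero>\<^bsub>P\<^esub>" using k by simp
    then show "x = y" using P.minus_eq_zero_iff[OF xy(1,2)] by blast
  qed
  then have "proj_resolution A M 0 (\<lambda>_. P) (\<lambda>_. g)" unfolding proj_resolution_def using * by auto
  then show ?thesis by (rule pd_leI)
qed

section \<open>Finite resolutions and the length of walks\<close>

context rsz_ring
begin

text \<open>Lift the coefficients of the relation to u in P. Then w, the sum of the u e times
  arrows, lies in the kernel Z and is killed by arrows. If w were in ZJ, it would also be such a sum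
  with coefficients z e in Z; the difference u - z would be a relation in P, hence radical by
  \<open>projective_relation\<close>. Applying g, which kills z, would put every coefficient y e
  into NJ.\<close>

lemma syz_top_lift:
  assumes P: "projective A P" and N: "right_module A N" and g: "g \<in> rhom A P N" "g ` carrier P = carrier N"
    and top: "syz_top N j"
  shows "simple_summand (P\<lparr>carrier := a_kernel P N g\<rparr>) j"
proof -
  have rP: "right_module A P" using P by (simp add: projective_def fgmod_def)
  interpret P: rsz_module Q A el P by (rule rsz_moduleI[OF rP])
  interpret N: rsz_module Q A el N by (rule rsz_moduleI[OF N])
  let ?Z = "P\<lparr>carrier := a_kernel P N g\<rparr>"
  have sZ: "submod A P (a_kernel P N g)" by (rule submod_kernel[OF rP N g(1)])
  interpret Z: rsz_module Q A el ?Z by (rule rsz_moduleI[OF P.right_module_submod[OF sZ]])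
  note Z' = P.submodD[OF sZ] and g' = rhomD[OF g(1)]
  obtain y where y: "y \<in> arcs Q \<rightarrow> carrier N" "\<forall>e\<in>arcs Q. y e \<triangleleft>\<^bsub>N\<^esub> ep (tail Q e) = y e"
    "\<forall>e\<in>arcs Q. head Q e \<noteq> j \<longrightarrow> y e = \<zero>\<^bsub>N\<^esub>" "arc_sum N y = \<zero>\<^bsub>N\<^esub>"
    "\<exists>e\<in>arcs Q. y e \<notin> rad N"
    using top unfolding syz_top_def by blast
  \<comment> \<open>The lift has to start at the tail of e, and has to be zero whenever y e is
    forced to be zero; otherwise w would not be concentrated at j.\<close>
  have "\<exists>u. u \<in> carrier P \<and> u \<triangleleft>\<^bsub>P\<^esub> ep (tail Q e) = u \<and> (head Q e \<noteq> j \<longrightarrow> u = \<zero>\<^bsub>P\<^esub>) \<and> g u = y e" if e: "e \<in> arcs Q" for e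
  proof (cases "head Q e = j")
    case True
    have "y e \<in> g ` carrier P" using y(1) e g(2) by auto
    then obtain v where v: "v \<in> carrier P" "y e = g v" by blast
    have "y e \<triangleleft>\<^bsub>N\<^esub> ep (tail Q e) = y e" using y(2) e by blast
    then have "g (v \<triangleleft>\<^bsub>P\<^esub> ep (tail Q e)) = y e" using g'(3)[OF v(1) basis_closed(1)[of "tail Q e"]] by (simp only: v(2))
    then show ?thesis using v(1) True
      by (intro exI[of _ "v \<triangleleft>\<^bsub>P\<^esub> ep (tail Q e)"]) (simp add: P.ract_assoc[symmetric] ep_ep)
  next
    case False
    then show ?thesis using y(3) e rhom_zero[OF rP N g(1)] by (intro exI[of _ "\<zero>\<^bsub>P\<^esub>"]) (simp add: P.ract_zero_left)
  qed
  then obtain u where u: "\<And>e. e \<in> arcs Q \<Longrightarrow> u e \<in> carrier P \<and> u e \<triangleleft>\<^bsub>P\<^esub> ep (tail Q e) = u e \<and>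
      (head Q e \<noteq> j \<longrightarrow> u e = \<zero>\<^bsub>P\<^esub>) \<and> g (u e) = y e" by metis
  define w where "w = arc_sum P u"
  have uP: "u \<in> arcs Q \<rightarrow> carrier P" using u by auto
  have wr: "w \<in> rad P" unfolding w_def rad_def using uP by blast
  have wP: "w \<in> carrier P" using wr P.submodD(3)[OF P.submod_rad] by blast
  have "g w = (\<Oplus>\<^bsub>N\<^esub>e\<in>arcs Q. g (u e \<triangleleft>\<^bsub>P\<^esub> ar e))"
    unfolding w_def by (rule rhom_finsum[OF rP N g(1)]) (use u in auto)
  also have "\<dots> = arc_sum N y"
    using u y(1) g'(3) by (intro N.M.finsum_cong') (auto simp: Pi_iff)
  finally have gw: "g w = \<zero>\<^bsub>N\<^esub>" using y(4) by simp
  then have wZ: "w \<in> carrier ?Z" using wP by (simp add: a_kernel_def')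
  have "w \<triangleleft>\<^bsub>P\<^esub> ep j = (\<Oplus>\<^bsub>P\<^esub>e\<in>arcs Q. (u e \<triangleleft>\<^bsub>P\<^esub> ar e) \<triangleleft>\<^bsub>P\<^esub> ep j)"
    unfolding w_def by (rule P.finsum_ract) (use u in auto)
  also have "\<dots> = w" unfolding w_def
  proof (rule P.M.finsum_cong')
    fix e assume e: "e \<in> arcs Q"
    then show "(u e \<triangleleft>\<^bsub>P\<^esub> ar e) \<triangleleft>\<^bsub>P\<^esub> ep j = u e \<triangleleft>\<^bsub>P\<^esub> ar e"
      using u[OF e] by (cases "head Q e = j") (auto simp: P.ract_assoc[symmetric] ar_ep P.ract_zero_left)
  qed (use u in auto)
  finally have wj: "w \<triangleleft>\<^bsub>P\<^esub> ep j = w" .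
  have "w \<notin> rad ?Z"
  proof
    assume "w \<in> rad ?Z"
    moreover have "w \<triangleleft>\<^bsub>?Z\<^esub> ep j = w" using wj by simp
    ultimately obtain z where z: "z \<in> arcs Q \<rightarrow> carrier ?Z" "w = arc_sum ?Z z"
      "\<And>e. e \<in> arcs Q \<Longrightarrow> z e \<triangleleft>\<^bsub>?Z\<^esub> ep (tail Q e) = z e"
      using Z.rad_homogeneous[of w j] by blast
    have zP: "z e \<in> carrier P" "g (z e) = \<zero>\<^bsub>N\<^esub>" if "e \<in> arcs Q" for e
      using z(1) that by (auto simp: a_kernel_def')
    have "w = (\<Oplus>\<^bsub>P\<^esub>e\<in>arcs Q. z e \<triangleleft>\<^bsub>?Z\<^esub> ar e)"
      unfolding z(2) by (rule rhom_finsum[OF Z.right_module_axioms rP P.rhom_incl[OF Z'(1)]])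
        (use z(1) Z.ract_closed in \<open>auto simp: Pi_iff\<close>)
    then have wz: "w = arc_sum P z" by simp
    \<comment> \<open>Subtraction is written with the central scalar -1, which commutes with arrows
      and idempotents and so passes through the sums.\<close>
    define v where "v e = u e \<oplus>\<^bsub>P\<^esub> (z e \<triangleleft>\<^bsub>P\<^esub> sc (- 1))" for e
    have vP: "v \<in> arcs Q \<rightarrow> carrier P" using u zP by (auto simp: v_def)
    have sw: "(x \<triangleleft>\<^bsub>P\<^esub> sc (- 1)) \<triangleleft>\<^bsub>P\<^esub> a = (x \<triangleleft>\<^bsub>P\<^esub> a) \<triangleleft>\<^bsub>P\<^esub> sc (- 1)" if "x \<in> carrier P" "a \<in> carrier A" for x a
      using that by (simp add: P.ract_assoc[symmetric] sc_comm)
    have "arc_sum P v = (\<Oplus>\<^bsub>P\<^esub>e\<in>arcs Q. (u e \<triangleleft>\<^bsub>P\<^esub> ar e) \<oplus>\<^bsub>P\<^esub> ((z e \<triangleleft>\<^bsub>P\<^esub> ar e) \<triangleleft>\<^bsub>P\<^esub> sc (- 1)))"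
      using u zP by (intro P.M.finsum_cong') (auto simp: v_def P.ract_l_distr sw)
    also have "\<dots> = w \<oplus>\<^bsub>P\<^esub> (\<Oplus>\<^bsub>P\<^esub>e\<in>arcs Q. (z e \<triangleleft>\<^bsub>P\<^esub> ar e) \<triangleleft>\<^bsub>P\<^esub> sc (- 1))"
      unfolding w_def by (rule P.M.finsum_addf) (use u zP in auto)
    also have "(\<Oplus>\<^bsub>P\<^esub>e\<in>arcs Q. (z e \<triangleleft>\<^bsub>P\<^esub> ar e) \<triangleleft>\<^bsub>P\<^esub> sc (- 1)) = w \<triangleleft>\<^bsub>P\<^esub> sc (- 1)"
      unfolding wz by (rule P.finsum_ract[symmetric]) (use zP in auto)
    also have "w \<oplus>\<^bsub>P\<^esub> (w \<triangleleft>\<^bsub>P\<^esub> sc (- 1)) = w \<triangleleft>\<^bsub>P\<^esub> (sc 1 \<oplus>\<^bsub>A\<^esub> sc (- 1))"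
      using wP by (simp add: P.ract_r_distr) (simp add: sc_one)
    also have "\<dots> = \<zero>\<^bsub>P\<^esub>" using wP P.ract_zero_right by (simp add: sc_def el_add el_zero)
    finally have v0: "arc_sum P v = \<zero>\<^bsub>P\<^esub>" .
    have ve: "v e \<triangleleft>\<^bsub>P\<^esub> ep (tail Q e) = v e" if "e \<in> arcs Q" for e
      using u[OF that] zP[OF that] z(3)[OF that] by (simp add: v_def P.ract_l_distr sw)
    have "y e \<in> rad N" if e: "e \<in> arcs Q" for e
    proof -
      have "v e \<in> rad P" by (rule projective_relation[OF P vP ve v0 e])
      then have "g (v e) \<in> rad N" by (rule rad_hom[OF rP N g(1)])
      moreover have "g (v e) = y e"
        using u[OF e] zP[OF e] y(1) e by (auto simp: v_def g' N.ract_zero_left Pi_iff)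
      ultimately show ?thesis by simp
    qed
    then show False using y(5) by blast
  qed
  then show ?thesis unfolding simple_summand_def
    using wZ wj P.rad_ar[OF wr] by (intro bexI[of _ w]) auto
qed

text \<open>A relation ending in j makes the simple module at j a summand of the next kernel, and an
  arrow out of j turns this summand into a relation there. A walk of length m drives this through
  all the kernels and ends with a simple summand in the kernel of the last map, which is
  zero.\<close>

lemma syz_top_walk:
  assumes M: "right_module A M" and res: "proj_resolution A M m P d" and top: "syz_top M j"
  shows "\<not> has_walk Q m j"
proof -
  have r: "\<And>i. i \<le> m \<Longrightarrow> projective A (P i)" "d 0 \<in> rhom A (P 0) M" "d 0 ` carrier (P 0) = carrier M"
    "\<And>i. i < m \<Longrightarrow> d (Suc i) \<in> rhom A (P (Suc i)) (P i)"
    "\<And>i. i < m \<Longrightarrow> d (Suc i) ` carrier (P (Suc i)) = a_kernel (P i) (case i of 0 \<Rightarrow> M | Suc j \<Rightarrow> P j) (d i)"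
    "inj_on (d m) (carrier (P m))"
    using res unfolding proj_resolution_def by auto
  \<comment> \<open>\<open>C i\<close> is the codomain of the differential d i, and
    \<open>N i\<close> is its image. They agree for i = 0, where both are M; beyond that,
    \<open>N\<close> consists of the successive kernels.\<close>
  define C where "C i = (case i of 0 \<Rightarrow> M | Suc k \<Rightarrow> P k)" for i
  define N where "N i = (case i of 0 \<Rightarrow> M | Suc k \<Rightarrow> (P k)\<lparr>carrier := a_kernel (P k) (C k) (d k)\<rparr>)" for i
  have rP: "right_module A (P i)" if "i \<le> m" for i using r(1)[OF that] by (simp add: projective_def fgmod_def)
  have rC: "right_module A (C i)" if "i \<le> Suc m" for i using that rP M by (cases i) (auto simp: C_def)
  have dC: "d i \<in> rhom A (P i) (C i)" if "i \<le> m" for i using that r(2,4) by (cases i) (auto simp: C_def)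
  have rN: "right_module A (N i)" if "i \<le> Suc m" for i
  proof (cases i)
    case 0 then show ?thesis using M by (simp add: N_def)
  next
    case (Suc k)
    then have k: "k \<le> m" using that by simp
    show ?thesis unfolding N_def Suc
      using right_module.right_module_submod[OF rP[OF k] submod_kernel[OF rP[OF k] rC dC[OF k]]] k by simp
  qed
  have zN: "\<zero>\<^bsub>N i\<^esub> = \<zero>\<^bsub>C i\<^esub>" for i by (cases i) (auto simp: N_def C_def)
  have dN: "d i \<in> rhom A (P i) (N i)" "d i ` carrier (P i) = carrier (N i)" if "i \<le> m" for i
  proof -
    show s: "d i ` carrier (P i) = carrier (N i)"
      using that r(3,5) by (cases i) (auto simp: N_def C_def)
    show "d i \<in> rhom A (P i) (N i)"
    proof (cases i)
      case 0 then show ?thesis using r(2) by (simp add: N_def)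
    next
      case (Suc k)
      then have "d i ` carrier (P i) \<subseteq> a_kernel (P k) (C k) (d k)" using s by (simp add: N_def)
      then show ?thesis using rhom_restrict_codomain[of "d i" A "P i" "P k"] r(4)[of k] Suc that by (simp add: N_def)
    qed
  qed
  have ker: "(P i)\<lparr>carrier := a_kernel (P i) (N i) (d i)\<rparr> = N (Suc i)" for i
    by (simp add: N_def a_kernel_def' zN[unfolded N_def])
  have lift: "simple_summand (N (Suc i)) j" if "i \<le> m" "syz_top (N i) j" for i j
    using syz_top_lift[OF r(1)[OF that(1)] rN dN[OF that(1)] that(2)] that(1) by (simp add: ker)
  \<comment> \<open>\<open>N (Suc m)\<close> is the kernel of the injective map d m, so every
    element of it is zero and lies in the radical.\<close>
  have last: "\<not> simple_summand (N (Suc m)) j" for j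
  proof
    assume "simple_summand (N (Suc m)) j"
    then obtain x where x: "x \<in> carrier (N (Suc m))" "x \<notin> rad (N (Suc m))" unfolding simple_summand_def by blast
    interpret P: right_module A "P m" by (rule rP) simp
    interpret N: rsz_module Q A el "N (Suc m)" by (rule rsz_moduleI[OF rN]) simp
    have "x \<in> carrier (P m)" "d m x = \<zero>\<^bsub>C m\<^esub>" using x(1) by (auto simp: N_def a_kernel_def')
    moreover have "d m \<zero>\<^bsub>P m\<^esub> = \<zero>\<^bsub>C m\<^esub>" by (rule rhom_zero[OF rP rC dC]) auto
    ultimately have "x = \<zero>\<^bsub>P m\<^esub>" using r(6) by (metis P.M.zero_closed inj_onD)
    moreover have "\<zero>\<^bsub>P m\<^esub> = \<zero>\<^bsub>N (Suc m)\<^esub>" by (simp add: N_def)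
    ultimately show False using x(2) N.submodD(2)[OF N.submod_rad] by metis
  qed
  \<comment> \<open>The induction counts the arrows still to be followed, so it starts at the end of
    the resolution and moves back towards M.\<close>
  have "i \<le> m \<Longrightarrow> syz_top (N (m - i)) j \<Longrightarrow> \<not> has_walk Q i j" for i j
  proof (induction i arbitrary: j)
    case 0
    then show ?case using lift[of m j] last by auto
  next
    case (Suc i)
    interpret N: rsz_module Q A el "N (m - i)" by (rule rsz_moduleI[OF rN]) simp
    have s: "simple_summand (N (m - i)) j"
      using lift[OF _ Suc.prems(2)] Suc.prems(1) by (simp add: Suc_diff_Suc)
    show ?case
    proof
      assume "has_walk Q (Suc i) j"
      then obtain e where e: "e \<in> arcs Q" "tail Q e = j" "has_walk Q i (head Q e)" by auto
      have "syz_top (N (m - i)) (head Q e)" using N.simple_summand_syz_top[of e] s e by simp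
      then show False using Suc.IH[of "head Q e"] Suc.prems(1) e(3) by simp
    qed
  qed
  from this[of m j] show ?thesis using top by (simp add: N_def)
qed

text \<open>Every vertex in the support of the syzygy is the head of an arrow leaving the support of
  N, so the bound on walks drops by one with each syzygy. For k = 0 no arrow leaves the support, and
  the syzygy is zero.\<close>

lemma pd_semisimple_le:
  assumes "N \<in> fgmod A" "\<forall>i\<in>support N. \<not> has_walk Q (Suc k) i"
  shows "pd A N \<le> enat k"
  using assms
proof (induction k arbitrary: N)
  case (0 N)
  have r: "right_module A N" using 0 by (simp add: fgmod_def)
  interpret N: rsz_module Q A el N by (rule rsz_moduleI[OF r])
  have s: "is_syzygy A N (syzygy A N)" by (rule syzygy_exists[OF 0(1)])
  then have "right_module A (syzygy A N)" by (simp add: is_syzygy_def fgmod_def)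
  then interpret S: rsz_module Q A el "syzygy A N" by (rule rsz_moduleI)
  have "support (syzygy A N) = {}"
  proof (rule ccontr)
    assume "support (syzygy A N) \<noteq> {}"
    then obtain j where "j \<in> support (syzygy A N)" by blast
    from N.syz_top_tail[OF support_syzygy[OF s r this]] show False using 0(2) by auto
  qed
  then show ?case using pd_zero[OF s S.support_empty r] by simp
next
  case (Suc k N)
  have r: "right_module A N" using Suc by (simp add: fgmod_def)
  interpret N: rsz_module Q A el N by (rule rsz_moduleI[OF r])
  have s: "is_syzygy A N (syzygy A N)" by (rule syzygy_exists[OF Suc.prems(1)])
  have "pd A (syzygy A N) \<le> enat k"
  proof (rule Suc.IH)
    show "syzygy A N \<in> fgmod A" using s by (simp add: is_syzygy_def)
    show "\<forall>j\<in>support (syzygy A N). \<not> has_walk Q (Suc k) j"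
    proof (intro ballI notI)
      fix j assume j: "j \<in> support (syzygy A N)" and w: "has_walk Q (Suc k) j"
      from N.syz_top_tail[OF support_syzygy[OF s r j]] show False using Suc.prems(2) w by fastforce
    qed
  qed
  then show ?case by (rule pd_syzygy[OF s])
qed

text \<open>A given finite resolution bounds the walks from the support by its own length, whatever
  that is. The hypothesis \<open>bound\<close> improves this to the uniform bound D, which then
  controls the projective dimension.\<close>

lemma finite_pd_semisimple:
  assumes bound: "\<And>m j. j \<in> verts Q \<Longrightarrow> \<not> has_walk Q m j \<Longrightarrow> \<not> has_walk Q (Suc D) j"
    and N: "N \<in> fgmod A" "semisimple N" "pd A N < \<infinity>"
  shows "pd A N \<le> enat D"
proof (rule pd_semisimple_le[OF N(1)], intro ballI)
  fix i assume i: "i \<in> support N"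
  have r: "right_module A N" using N by (simp add: fgmod_def)
  interpret N: rsz_module Q A el N by (rule rsz_moduleI[OF r])
  obtain m P d where res: "proj_resolution A N m P d" using N(3) by (rule pd_finiteE)
  have "\<not> has_walk Q (Suc m) i"
  proof
    assume "has_walk Q (Suc m) i"
    then obtain e where e: "e \<in> arcs Q" "tail Q e = i" "has_walk Q m (head Q e)" by auto
    have "syz_top N (head Q e)"
      using N.simple_summand_syz_top[OF _ e(1)] N.semisimple_simple_summand[OF N(2) i] e(2) by simp
    then show False using syz_top_walk[OF r res] e(3) by blast
  qed
  then show "\<not> has_walk Q (Suc D) i" by (rule bound[rotated]) (use i in \<open>simp add: support_def\<close>)
qed

text \<open>A general module need not have simple summands at its support, but the support of its
  syzygy consists of ends of nontrivial relations, to which \<open>syz_top_walk\<close> applies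
  directly. Passing to the syzygy costs the extra one.\<close>

lemma finite_pd:
  assumes bound: "\<And>m j. j \<in> verts Q \<Longrightarrow> \<not> has_walk Q m j \<Longrightarrow> \<not> has_walk Q (Suc D) j"
    and N: "N \<in> fgmod A" "pd A N < \<infinity>"
  shows "pd A N \<le> enat (Suc D)"
proof -
  have r: "right_module A N" using N by (simp add: fgmod_def)
  obtain m P d where res: "proj_resolution A N m P d" using N(2) by (rule pd_finiteE)
  have s: "is_syzygy A N (syzygy A N)" by (rule syzygy_exists[OF N(1)])
  have "pd A (syzygy A N) \<le> enat D"
  proof (rule pd_semisimple_le)
    show "syzygy A N \<in> fgmod A" using s by (simp add: is_syzygy_def)
    show "\<forall>j\<in>support (syzygy A N). \<not> has_walk Q (Suc D) j"
    proof
      fix j assume j: "j \<in> support (syzygy A N)"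
      then have "\<not> has_walk Q m j" by (rule syz_top_walk[OF r res support_syzygy[OF s r]])
      then show "\<not> has_walk Q (Suc D) j" by (rule bound[rotated]) (use j in \<open>simp add: support_def\<close>)
    qed
  qed
  then show ?thesis by (rule pd_syzygy[OF s])
qed

lemma syzygy_iterate: "M \<in> fgmod A \<Longrightarrow> (syzygy A ^^ k) M \<in> fgmod A"
proof (induction k)
  case (Suc k)
  then have "is_syzygy A ((syzygy A ^^ k) M) (syzygy A ((syzygy A ^^ k) M))" by (intro syzygy_exists)
  then show ?case by (simp add: is_syzygy_def)
qed simp

lemma semisimple_image:
  assumes "right_module A M" "right_module A N" "h \<in> rhom A M N" "h ` carrier M = carrier N" "semisimple M"
  shows "semisimple N"
  unfolding semisimple_def
proof (intro ballI)
  fix y e assume "y \<in> carrier N" and e: "e \<in> arcs Q"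
  then obtain x where x: "x \<in> carrier M" "y = h x" using assms(4) by auto
  then show "y \<triangleleft>\<^bsub>N\<^esub> ar e = \<zero>\<^bsub>N\<^esub>"
    using rhomD(3)[OF assms(3) x(1) basis_closed(2)[of e]] assms(5) e rhom_zero[OF assms(1-3)]
    by (simp add: semisimple_def)
qed

lemma semisimple_direct_summand:
  assumes "right_module A X" "semisimple X" "summand A N X"
  shows "semisimple N"
proof -
  obtain N' h where N: "N \<in> fgmod A" "N' \<in> fgmod A" and h: "h \<in> rhom A X (dsum N N')"
    "bij_betw h (carrier X) (carrier (dsum N N'))"
    using assms(3) unfolding summand_def riso_def by blast
  have rN: "right_module A N" "right_module A N'" using N by (auto simp: fgmod_def)
  interpret N': right_module A N' by (rule rN(2))
  have p: "fst \<in> rhom A (dsum N N') N" by (rule rhomI) (auto simp: dsum_def)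
  have "fst ` carrier (dsum N N') = carrier N" using N'.M.zero_closed by (auto simp: dsum_def image_iff intro!: bexI)
  then have "(\<lambda>x. fst (h x)) ` carrier X = carrier N" using h(2) by (simp add: bij_betw_def image_image[symmetric])
  then show ?thesis by (rule semisimple_image[OF assms(1) rN(1) rhom_comp[OF h(1) p] _ assms(2)])
qed

lemma psi_le:
  assumes bound: "\<And>m j. j \<in> verts Q \<Longrightarrow> \<not> has_walk Q m j \<Longrightarrow> \<not> has_walk Q (Suc D) j"
    and M: "M \<in> fgmod A" and phi: "phi A M \<le> m" and m: "0 < m"
  shows "psi A M \<le> enat (m + D)"
proof -
  let ?X = "(syzygy A ^^ phi A M) M"
  \<comment> \<open>The slack between m and \<phi>(M) is kept, so that adding \<phi>(M) gives
    exactly m + D and, for \<phi>(M) = 0, the value D + 1 still fits.\<close>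
  have "pd A N \<le> enat (m + D - phi A M)" if N: "summand A N ?X" "pd A N < \<infinity>" for N
  proof (cases "phi A M")
    case 0
    have "pd A N \<le> enat (Suc D)" using N by (intro finite_pd[OF bound]) (auto simp: summand_def)
    also have "\<dots> \<le> enat (m + D - phi A M)" using 0 m by simp
    finally show ?thesis .
  next
    case (Suc k)
    let ?Y = "(syzygy A ^^ k) M"
    have s: "is_syzygy A ?Y ?X" using Suc syzygy_exists[OF syzygy_iterate[OF M]] by simp
    then have "right_module A ?X" by (simp add: is_syzygy_def fgmod_def)
    then have "semisimple N" by (rule semisimple_direct_summand[OF _ semisimple_syzygy[OF s] N(1)])
    then have "pd A N \<le> enat D" using N by (intro finite_pd_semisimple[OF bound]) (auto simp: summand_def)
    also have "\<dots> \<le> enat (m + D - phi A M)" using phi by simp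
    finally show ?thesis .
  qed
  then have "(SUP N \<in> {N. summand A N ?X \<and> pd A N < \<infinity>}. pd A N) \<le> enat (m + D - phi A M)"
    by (intro SUP_least) auto
  then have "psi A M \<le> enat (phi A M) + enat (m + D - phi A M)"
    unfolding psi_def by (rule add_left_mono)
  then show ?thesis using phi by simp
qed

end

section \<open>Walks and the heart\<close>

context fin_digraph
begin

lemma has_walk_Suc_imp: "has_walk G (Suc k) j \<Longrightarrow> has_walk G k j"
  by (induction k arbitrary: j) auto

text \<open>The sets of vertices without a walk of length \<open>k\<close> increase with \<open>k\<close>, and a repetition is stable.\<close>

lemma no_walk_card:
  assumes "j \<in> verts G" "\<not> has_walk G m j"
  shows "\<not> has_walk G (card (verts G)) j"
proof -
  define F where "F k = {j \<in> verts G. \<not> has_walk G k j}" for k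
  have step: "F (Suc k) = {j \<in> verts G. \<forall>e\<in>arcs G. tail G e = j \<longrightarrow> head G e \<in> F k}" for k
    by (auto simp: F_def)
  have F: "F k \<subseteq> verts G" for k by (auto simp: F_def)
  have "mono F" unfolding mono_iff_le_Suc using has_walk_Suc_imp by (auto simp: F_def simp del: has_walk.simps)
  moreover have "finite (range F)" by (rule finite_subset[of _ "Pow (verts G)"]) (use F in auto)
  moreover have "\<forall>n. F n = F (Suc n) \<longrightarrow> F (Suc n) = F (Suc (Suc n))"
  proof (intro allI impI)
    fix n assume eq: "F n = F (Suc n)"
    have "F (Suc n) = {j \<in> verts G. \<forall>e\<in>arcs G. tail G e = j \<longrightarrow> head G e \<in> F n}" by (rule step)
    also have "\<dots> = F (Suc (Suc n))" unfolding step[of "Suc n"] eq ..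
    finally show "F (Suc n) = F (Suc (Suc n))" .
  qed
  ultimately have "\<exists>N. (\<forall>n\<le>N. \<forall>m\<le>N. m < n \<longrightarrow> F m \<subset> F n) \<and> (\<forall>n\<ge>N. F N = F n)"
    by (intro finite_mono_remains_stable_implies_strict_prefix)
  \<comment> \<open>Each strict increase adds a vertex, so the chain has become constant at the
    index \<open>card (verts G)\<close> at the latest.\<close>
  then have "F (card (verts G)) = (\<Union>n. F n)"
    by (intro finite_mono_strict_prefix_implies_finite_fixpoint F) auto
  moreover have "j \<in> F m" using assms by (simp add: F_def)
  ultimately have "j \<in> F (card (verts G))" by blast
  then show ?thesis by (simp add: F_def)
qed

text \<open>Follow the given walk of length k and continue as long as an arrow leaves the current
  vertex. The bound m makes this stop, which can happen only at a sink. Every vertex passed again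
  has walks of bounded length, so the whole walk stays in S.\<close>

lemma walk_to_sink:
  assumes S: "\<And>j m. j \<in> verts G \<Longrightarrow> \<not> has_walk G m j \<Longrightarrow> j \<in> S"
  shows "j \<in> verts G \<Longrightarrow> \<not> has_walk G m j \<Longrightarrow> has_walk G k j \<Longrightarrow>
    \<exists>p v. pre_digraph.awalk (G \<restriction> S) j p v \<and> sink G v \<and> k \<le> length p"
proof (induction m arbitrary: j k)
  case 0 then show ?case by simp
next
  case (Suc m)
  have jS: "j \<in> S" using S Suc.prems by blast
  show ?case
  proof (cases "\<exists>e\<in>arcs G. tail G e = j")
    case False
    then have "k = 0" using Suc.prems(3) by (cases k) auto
    moreover have "sink G j" using False Suc.prems(1) by (auto simp: sink_def out_arcs_def)
    moreover have "pre_digraph.awalk (G \<restriction> S) j [] j"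
      using jS by (simp add: pre_digraph.awalk_def pre_digraph.cas.simps)
    ultimately show ?thesis by auto
  next
    case True
    \<comment> \<open>For k = 0 any arrow will do, and \<open>k - 1\<close> is again 0; this is the
      phase in which the walk is prolonged towards the sink.\<close>
    have "\<exists>e\<in>arcs G. tail G e = j \<and> has_walk G (k - 1) (head G e)"
      using True Suc.prems(3) by (cases k) auto
    then obtain e where e: "e \<in> arcs G" "tail G e = j" "has_walk G (k - 1) (head G e)" by blast
    have h: "head G e \<in> verts G" "\<not> has_walk G m (head G e)" using e Suc.prems(2) by auto
    obtain p v where p: "pre_digraph.awalk (G \<restriction> S) (head G e) p v" "sink G v" "k - 1 \<le> length p"
      using Suc.IH[OF h e(3)] by blast
    have "pre_digraph.awalk (G \<restriction> S) j (e # p) v"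
      using p(1) e(1,2) jS S[OF h] by (auto simp: pre_digraph.awalk_def pre_digraph.cas.simps)
    then show ?thesis using p(2,3) by (intro exI[of _ "e # p"] exI[of _ v]) auto
  qed
qed

end

section \<open>The algebra \<open>KQ/J\<^sup>2\<close> in coordinates\<close>

context fin_digraph
begin

text \<open>A basis path with a coefficient built in, as the path algebra is given only as a ring,
  without a scalar action.\<close>

definition mono_path :: "'k::field \<Rightarrow> 'a \<times> 'b list \<Rightarrow> ('a \<times> 'b list \<Rightarrow> 'k)" where
  "mono_path k x = (\<lambda>y. if y = x then k else 0)"

text \<open>The guards make the support consist of genuine paths, so that arbitrary functions c and
  d yield an element of the path algebra.\<close>

definition short_elem :: "('a \<Rightarrow> 'k::field) \<Rightarrow> ('b \<Rightarrow> 'k) \<Rightarrow> ('a \<times> 'b list \<Rightarrow> 'k)" where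
  "short_elem c d = (\<lambda>(u, p). case p of [] \<Rightarrow> if u \<in> verts G then c u else 0
     | e # q \<Rightarrow> if q = [] \<and> e \<in> arcs G \<and> tail G e = u then d e else 0)"

definition rsz_el :: "('a \<Rightarrow> 'k::field) \<Rightarrow> ('b \<Rightarrow> 'k) \<Rightarrow> ('a \<times> 'b list \<Rightarrow> 'k) set" where
  "rsz_el c d = arrow_ideal_sq G +>\<^bsub>path_algebra G\<^esub> short_elem c d"

lemma path_algebra_carrier:
  "f \<in> carrier (path_algebra G) \<longleftrightarrow> finite {x. f x \<noteq> 0} \<and> {x. f x \<noteq> 0} \<subseteq> paths G"
  by (simp add: path_algebra_def)

lemma path_algebra_simps:
  "f \<oplus>\<^bsub>path_algebra G\<^esub> g = (\<lambda>x. f x + g x)" "\<zero>\<^bsub>path_algebra G\<^esub> = (\<lambda>_. 0)"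
  "(f \<otimes>\<^bsub>path_algebra G\<^esub> g) (u, p) = (\<Sum>k\<le>length p. f (u, take k p) * g (awlast u (take k p), drop k p))"
  by (simp_all add: path_algebra_def)

lemma mono_path_closed: "x \<in> paths G \<Longrightarrow> mono_path k x \<in> carrier (path_algebra G)"
  by (auto simp: path_algebra_carrier mono_path_def)

lemma short_elem_closed: "short_elem c d \<in> carrier (path_algebra G)"
proof -
  let ?S = "(\<lambda>u. (u, [])) ` verts G \<union> (\<lambda>e. (tail G e, [e])) ` arcs G"
  have "{x. short_elem c d x \<noteq> 0} \<subseteq> ?S"
    by (auto simp: short_elem_def split: list.splits if_splits)
  moreover have "?S \<subseteq> paths G" by (auto simp: paths_iff awalk_def)
  moreover have "finite ?S" by simp
  ultimately show ?thesis unfolding path_algebra_carrier by (meson finite_subset order_trans)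
qed

lemma short_elem_simps [simp]:
  "u \<in> verts G \<Longrightarrow> short_elem c d (u, []) = c u"
  "e \<in> arcs G \<Longrightarrow> short_elem c d (tail G e, [e]) = d e"
  by (simp_all add: short_elem_def)

lemma mono_path_mult:
  assumes "awlast u p = v"
  shows "mono_path k (u, p) \<otimes>\<^bsub>path_algebra G\<^esub> mono_path l (v, q) = mono_path (k * l) (u, p @ q)"
proof (rule ext, clarify)
  fix u' p'
  \<comment> \<open>Among all factorisations of p', only the cut after \<open>length p\<close>
    arrows can match the first factor.\<close>
  have "(mono_path k (u, p) \<otimes>\<^bsub>path_algebra G\<^esub> mono_path l (v, q)) (u', p') =
    (\<Sum>i\<le>length p'. if i = length p then mono_path (k * l) (u, p @ q) (u', p') else 0)"
    unfolding path_algebra_simps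
  proof (intro sum.cong refl)
    fix i assume "i \<in> {..length p'}"
    then have i: "i \<le> length p'" by simp
    show "mono_path k (u, p) (u', take i p') * mono_path l (v, q) (awlast u' (take i p'), drop i p') =
      (if i = length p then mono_path (k * l) (u, p @ q) (u', p') else 0)"
    proof (cases "i = length p")
      case True
      have "take i p' = p \<and> drop i p' = q \<longleftrightarrow> p' = p @ q"
        using True by (metis append_eq_conv_conj append_take_drop_id)
      then show ?thesis using True assms by (auto simp: mono_path_def)
    next
      case False
      then have "take i p' \<noteq> p" using i by auto
      then show ?thesis using False by (simp add: mono_path_def)
    qed
  qed
  also have "\<dots> = mono_path (k * l) (u, p @ q) (u', p')"
    by (auto simp: mono_path_def)
  finally show "(mono_path k (u, p) \<otimes>\<^bsub>path_algebra G\<^esub> mono_path l (v, q)) (u', p') = mono_path (k * l) (u, p @ q) (u', p')" .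
qed

lemma mono_path_in_arrow_ideal:
  fixes k :: "'k::field"
  assumes "(u, e # q) \<in> paths G"
  shows "mono_path k (u, e # q) \<in> arrow_ideal G"
proof -
  interpret K: ring "path_algebra G :: ('a \<times> 'b list \<Rightarrow> 'k::field) ring" by (rule ring_path_algebra)
  interpret I: ideal "arrow_ideal G" "path_algebra G :: ('a \<times> 'b list \<Rightarrow> 'k::field) ring" by (rule ideal_arrow_ideal)
  have e: "e \<in> arcs G" "u = tail G e" "(head G e, q) \<in> paths G"
    using assms by (auto simp: paths_iff awalk_Cons_iff)
  have "basis_path (tail G e, [e]) \<in> (arrow_ideal G :: ('a \<times> 'b list \<Rightarrow> 'k) set)"
    unfolding arrow_ideal_def
  proof (rule subsetD[OF K.genideal_self])
    show "{basis_path (tail G e, [e]) |e. e \<in> arcs G} \<subseteq> carrier (path_algebra G :: ('a \<times> 'b list \<Rightarrow> 'k) ring)"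
      by (auto simp: path_algebra_carrier basis_path_def paths_iff awalk_def)
  qed (use e(1) in blast)
  then have "mono_path 1 (tail G e, [e]) \<in> (arrow_ideal G :: ('a \<times> 'b list \<Rightarrow> 'k) set)"
    by (simp add: mono_path_def basis_path_def)
  then have "mono_path 1 (tail G e, [e]) \<otimes>\<^bsub>path_algebra G\<^esub> mono_path k (head G e, q) \<in> arrow_ideal G"
    by (rule I.I_r_closed[OF _ mono_path_closed[OF e(3)]])
  then show ?thesis using e by (simp add: mono_path_mult awalk_verts_conv)
qed

text \<open>Cut the path after its first arrow: both pieces are nonempty and hence lie in J. The
  coefficient is carried by the first piece.\<close>

lemma mono_path_in_arrow_ideal_sq:
  assumes "(u, p) \<in> paths G" "2 \<le> length p"
  shows "mono_path k (u, p) \<in> arrow_ideal_sq G"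
proof -
  obtain e f q where p: "p = e # f # q" using assms(2) by (cases p; cases "tl p") auto
  have e: "e \<in> arcs G" "u = tail G e" "(head G e, f # q) \<in> paths G"
    using assms(1) by (auto simp: p paths_iff awalk_Cons_iff)
  have "(tail G e, [e]) \<in> paths G" using e(1) by (auto simp: paths_iff awalk_def)
  then have "mono_path k (tail G e, [e]) \<otimes>\<^bsub>path_algebra G\<^esub> mono_path 1 (head G e, f # q) \<in> arrow_ideal_sq G"
    unfolding arrow_ideal_sq_def by (intro ideal_prod.prod mono_path_in_arrow_ideal e(3))
  then show ?thesis using e by (simp add: mono_path_mult p)
qed

text \<open>Such an f is a finite sum of multiples of paths of length at least two, each in J^2.
  Together with \<open>arrow_ideal_sq_short_path\<close> this describes J^2 exactly, so residue
  classes are read off at paths of length at most one.\<close>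

lemma long_in_arrow_ideal_sq:
  assumes "f \<in> carrier (path_algebra G)" "\<And>u p. length p \<le> 1 \<Longrightarrow> f (u, p) = (0::'k::field)"
  shows "f \<in> arrow_ideal_sq G"
proof -
  have J: "additive_subgroup (arrow_ideal_sq G) (path_algebra G :: ('a \<times> 'b list \<Rightarrow> 'k) ring)"
    by (rule ideal.axioms(1)[OF ideal_arrow_ideal_sq])
  have "finite S \<Longrightarrow> S \<subseteq> {(u, p) \<in> paths G. 2 \<le> length p} \<Longrightarrow> (\<lambda>x. if x \<in> S then f x else 0) \<in> arrow_ideal_sq G" for S
  proof (induction S rule: finite_induct)
    case empty
    then show ?case using additive_subgroup.zero_closed[OF J] by (simp add: path_algebra_simps)
  next
    case (insert x S)
    have "(\<lambda>y. if y \<in> insert x S then f y else 0) = (\<lambda>y. if y \<in> S then f y else 0) \<oplus>\<^bsub>path_algebra G\<^esub> mono_path (f x) x"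
      using insert.hyps(2) by (auto simp: path_algebra_simps mono_path_def)
    moreover have "mono_path (f x) x \<in> arrow_ideal_sq G"
      using insert.prems mono_path_in_arrow_ideal_sq by (cases x) auto
    ultimately show ?case using insert by (auto intro: additive_subgroup.a_closed[OF J])
  qed
  note * = this[of "{x. f x \<noteq> 0}"]
  have "{x. f x \<noteq> 0} \<subseteq> {(u, p) \<in> paths G. 2 \<le> length p}"
  proof clarify
    fix u p assume fp: "f (u, p) \<noteq> 0"
    then have "(u, p) \<in> paths G" using assms(1) by (auto simp: path_algebra_carrier)
    moreover have "\<not> length p \<le> 1" using fp assms(2) by blast
    ultimately show "(u, p) \<in> paths G \<and> 2 \<le> length p" by simp
  qed
  then have "(\<lambda>x. if x \<in> {x. f x \<noteq> 0} then f x else 0) \<in> arrow_ideal_sq G"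
    using assms(1) by (intro *) (auto simp: path_algebra_carrier)
  moreover have "(\<lambda>x. if x \<in> {x. f x \<noteq> 0} then f x else 0) = f" by auto
  ultimately show ?thesis by simp
qed

lemma path_algebra_minus:
  assumes "f \<in> carrier (path_algebra G)"
  shows "(\<ominus>\<^bsub>path_algebra G\<^esub> f) x = - (f x :: 'k::field)"
proof -
  interpret K: ring "path_algebra G :: ('a \<times> 'b list \<Rightarrow> 'k) ring" by (rule ring_path_algebra)
  have "(f \<oplus>\<^bsub>path_algebra G\<^esub> \<ominus>\<^bsub>path_algebra G\<^esub> f) x = \<zero>\<^bsub>path_algebra G\<^esub> x" using assms by (simp add: K.r_neg)
  then show ?thesis by (simp add: path_algebra_simps add_eq_0_iff)
qed

lemma coset_eq_iff:
  assumes f: "f \<in> carrier (path_algebra G)" and g: "g \<in> carrier (path_algebra G)"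
  shows "arrow_ideal_sq G +>\<^bsub>path_algebra G\<^esub> f = arrow_ideal_sq G +>\<^bsub>path_algebra G\<^esub> g \<longleftrightarrow>
    (\<forall>u p. length p \<le> 1 \<longrightarrow> f (u, p) = (g (u, p) :: 'k::field))"
proof -
  let ?K = "path_algebra G :: ('a \<times> 'b list \<Rightarrow> 'k) ring"
  let ?J = "arrow_ideal_sq G :: ('a \<times> 'b list \<Rightarrow> 'k) set"
  interpret K: ring ?K by (rule ring_path_algebra)
  interpret J: ideal ?J ?K by (rule ideal_arrow_ideal_sq)
  have "?J +>\<^bsub>?K\<^esub> f = ?J +>\<^bsub>?K\<^esub> g \<longleftrightarrow> f \<ominus>\<^bsub>?K\<^esub> g \<in> ?J"
    by (rule K.quotient_eq_iff_same_a_r_cos[OF J.ideal_axioms f g, symmetric])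
  also have "\<dots> \<longleftrightarrow> (\<forall>u p. length p \<le> 1 \<longrightarrow> (f \<ominus>\<^bsub>?K\<^esub> g) (u, p) = 0)"
    using long_in_arrow_ideal_sq[OF K.minus_closed[OF f g]] arrow_ideal_sq_short_path[of "f \<ominus>\<^bsub>?K\<^esub> g"] by blast
  also have "\<dots> \<longleftrightarrow> (\<forall>u p. length p \<le> 1 \<longrightarrow> f (u, p) = g (u, p))"
    using g by (simp add: K.minus_eq path_algebra_simps path_algebra_minus)
  finally show ?thesis .
qed

text \<open>Off the paths both functions vanish, so only the trivial paths and the single arrows
  have to be compared.\<close>

lemma short_elem_cong:
  assumes f: "f \<in> carrier (path_algebra G)" and g: "g \<in> carrier (path_algebra G)"
    and "\<And>u. u \<in> verts G \<Longrightarrow> f (u, []) = g (u, [])" "\<And>e. e \<in> arcs G \<Longrightarrow> f (tail G e, [e]) = (g (tail G e, [e]) :: 'k::field)"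
  shows "arrow_ideal_sq G +>\<^bsub>path_algebra G\<^esub> f = arrow_ideal_sq G +>\<^bsub>path_algebra G\<^esub> g"
  unfolding coset_eq_iff[OF f g]
proof (intro allI impI)
  fix u and p :: "'b list" assume p: "length p \<le> 1"
  show "f (u, p) = g (u, p)"
  proof (cases "(u, p) \<in> paths G")
    case True
    show ?thesis
    proof (cases p)
      case Nil
      then show ?thesis using True assms(3) by (auto simp: paths_iff awalk_def)
    next
      case (Cons e q)
      then have "q = []" using p by simp
      then show ?thesis using True assms(4)[of e] Cons by (auto simp: paths_iff awalk_Cons_iff)
    qed
  next
    case False
    then show ?thesis using f g unfolding path_algebra_carrier by (metis (mono_tags, lifting) mem_Collect_eq subsetD)
  qed
qed

lemma rsz_el_surj:
  assumes "a \<in> carrier (rad_sq_zero G :: ('a \<times> 'b list \<Rightarrow> 'k::field) set ring)"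
  shows "\<exists>c d. a = rsz_el c d"
proof -
  obtain f where f: "f \<in> carrier (path_algebra G)" "a = arrow_ideal_sq G +>\<^bsub>path_algebra G\<^esub> f"
    using assms by (auto simp: rad_sq_zero_def FactRing_def A_RCOSETS_def')
  have "a = rsz_el (\<lambda>u. f (u, [])) (\<lambda>e. f (tail G e, [e]))"
    unfolding f(2) rsz_el_def by (rule short_elem_cong[OF f(1) short_elem_closed]) auto
  then show ?thesis by blast
qed

text \<open>All identities reduce to coefficients at trivial paths and arrows. In a product, an
  arrow e has two factorisations, which give the two terms of its coefficient; products of two
  arrows fall into J^2.\<close>

lemma rsz_ring_rad_sq_zero: "rsz_ring G (rad_sq_zero G :: ('a \<times> 'b list \<Rightarrow> 'k::field) set ring) rsz_el"
proof -
  let ?K = "path_algebra G :: ('a \<times> 'b list \<Rightarrow> 'k) ring"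
  let ?A = "rad_sq_zero G :: ('a \<times> 'b list \<Rightarrow> 'k) set ring"
  let ?J = "arrow_ideal_sq G :: ('a \<times> 'b list \<Rightarrow> 'k) set"
  interpret K: ring ?K by (rule ring_path_algebra)
  interpret J: ideal ?J ?K by (rule ideal_arrow_ideal_sq)
  note sc = short_elem_closed
  have add: "(?J +>\<^bsub>?K\<^esub> f) \<oplus>\<^bsub>?A\<^esub> (?J +>\<^bsub>?K\<^esub> g) = ?J +>\<^bsub>?K\<^esub> (f \<oplus>\<^bsub>?K\<^esub> g)"
    and mult: "(?J +>\<^bsub>?K\<^esub> f) \<otimes>\<^bsub>?A\<^esub> (?J +>\<^bsub>?K\<^esub> g) = ?J +>\<^bsub>?K\<^esub> (f \<otimes>\<^bsub>?K\<^esub> g)"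
    if "f \<in> carrier ?K" "g \<in> carrier ?K" for f g
    using that by (simp_all add: rad_sq_zero_def FactRing_def J.a_rcos_sum J.rcoset_mult_add)
  show ?thesis
  proof (intro rsz_ring.intro rsz_ring_axioms.intro fin_digraph_axioms ring_rad_sq_zero)
    fix c c' :: "'a \<Rightarrow> 'k" and d d' :: "'b \<Rightarrow> 'k"
    show "rsz_el c d \<in> carrier ?A"
      using sc[of c d] by (auto simp: rsz_el_def rad_sq_zero_def FactRing_def A_RCOSETS_def')
    show "rsz_el c d = rsz_el c' d' \<longleftrightarrow> (\<forall>i\<in>verts G. c i = c' i) \<and> (\<forall>e\<in>arcs G. d e = d' e)"
    proof
      assume "rsz_el c d = rsz_el c' d'"
      then have *: "short_elem c d (u, p) = short_elem c' d' (u, p)" if "length p \<le> 1" for u p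
        using that unfolding rsz_el_def coset_eq_iff[OF sc sc] by blast
      show "(\<forall>i\<in>verts G. c i = c' i) \<and> (\<forall>e\<in>arcs G. d e = d' e)"
      proof (intro conjI ballI)
        show "c i = c' i" if "i \<in> verts G" for i using *[of "[]" i] that by simp
        show "d e = d' e" if "e \<in> arcs G" for e using *[of "[e]" "tail G e"] that by simp
      qed
    next
      assume "(\<forall>i\<in>verts G. c i = c' i) \<and> (\<forall>e\<in>arcs G. d e = d' e)"
      then show "rsz_el c d = rsz_el c' d'"
        unfolding rsz_el_def by (intro short_elem_cong sc) auto
    qed
    show "rsz_el c d \<oplus>\<^bsub>?A\<^esub> rsz_el c' d' = rsz_el (\<lambda>i. c i + c' i) (\<lambda>e. d e + d' e)"
      unfolding rsz_el_def add[OF sc sc]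
      by (rule short_elem_cong[OF K.a_closed[OF sc sc] sc]) (simp_all add: path_algebra_simps)
    show "rsz_el c d \<otimes>\<^bsub>?A\<^esub> rsz_el c' d' =
        rsz_el (\<lambda>i. c i * c' i) (\<lambda>e. c (tail G e) * d' e + d e * c' (head G e))"
      unfolding rsz_el_def mult[OF sc sc]
      by (rule short_elem_cong[OF K.m_closed[OF sc sc] sc]) (simp_all add: path_algebra_simps awalk_verts_conv)
    have "\<one>\<^bsub>?K\<^esub> (u, p) = (if u \<in> verts G \<and> p = [] then 1 else 0)" for u p by (simp add: path_algebra_def)
    then show "\<one>\<^bsub>?A\<^esub> = rsz_el (\<lambda>_. 1) (\<lambda>_. 0)"
      unfolding rsz_el_def by (simp add: rad_sq_zero_def FactRing_def) (rule short_elem_cong[OF K.one_closed sc], simp_all)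
  qed (rule rsz_el_surj)
qed

lemma A0_properties:
  fixes M :: "('a, 'b, 'k::field) rsz_module"
  assumes "M = A0 G"
  shows "M \<in> fgmod (rad_sq_zero G)" "rsz_ring.semisimple G rsz_el M"
proof -
  let ?A = "rad_sq_zero G :: ('a \<times> 'b list \<Rightarrow> 'k) set ring"
  let ?S = "simple_at :: 'a \<Rightarrow> (('a \<times> 'b list \<Rightarrow> 'k) set, 'k) rmodule"
  interpret A: rsz_ring G ?A rsz_el by (rule rsz_ring_rad_sq_zero)
  let ?D = "dsum_family (verts G) ?S"
  have S: "right_module ?A (?S i)" if "i \<in> verts G" for i by (rule right_module_simple_at[OF that])
  have act: "x \<triangleleft>\<^bsub>?S i\<^esub> rsz_el c d = x * c i" if "i \<in> verts G" for i x c d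
    unfolding rsz_el_def using that by (subst simple_at_class[OF short_elem_closed]) simp
  have gen: "generates ?A (?S i) {1}" if i: "i \<in> verts G" for i
  proof -
    interpret S: right_module ?A "?S i" by (rule S[OF i])
    have "x \<in> N" if N: "submod ?A (?S i) N" "1 \<in> N" for x N
      using S.submodD(7)[OF N A.el_closed[of "\<lambda>_. x" "\<lambda>_. 0"]] by (simp add: act[OF i])
    then show ?thesis unfolding generates_def by (auto simp: simple_at_def)
  qed
  have D: "right_module ?A ?D" by (rule right_module_dsum_family[OF ring_rad_sq_zero S])
  have fD: "fin_gen ?A ?D"
    by (rule fin_gen_dsum_family[OF ring_rad_sq_zero S]) (use gen in \<open>auto simp: fin_gen_iff\<close>)
  have ss: "A.semisimple ?D" unfolding A.semisimple_def
  proof (intro ballI)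
    fix x e assume "x \<in> carrier ?D" "e \<in> arcs G"
    show "x \<triangleleft>\<^bsub>?D\<^esub> A.ar e = \<zero>\<^bsub>?D\<^esub>"
      by (auto simp: A.ar_def act intro!: restrict_ext) (simp add: simple_at_def)
  qed
  have M: "M \<in> fgmod ?A \<and> riso ?A ?D M"
    unfolding assms A0_def fgmod_copy_def by (rule someI_ex) (use fgmod_copy_exists[OF D fD] in blast)
  then show "M \<in> fgmod ?A" by blast
  then have rM: "right_module ?A M" by (simp add: fgmod_def)
  obtain h where "h \<in> rhom ?A ?D M" "h ` carrier ?D = carrier M"
    using M unfolding riso_def bij_betw_def by blast
  then show "A.semisimple M" using A.semisimple_image[OF D rM _ _ ss] by blast
qed

text \<open>A heart vertex lies in the support of the n-th cosyzygy of the semisimple module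
  \<open>A0\<close>, and n cosyzygies produce a walk of length n.\<close>

lemma heart_walk:
  assumes "j \<in> heart_verts TYPE('k::field) G"
  shows "has_walk G (card (verts G)) j"
proof -
  let ?A = "rad_sq_zero G :: ('a \<times> 'b list \<Rightarrow> 'k) set ring"
  interpret A: rsz_ring G ?A rsz_el by (rule rsz_ring_rad_sq_zero)
  let ?M = "(cosyzygy ?A ^^ card (verts G)) (A0 G)"
  \<comment> \<open>This identifies the residue class \<open>idem G i\<close> with the coordinate
    idempotent, so \<open>supp\<close> and \<open>support\<close> name the same set.\<close>
  have "basis_path (i, []) = (short_elem (\<lambda>j. if j = i then 1 else 0) (\<lambda>_. 0) :: 'a \<times> 'b list \<Rightarrow> 'k)" if "i \<in> verts G" for i
    using that by (auto simp: basis_path_def short_elem_def fun_eq_iff split: list.splits)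
  then have "idem G i = A.ep i" if "i \<in> verts G" for i
    using that by (simp add: idem_def A.ep_def rsz_el_def)
  then have "supp G ?M = A.support ?M" unfolding supp_def A.support_def by auto
  moreover have "j \<in> supp G ?M" using assms unfolding heart_verts_def by (simp add: Let_def)
  ultimately show ?thesis using A.cosyzygy_iterate[OF A0_properties[OF refl], of "card (verts G)"] by blast
qed

text \<open>By \<open>no_walk_card\<close>, a vertex whose walks are bounded has no walk of length
  n, so by \<open>heart_walk\<close> it lies in the member. A walk from it extends inside the member
  to a sink, where its length is counted by the supremum.\<close>

lemma walk_le_sink_length:
  assumes "j \<in> verts G" "\<not> has_walk G m j" "has_walk G k j"
  shows "enat k \<le> sink_length TYPE('k::field) G"
proof -
  let ?S = "verts G - verts (heart TYPE('k) G)"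
  have "j \<in> ?S" if "j \<in> verts G" "\<not> has_walk G m j" for j m
    using that no_walk_card[OF that] heart_walk[where 'k='k, of j] by (auto simp: heart_def)
  then obtain p v where p: "pre_digraph.awalk (G \<restriction> ?S) j p v" "sink G v" "k \<le> length p"
    using walk_to_sink[of ?S j m k] assms by blast
  have "enat (length p) \<le> sink_length TYPE('k) G"
    unfolding sink_length_def member_quiver_def using p(1,2) by (intro SUP_upper) blast
  then show ?thesis using p(3) by (meson enat_ord_simps(1) order_trans)
qed

end

theorem proposition4p64:
  fixes Q :: "('v, 'a) pre_digraph"
    and A :: "('v \<times> 'a list \<Rightarrow> 'k::field) set ring"
    and n :: nat
  assumes "fin_digraph Q" and "Digraph_Component.connected Q"
    and "A = rad_sq_zero Q"
    and "n = card (verts Q)"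
    and "0 < phi_dim A" and "phi_dim A \<le> enat (n - 1)"
  shows "psi_dim A \<le> enat (n - 1) + sink_length TYPE('k) Q"
proof (cases "sink_length TYPE('k) Q")
  case infinity
  then show ?thesis by simp
next
  case (enat D)
  interpret Q: fin_digraph Q by fact
  interpret A: rsz_ring Q A Q.rsz_el unfolding assms(3) by (rule Q.rsz_ring_rad_sq_zero)
  \<comment> \<open>A walk of length D + 1 from a vertex with bounded walks would give D + 1 \<le>
    D, so one and the same D serves for all such vertices.\<close>
  have bound: "\<not> has_walk Q (Suc D) j" if "j \<in> verts Q" "\<not> has_walk Q m j" for j m
    using Q.walk_le_sink_length[where 'k='k, OF that, of "Suc D"] enat by auto
  have "(0::enat) < enat (n - 1)" using assms(5,6) by (rule less_le_trans)
  then have n: "0 < n - 1" by (simp add: zero_enat_def)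
  have "psi A M \<le> enat (n - 1 + D)" if M: "M \<in> fgmod A" for M
  proof (rule A.psi_le[OF bound M _ n])
    have "enat (phi A M) \<le> phi_dim A" unfolding phi_dim_def using M by (rule SUP_upper)
    then show "phi A M \<le> n - 1" using assms(6) by (meson enat_ord_simps(1) order_trans)
  qed
  then show ?thesis unfolding psi_dim_def enat by (simp add: SUP_least)
qed

end
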